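(* Let $D$ be a domain in $\mathbb{R}^n$, $n\ge 2$, such that $\partial D$ has positive conformal capacity, and let $x_0\in D$. Then there is $r_0>0$ such that for all $0<r<r_0$ the $\mu_D$-sphere $S_{\mu_D}(x_0,r)=\{y\in D:\mu_D(x_0,y)=r\}$ is a topological sphere in $\mathbb{R}^n$ which satisfies the interior and exterior cone conditions, and the $\mu_D$-ball $B_{\mu_D}(x_0,r)=\{y\in D:\mu_D(x_0,y)<r\}$ is starlike with respect to $x_0$.
   Context: Let $\overline{\mathbb{R}}^n=\mathbb{R}^n\cup\{\infty\}$ be the one-point compactification. Boundaries of domains are taken in $\overline{\mathbb{R}}^n$. Condenser and capacity: a condenser is a pair $(D,K)$ with $D$ a domain and $K$ a non-empty compact subset of $D$. For $D\subset\mathbb{R}^n$, its (conformal) capacity is $\mathrm{cap}(D,K)=\inf_u\int_{D\setminus K}|\nabla u|^n\,dm$, where $m$ is $n$-dimensional Lebesgue measure and the infimum is over all $C^1$ functions $u$ with compact support in $D$ satisfying $u\ge 1$ on $K$. Positive capacity: a compact set $E\subset\overline{\mathbb{R}}^n$, $E\neq\overline{\mathbb{R}}^n$, has zero (conformal) capacity if, after applying a Möbius transformation $T$ of $\overline{\mathbb{R}}^n$ with $T(E)\subset\mathbb{R}^n$, there is a bounded domain $G\supset T(E)$ in $\mathbb{R}^n$ with $\mathrm{cap}(G,T(E))=0$ (the empty set has zero capacity). Otherwise $E$ has positive (conformal) capacity. Modulus metric: for a domain $D\subset\mathbb{R}^n$ with $\partial D$ of positive capacity and $x,y\in D$, $x\ne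 y$, $\mu_D(x,y)=\inf\{\mathrm{cap}(D,\gamma):\gamma\in C_{xy}\}$, where $C_{xy}$ is the family of all Jordan arcs joining $x$ to $y$ in $D$; $\mu_D(x,x)=0$. This is a metric on $D$. A topological sphere is a set homeomorphic to the unit sphere $\{x\in\mathbb{R}^n:|x|=1\}$. A set $A$ is starlike with respect to $x_0$ if for every $y\in A$ the segment $\{x_0+t(y-x_0):0\le t\le 1\}$ lies in $A$. Cone conditions: a spherical cone with vertex $x$, radius $\rho>0$, axis direction $v\neq 0$ and angle $\alpha\in(0,\pi/2)$ is the set of points $x+w$ with $0<|w|<\rho$ such that the angle between $w$ and $v$ is less than $\alpha$. The $\mu_D$-sphere $S_{\mu_D}(x_0,r)$ satisfies the interior (respectively exterior) cone condition if every $x\in S_{\mu_D}(x_0,r)$ is the vertex of some spherical cone contained in $B_{\mu_D}(x_0,r)$ (respectively in $D\setminus\overline{B_{\mu_D}(x_0,r)}$). *)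

theory Defs
  imports "HOL-Analysis.Analysis"
begin

section \<open>Conformal capacity of condensers\<close>

text \<open>The competitors are total functions: a \<open>C\<^sup>1\<close> function with compact support in \<open>D\<close>
  is identified with its extension by zero. Since the gradient \<open>g\<close> of \<open>u\<close> is unique, the infimum is
  over all admissible \<open>u\<close>. Values are in \<^typ>\<open>ennreal\<close>, so that no integrability or
  boundedness side condition is hidden in a default value.\<close>

definition C1_compact_support_in :: "(real^'n) set \<Rightarrow> (real^'n \<Rightarrow> real) \<Rightarrow> (real^'n \<Rightarrow> real^'n) \<Rightarrow> bool" where
  "C1_compact_support_in D u g \<longleftrightarrow>
     (\<forall>x. GDERIV u x :> g x) \<and> continuous_on UNIV g \<and>
     compact (closure (support_on UNIV u)) \<and> closure (support_on UNIV u) \<subseteq> D"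

definition capacity :: "(real^'n) set \<Rightarrow> (real^'n) set \<Rightarrow> ennreal" where
  "capacity D K =
     Inf {\<integral>\<^sup>+x\<in>D - K. ennreal (norm (g x) ^ CARD('n)) \<partial>lborel | u g.
            C1_compact_support_in D u g \<and> (\<forall>x\<in>K. 1 \<le> u x)}"


section \<open>The one-point compactification and sets of positive capacity\<close>

text \<open>The point at infinity is \<^term>\<open>None\<close>, and \<open>x \<in> \<real>\<^sup>n\<close> is represented by \<^term>\<open>Some x\<close>.\<close>

abbreviation extended_space :: "(real^'n) option topology" where
  "extended_space \<equiv> Alexandroff_compactification euclidean"

fun sphere_reflection :: "real^'n \<Rightarrow> real \<Rightarrow> (real^'n) option \<Rightarrow> (real^'n) option" where
  "sphere_reflection a r None = Some a"
| "sphere_reflection a r (Some x) =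
     (if x = a then None else Some (a + (r\<^sup>2 / (norm (x - a))\<^sup>2) *\<^sub>R (x - a)))"

text \<open>Reflection in the hyperplane \<open>{x. v \<bullet> x = c}\<close>.\<close>

fun hyperplane_reflection :: "real^'n \<Rightarrow> real \<Rightarrow> (real^'n) option \<Rightarrow> (real^'n) option" where
  "hyperplane_reflection v c None = None"
| "hyperplane_reflection v c (Some x) = Some (x - (2 * (v \<bullet> x - c) / (norm v)\<^sup>2) *\<^sub>R v)"

text \<open>Finite compositions of reflections in spheres and hyperplanes.\<close>

inductive moebius :: "((real^'n) option \<Rightarrow> (real^'n) option) \<Rightarrow> bool" where
  moebius_id: "moebius id"
| moebius_sphere: "moebius T \<Longrightarrow> 0 < r \<Longrightarrow> moebius (sphere_reflection a r \<circ> T)"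
| moebius_hyperplane: "moebius T \<Longrightarrow> v \<noteq> 0 \<Longrightarrow> moebius (hyperplane_reflection v c \<circ> T)"

definition zero_capacity :: "(real^'n) option set \<Rightarrow> bool" where
  "zero_capacity E \<longleftrightarrow>
     compactin extended_space E \<and> E \<noteq> UNIV \<and>
     (E = {} \<or>
      (\<exists>T K G. moebius T \<and> T ` E = Some ` K \<and>
         open G \<and> connected G \<and> bounded G \<and> K \<subseteq> G \<and> capacity G K = 0))"

definition positive_capacity :: "(real^'n) option set \<Rightarrow> bool" where
  "positive_capacity E \<longleftrightarrow>
     compactin extended_space E \<and> E \<noteq> UNIV \<and> \<not> zero_capacity E"


section \<open>The modulus metric\<close>

definition modulus_metric :: "(real^'n) set \<Rightarrow> real^'n \<Rightarrow> real^'n \<Rightarrow> ennreal" where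
  "modulus_metric D x y =
     (if x = y then 0
      else INF \<gamma>\<in>{\<gamma>. arc \<gamma> \<and> path_image \<gamma> \<subseteq> D \<and> pathstart \<gamma> = x \<and> pathfinish \<gamma> = y}.
             capacity D (path_image \<gamma>))"

definition modulus_ball :: "(real^'n) set \<Rightarrow> real^'n \<Rightarrow> real \<Rightarrow> (real^'n) set" where
  "modulus_ball D x0 r = {y \<in> D. modulus_metric D x0 y < ennreal r}"

definition modulus_sphere :: "(real^'n) set \<Rightarrow> real^'n \<Rightarrow> real \<Rightarrow> (real^'n) set" where
  "modulus_sphere D x0 r = {y \<in> D. modulus_metric D x0 y = ennreal r}"


section \<open>Starlikeness and cone conditions\<close>

text \<open>In contrast to \<^const>\<open>starlike\<close>, the centre is prescribed.\<close>

definition starlike_wrt :: "real^'n \<Rightarrow> (real^'n) set \<Rightarrow> bool" where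
  "starlike_wrt x0 A \<longleftrightarrow> (\<forall>y\<in>A. closed_segment x0 y \<subseteq> A)"

definition spherical_cone :: "real^'n \<Rightarrow> real \<Rightarrow> real^'n \<Rightarrow> real \<Rightarrow> (real^'n) set" where
  "spherical_cone x \<rho> v \<alpha> =
     {x + w | w. 0 < norm w \<and> norm w < \<rho> \<and> arccos ((w \<bullet> v) / (norm w * norm v)) < \<alpha>}"

definition vertex_of_cone_in :: "real^'n \<Rightarrow> (real^'n) set \<Rightarrow> bool" where
  "vertex_of_cone_in x A \<longleftrightarrow>
     (\<exists>\<rho> v \<alpha>. 0 < \<rho> \<and> v \<noteq> 0 \<and> 0 < \<alpha> \<and> \<alpha> < pi / 2 \<and> spherical_cone x \<rho> v \<alpha> \<subseteq> A)"

definition interior_cone_condition :: "(real^'n) set \<Rightarrow> real^'n \<Rightarrow> real \<Rightarrow> bool" where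
  "interior_cone_condition D x0 r \<longleftrightarrow>
     (\<forall>x\<in>modulus_sphere D x0 r. vertex_of_cone_in x (modulus_ball D x0 r))"

definition exterior_cone_condition :: "(real^'n) set \<Rightarrow> real^'n \<Rightarrow> real \<Rightarrow> bool" where
  "exterior_cone_condition D x0 r \<longleftrightarrow>
     (\<forall>x\<in>modulus_sphere D x0 r. vertex_of_cone_in x (D - closure (modulus_ball D x0 r)))"

end

theory Submission
  imports Defs "HOL-Probability.Probability_Measure"
begin

text \<open>The theorem says that, close to \<open>x0\<close>, the function \<open>m y = modulus_metric D x0 y\<close> behaves like a
  norm: it is strictly increasing along the rays from \<open>x0\<close>, at a definite rate, and locally Lipschitz.
  The shape of balls and spheres follows from two estimates, in which \<open>\<delta>\<close> is small and \<open>c\<close>, \<open>C\<close> depend on \<open>y\<close> locally uniformly: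

  \<^item> \<open>m (x0 + exp (- \<delta>) *\<^sub>R (y - x0)) \<le> (1 - c * \<delta>) * m y\<close> for \<open>y\<close> close to \<open>x0\<close>
    (\<open>modulus_metric_radial_contraction\<close>);
  \<^item> \<open>m z' \<le> (1 + C * dist z z') * m z\<close> for \<open>z\<close>, \<open>z'\<close> close to \<open>y\<close>
    (\<open>modulus_metric_locally_lipschitz\<close>).

  A step of length \<open>\<tau>\<close> towards \<open>x0\<close> decreases \<open>m\<close> by a proportion of order \<open>\<tau>\<close>, and a sideways step of length
  \<open>\<kappa> * \<tau>\<close> with small \<open>\<kappa>\<close> cannot make up for it. This gives the interior cones, and a step away from \<open>x0\<close> gives
  the exterior ones. Monotonicity on rays makes the balls starlike and the radial projection of a sphere to
  the unit sphere injective; the intermediate value theorem makes it surjective. Besides the two estimates, these deductions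
  use that \<open>m\<close> is positive off \<open>x0\<close> and tends to \<open>0\<close> at \<open>x0\<close>; they are carried out in the locale \<open>radial_gauge\<close>. The spheres of small radius
  lie close to \<open>x0\<close> because \<open>m\<close> is bounded below away from \<open>x0\<close> (\<open>modulus_metric_far_lower_bound\<close>).

  Both estimates come from a substitution. Let a near-minimal arc \<open>\<gamma>\<close> from \<open>x0\<close> to \<open>y\<close> and a near-minimal
  function \<open>u\<close> for it be given, and let \<open>\<Phi>\<close> be a diffeomorphism that fixes \<open>x0\<close>, is the identity near the
  boundary of \<open>D\<close> and moves \<open>z\<close> to \<open>y\<close>. The preimage of \<open>\<gamma>\<close> under \<open>\<Phi>\<close> and \<open>u \<circ> \<Phi>\<close> are competitors for \<open>m z\<close>, so
  that \<open>m z\<close> is at most the energy of \<open>u \<circ> \<Phi>\<close> (\<open>modulus_metric_pullback_le\<close>). Neither extremal arcs nor extremal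
  functions occur. For the Lipschitz estimate, \<open>\<Phi>\<close> is the identity plus a small bump. For the contraction,
  \<open>\<Phi> x = x0 + exp (\<epsilon> * Q (x - x0)) *\<^sub>R (x - x0)\<close>, where \<open>Q\<close> is a truncated logarithm of \<open>1 / norm x\<close>. In
  logarithmic polar coordinates this map compresses the radial direction by a factor \<open>1 - \<epsilon>\<close> in a long annulus. Its
  effect on the energy \<open>E\<close> of \<open>u\<close> is a gain proportional to the energy of the radial derivative, against
  a loss proportional to \<open>E\<close>; to first order the new energy is \<open>(1 + \<epsilon>) * E - 2 * \<epsilon> * I\<close>, where \<open>I\<close> is the
  radial energy (\<open>modulus_metric_radial_stretch\<close>). So \<open>m\<close> decreases as soon as more than half of the energy is
  radial.

  That almost all of the energy is radial when \<open>s = norm (y - x0)\<close> is small is the analytic core. The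
  truncated logarithm is a competitor on the segment from \<open>x0\<close> to \<open>y\<close> and shows that \<open>m y\<close> is at most
  about \<open>\<omega> / ln (1 / s) ^ (n - 1)\<close>, where \<open>\<omega>\<close> is the area of the unit sphere (\<open>modulus_metric_le_log\<close>).
  Conversely, Hoelder's inequality along rays shows that the radial energy of any function is at least about
  \<open>\<omega> / ln (1 / s) ^ (n - 1)\<close> times the \<open>n\<close>-th power of the difference of its means over
  two shells of radii about \<open>s\<close> and about \<open>1\<close> (\<open>shell_mean_radial_increment\<close>). For a near-minimal \<open>u\<close> this difference
  tends to \<open>1\<close> with \<open>s\<close>. The inner mean is almost at least \<open>1\<close>, since \<open>u \<ge> 1\<close> on an arc that meets all spheres of
  radius at most \<open>s\<close>, and on one of them the energy does not concentrate
  (\<open>shell_mean_near_continuum\<close>). The outer mean is almost at most \<open>0\<close>, since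
  otherwise \<open>u\<close>, seen through the inversion in a sphere about \<open>x0\<close>, would give competitors of too small an energy for the boundary
  (\<open>shell_mean_outer_bound\<close>); this is where positive capacity enters.\<close>

section \<open>Change of variables with rank-one perturbed derivatives\<close>

lemma det_rank_one_update_axis:
  fixes c :: "real^'n"
  shows "det (\<chi> i j. (if i = j then 1 else 0) + (if j = k then c $ i else 0)) = 1 + c $ k"
proof -
  have "(\<chi> i j. (if i = j then 1 else 0) + (if j = k then c $ i else 0)) =
        (\<chi> i j. if j = k then (mat 1 *v (axis k 1 + c)) $ i else (mat 1 :: real^'n^'n) $ i $ j)"
    by (auto simp: vec_eq_iff axis_def mat_def[symmetric]) (simp_all add: mat_def)
  then show ?thesis
    using cramer_lemma[of k "mat 1" "axis k 1 + c"] by simp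
qed

text \<open>An orthogonal map that takes a coordinate axis to the direction of \<open>p\<close> conjugates the given map to one
  whose matrix differs from the identity in a single column.\<close>

lemma det_rank_one_update:
  fixes p q :: "real^'n"
  shows "det (matrix (\<lambda>h. h + (p \<bullet> h) *\<^sub>R q)) = 1 + p \<bullet> q"
proof (cases "p = 0")
  case True
  then show ?thesis by (simp add: matrix_id_mat_1[unfolded id_def])
next
  case False
  define k where "k = (undefined :: 'n)"
  define e where "e = p /\<^sub>R norm p"
  have "norm e = 1" using False by (simp add: e_def)
  have "\<exists>f :: real^'n \<Rightarrow> real^'n. orthogonal_transformation f \<and> f (axis k 1) = e"
    by (rule orthogonal_transformation_exists_1[OF norm_axis_1[of k] \<open>norm e = 1\<close>]) blast
  then obtain f :: "real^'n \<Rightarrow> real^'n" where f: "orthogonal_transformation f" "f (axis k 1) = e" by blast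
  have lf: "linear f" using f(1) orthogonal_transformation_linear by blast
  define g where "g = inv f"
  have bij: "bij f" using orthogonal_transformation_bij[OF f(1)] .
  have g: "linear g" "\<And>x. g (f x) = x" "\<And>x. f (g x) = x"
    using orthogonal_transformation_linear[OF orthogonal_transformation_inv[OF f(1)]]
    by (simp_all add: g_def bij_is_inj[OF bij] surj_f_inv_f[OF bij_is_surj[OF bij]])
  have ip: "f x \<bullet> f y = x \<bullet> y" for x y using f(1) by (simp add: orthogonal_transformation_def)
  define c where "c = norm p *\<^sub>R g q"
  define B where "B = (\<lambda>h::real^'n. h + (h $ k) *\<^sub>R c)"
  have lB: "linear B"
    unfolding B_def by (intro linearI) (auto simp: algebra_simps)
  have pe: "p = norm p *\<^sub>R f (axis k 1)" using False f(2) by (simp add: e_def)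
  have fgq: "f c = norm p *\<^sub>R q" by (simp add: c_def linear_scale[OF lf] g)
  have eq: "(\<lambda>h. h + (p \<bullet> h) *\<^sub>R q) = f \<circ> B \<circ> g"
  proof
    fix h
    have "p \<bullet> h = norm p * (axis k 1 \<bullet> g h)"
      using ip[of "axis k 1" "g h"] by (subst pe) (simp add: g)
    then have "p \<bullet> h = norm p * (g h $ k)" by (simp add: inner_axis')
    then show "h + (p \<bullet> h) *\<^sub>R q = (f \<circ> B \<circ> g) h"
      by (simp add: B_def linear_add[OF lf] linear_scale[OF lf] g fgq)
  qed
  have "det (matrix (f \<circ> B \<circ> g)) = det (matrix f) * det (matrix B) * det (matrix g)"
    using lf lB g(1) by (simp add: matrix_compose linear_compose det_mul)
  moreover have "det (matrix f) * det (matrix g) = 1"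
    using matrix_compose[OF g(1) lf] det_mul[of "matrix f" "matrix g"]
    by (metis comp_apply det_I eq_id_iff g(3) matrix_id_mat_1)
  moreover have "det (matrix B) = 1 + c $ k"
  proof -
    have "matrix B = (\<chi> i j. (if i = j then 1 else 0) + (if j = k then c $ i else 0))"
      by (auto simp: matrix_def B_def vec_eq_iff axis_def)
    then show ?thesis by (simp add: det_rank_one_update_axis)
  qed
  moreover have "p \<bullet> q = c $ k"
  proof -
    have "p \<bullet> q = norm p * (axis k 1 \<bullet> g q)"
      using ip[of "axis k 1" "g q"] by (subst pe) (simp add: g)
    then show ?thesis by (simp add: inner_axis' c_def)
  qed
  ultimately show ?thesis
    unfolding eq by (metis mult.assoc mult.commute mult_1)
qed

lemma det_scaled_rank_one_update:
  fixes p q :: "real^'n"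
  shows "det (matrix (\<lambda>h. c *\<^sub>R (h + (p \<bullet> h) *\<^sub>R q))) = c ^ CARD('n) * (1 + p \<bullet> q)"
proof -
  have lin: "linear (\<lambda>h. h + (p \<bullet> h) *\<^sub>R q)"
    by (intro linearI) (auto simp: algebra_simps inner_add_right)
  have lc: "linear ((*\<^sub>R) c :: real^'n \<Rightarrow> real^'n)"
    by (intro linearI) (auto simp: algebra_simps)
  have "matrix (\<lambda>h. c *\<^sub>R (h + (p \<bullet> h) *\<^sub>R q)) = matrix ((*\<^sub>R) c) ** matrix (\<lambda>h. h + (p \<bullet> h) *\<^sub>R q)"
    using matrix_compose[OF lin lc] by (simp add: o_def)
  then show ?thesis by (simp add: det_mul det_matrix_scaleR det_rank_one_update)
qed

text \<open>For a nonnegative integrand the integral over the image is at most the one over the whole space, so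
  that the image need not be identified in applications.\<close>

lemma change_of_variables_le_wellorder:
  fixes \<Phi> :: "real^'n::{finite,wellorder} \<Rightarrow> real^'n::_" and F :: "real^'n::_ \<Rightarrow> real"
  assumes S: "open S" and inj: "inj_on \<Phi> S"
    and der: "\<And>x. x \<in> S \<Longrightarrow> (\<Phi> has_derivative \<Phi>' x) (at x)"
    and F: "integrable lborel F" "\<And>x. 0 \<le> F x"
  shows "(\<integral>\<^sup>+x\<in>S. ennreal (\<bar>det (matrix (\<Phi>' x))\<bar> * F (\<Phi> x)) \<partial>lborel) \<le> ennreal (integral\<^sup>L lborel F)"
proof -
  let ?f = "\<lambda>x. vec (F x) :: real^1"
  have cont: "continuous_on S \<Phi>"
    using der by (meson continuous_at_imp_continuous_on has_derivative_continuous)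
  have opi: "open (\<Phi> ` S)" using invariance_of_domain[OF cont S inj] .
  have Fleb: "integrable lebesgue F" using F(1) by (simp add: integrable_completion)
  then have FU: "F absolutely_integrable_on UNIV" by (simp add: set_integrable_def)
  then have FS: "F absolutely_integrable_on (\<Phi> ` S)"
    by (rule set_integrable_subset) (use opi in auto)
  have Fb: "F \<in> borel_measurable lborel" using F(1) by auto
  have der': "\<And>x. x \<in> S \<Longrightarrow> (\<Phi> has_derivative \<Phi>' x) (at x within S)"
    using der has_derivative_at_withinI by blast
  have Sl: "S \<in> sets lebesgue" using S by auto
  have fabs: "?f absolutely_integrable_on (\<Phi> ` S)"
    using FS by (simp add: absolutely_integrable_on_1_iff)
  have *: "(\<lambda>x. \<bar>det (matrix (\<Phi>' x))\<bar> *\<^sub>R ?f(\<Phi> x)) absolutely_integrable_on S \<and>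
     integral S (\<lambda>x. \<bar>det (matrix (\<Phi>' x))\<bar> *\<^sub>R ?f(\<Phi> x)) = integral (\<Phi> ` S) ?f"
    using has_absolute_integral_change_of_variables[OF Sl der' inj, of ?f "integral (\<Phi> ` S) ?f"] fabs by blast
  then have a: "(\<lambda>x. \<bar>det (matrix (\<Phi>' x))\<bar> * F (\<Phi> x)) absolutely_integrable_on S"
    by (simp add: absolutely_integrable_on_1_iff)
  have b: "integral S (\<lambda>x. \<bar>det (matrix (\<Phi>' x))\<bar> * F (\<Phi> x)) = integral (\<Phi> ` S) F"
    using * by (simp add: integral_on_1_eq)
  have "(\<integral>\<^sup>+x\<in>S. ennreal (\<bar>det (matrix (\<Phi>' x))\<bar> * F (\<Phi> x)) \<partial>lborel)
     = (\<integral>\<^sup>+x. ennreal (indicator S x *\<^sub>R (\<bar>det (matrix (\<Phi>' x))\<bar> * F (\<Phi> x))) \<partial>lebesgue)"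
    by (subst nn_integral_completion) (auto intro!: nn_integral_cong simp: indicator_def)
  also have "\<dots> = ennreal (\<integral>x. indicator S x *\<^sub>R (\<bar>det (matrix (\<Phi>' x))\<bar> * F (\<Phi> x)) \<partial>lebesgue)"
    by (rule nn_integral_eq_integral) (use a F(2) in \<open>auto simp: set_integrable_def\<close>)
  also have "(\<integral>x. indicator S x *\<^sub>R (\<bar>det (matrix (\<Phi>' x))\<bar> * F (\<Phi> x)) \<partial>lebesgue)
     = integral S (\<lambda>x. \<bar>det (matrix (\<Phi>' x))\<bar> * F (\<Phi> x))"
    using set_lebesgue_integral_eq_integral(2)[OF a] by (simp add: set_lebesgue_integral_def)
  also have "\<dots> = (LINT x:(\<Phi> ` S)|lebesgue. F x)"
    using b set_lebesgue_integral_eq_integral(2)[OF FS] by simp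
  also have "\<dots> \<le> integral\<^sup>L lebesgue F"
    unfolding set_lebesgue_integral_def
    by (rule integral_mono) (use FS Fleb F(2) in \<open>auto simp: set_integrable_def indicator_def\<close>)
  also have "integral\<^sup>L lebesgue F = integral\<^sup>L lborel F" 
    by (rule integral_completion) (use F in auto)
  finally show ?thesis by (simp add: ennreal_leI)
qed

text \<open>A copy of the index type, well-ordered by an enumeration of its elements. The coordinate change between
  the two copies of \<open>\<real>\<^sup>n\<close> is an isometry, which extends the substitution rule from well-ordered to arbitrary
  finite index types.\<close>

typedef 'a enumerated = "UNIV :: 'a set"
  by auto

lemma bij_Rep_enumerated: "bij (Rep_enumerated :: 'a enumerated \<Rightarrow> 'a)"
  by (metis Abs_enumerated_inverse Rep_enumerated_inject UNIV_I bij_betw_def injI surj_def)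

instance enumerated :: (finite) finite
  by standard (metis bij_Rep_enumerated bij_betw_finite finite)

instantiation enumerated :: (finite) wellorder
begin

definition less_eq_enumerated :: "'a enumerated \<Rightarrow> 'a enumerated \<Rightarrow> bool" where
  "less_eq_enumerated x y \<longleftrightarrow> to_nat (Rep_enumerated x) \<le> to_nat (Rep_enumerated y)"

definition less_enumerated :: "'a enumerated \<Rightarrow> 'a enumerated \<Rightarrow> bool" where
  "less_enumerated x y \<longleftrightarrow> to_nat (Rep_enumerated x) < to_nat (Rep_enumerated y)"

instance
proof
  fix x y z :: "'a enumerated" and P
  show "x < y \<longleftrightarrow> x \<le> y \<and> \<not> y \<le> x"
    by (auto simp: less_eq_enumerated_def less_enumerated_def)
  show "x \<le> x" by (simp add: less_eq_enumerated_def)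
  show "x \<le> y \<Longrightarrow> y \<le> z \<Longrightarrow> x \<le> z" by (simp add: less_eq_enumerated_def)
  show "x \<le> y \<Longrightarrow> y \<le> x \<Longrightarrow> x = y"
    by (simp add: less_eq_enumerated_def Rep_enumerated_inject)
  show "x \<le> y \<or> y \<le> x" by (auto simp: less_eq_enumerated_def)
  assume step: "\<And>x::'a enumerated. (\<And>y. y < x \<Longrightarrow> P y) \<Longrightarrow> P x"
  show "P x"
    by (induction "to_nat (Rep_enumerated x)" arbitrary: x rule: less_induct)
      (metis step less_enumerated_def)
qed

end

lemma card_enumerated: "CARD('a enumerated) = CARD('a)"
  by (rule bij_betw_same_card[OF bij_Rep_enumerated])

definition relabel :: "real^'n \<Rightarrow> real^('n enumerated)" where
  "relabel x = (\<chi> i. x $ Rep_enumerated i)"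

definition unlabel :: "real^('n enumerated) \<Rightarrow> real^'n" where
  "unlabel y = (\<chi> i. y $ Abs_enumerated i)"

lemma relabel_unlabel [simp]: "relabel (unlabel y) = y" "unlabel (relabel x) = x"
  by (simp_all add: relabel_def unlabel_def vec_eq_iff Abs_enumerated_inverse Rep_enumerated_inverse)

lemma inner_relabel [simp]: "relabel x \<bullet> relabel y = x \<bullet> y"
  unfolding inner_vec_def relabel_def
  by (simp, rule sum.reindex_bij_betw[OF bij_Rep_enumerated])

lemma linear_relabel: "linear relabel" and linear_unlabel: "linear unlabel"
  by (auto intro!: linearI simp: relabel_def unlabel_def vec_eq_iff)

lemma distr_unlabel: "distr lborel borel (unlabel :: real^('n enumerated) \<Rightarrow> real^'n) = lborel"
proof (rule lborel_eqI[symmetric])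
  have [measurable]: "(unlabel :: real^('n enumerated) \<Rightarrow> real^'n) \<in> borel_measurable borel"
    by (intro borel_measurable_continuous_onI linear_continuous_on linear_conv_bounded_linear[THEN iffD1] linear_unlabel)
  fix l u :: "real^'n"
  assume le: "\<And>b. b \<in> Basis \<Longrightarrow> l \<bullet> b \<le> u \<bullet> b"
  have lu: "l $ i \<le> u $ i" for i
    using le[of "axis i 1"] by (simp add: inner_axis)
  have "unlabel -` box l u = box (relabel l) (relabel u)"
    by (auto simp: mem_box_cart relabel_def unlabel_def)
      (metis Rep_enumerated_inverse Abs_enumerated_inverse UNIV_I)+
  then have "emeasure (distr lborel borel unlabel) (box l u) = emeasure lborel (box (relabel l) (relabel u))"
    by (simp add: emeasure_distr)
  also have "\<dots> = ennreal (\<Prod>b\<in>Basis. (relabel u - relabel l) \<bullet> b)"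
    by (subst emeasure_lborel_box) (auto simp: Basis_vec_def inner_axis relabel_def lu)
  also have "(\<Prod>b\<in>Basis. (relabel u - relabel l) \<bullet> b) = (\<Prod>i\<in>UNIV. (u - l) $ Rep_enumerated i)"
    unfolding Basis_vec_def
    by (subst prod.UNION_disjoint) (auto simp: inner_axis relabel_def axis_eq_axis)
  also have "\<dots> = (\<Prod>i\<in>UNIV. (u - l) $ i)"
    by (rule prod.reindex_bij_betw[OF bij_Rep_enumerated])
  also have "\<dots> = (\<Prod>b\<in>Basis. (u - l) \<bullet> b)"
    unfolding Basis_vec_def
    by (subst prod.UNION_disjoint) (auto simp: inner_axis axis_eq_axis)
  finally show "emeasure (distr lborel borel unlabel) (box l u) = ennreal (\<Prod>b\<in>Basis. (u - l) \<bullet> b)" .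
qed simp

text \<open>The three kinds of substitution to come (displacement by a bump, radial compression, inversion in
  a sphere) have derivatives of this form, a multiple of a rank-one perturbation of the identity. Their Jacobian
  is explicit, and the form is stable under the change of index type.\<close>

lemma change_of_variables_le:
  fixes \<Phi> :: "real^'n \<Rightarrow> real^'n" and F :: "real^'n \<Rightarrow> real"
  assumes S: "open S" and inj: "inj_on \<Phi> S"
    and der: "\<And>x. x \<in> S \<Longrightarrow> (\<Phi> has_derivative (\<lambda>h. c x *\<^sub>R (h + (p x \<bullet> h) *\<^sub>R q x))) (at x)"
    and F: "integrable lborel F" "\<And>x. 0 \<le> F x"
    and meas: "(\<lambda>x. ennreal (\<bar>c x\<bar> ^ CARD('n) * \<bar>1 + p x \<bullet> q x\<bar> * F (\<Phi> x)) * indicator S x) \<in> borel_measurable borel"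
  shows "(\<integral>\<^sup>+x\<in>S. ennreal (\<bar>c x\<bar> ^ CARD('n) * \<bar>1 + p x \<bullet> q x\<bar> * F (\<Phi> x)) \<partial>lborel)
           \<le> ennreal (integral\<^sup>L lborel F)"
proof -
  let ?U = "unlabel :: real^('n enumerated) \<Rightarrow> real^'n"
  let ?R = "relabel :: real^'n \<Rightarrow> real^('n enumerated)"
  have bl: "bounded_linear ?U" "bounded_linear ?R"
    using linear_unlabel linear_relabel by (auto simp: linear_conv_bounded_linear)
  have [measurable]: "?U \<in> borel_measurable borel"
    by (intro borel_measurable_continuous_onI linear_continuous_on bl)
  have Fb[measurable]: "F \<in> borel_measurable borel" using F(1) by auto
  have opS: "open (?U -` S)"
    using S bl(1) by (simp add: continuous_open_vimage linear_continuous_on continuous_on_eq_continuous_at linear_continuous_at)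
  have inj': "inj_on (?R \<circ> \<Phi> \<circ> ?U) (?U -` S)"
    using inj by (auto simp: inj_on_def) (metis relabel_unlabel)
  have der': "((?R \<circ> \<Phi> \<circ> ?U) has_derivative
      (\<lambda>h. c (?U y) *\<^sub>R (h + (?R (p (?U y)) \<bullet> h) *\<^sub>R ?R (q (?U y))))) (at y)" if "y \<in> ?U -` S" for y
  proof -
    have "((\<Phi> \<circ> ?U) has_derivative (\<lambda>h. c (?U y) *\<^sub>R (h + (p (?U y) \<bullet> h) *\<^sub>R q (?U y))) \<circ> ?U) (at y)"
      by (rule diff_chain_at) (use that der bl bounded_linear_imp_has_derivative in auto)
    then have "((?R \<circ> (\<Phi> \<circ> ?U)) has_derivative ?R \<circ> ((\<lambda>h. c (?U y) *\<^sub>R (h + (p (?U y) \<bullet> h) *\<^sub>R q (?U y))) \<circ> ?U)) (at y)"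
      by (rule diff_chain_at) (use bl bounded_linear_imp_has_derivative in auto)
    moreover have "?R ((c (?U y) *\<^sub>R (?U h + (p (?U y) \<bullet> ?U h) *\<^sub>R q (?U y)))) =
        c (?U y) *\<^sub>R (h + (?R (p (?U y)) \<bullet> h) *\<^sub>R ?R (q (?U y)))" for h
      by (metis (no_types, lifting) inner_relabel linear_add linear_cmul linear_relabel relabel_unlabel(1))
    ultimately show ?thesis by (simp add: o_def)
  qed
  have *: "lborel = distr lborel borel ?U" by (simp add: distr_unlabel)
  have iF: "integrable lborel (F \<circ> ?U)"
    using F(1) by (subst (asm) *) (simp add: integrable_distr_eq o_def)
  have ic: "integral\<^sup>L lborel (F \<circ> ?U) = integral\<^sup>L lborel F"
    using integral_distr[of ?U lborel borel F] by (simp add: distr_unlabel o_def)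
  note cv = change_of_variables_le_wellorder[OF opS inj' der' iF]
  have "(\<integral>\<^sup>+x\<in>S. ennreal (\<bar>c x\<bar> ^ CARD('n) * \<bar>1 + p x \<bullet> q x\<bar> * F (\<Phi> x)) \<partial>lborel) =
     (\<integral>\<^sup>+y\<in>?U -` S. ennreal (\<bar>c (?U y)\<bar> ^ CARD('n) * \<bar>1 + p (?U y) \<bullet> q (?U y)\<bar> * F (\<Phi> (?U y))) \<partial>lborel)"
    by (subst *, subst nn_integral_distr) (use meas in \<open>auto intro!: nn_integral_cong simp: indicator_def\<close>)
  also have "\<dots> \<le> ennreal (integral\<^sup>L lborel F)"
    using cv F(2) by (simp add: det_scaled_rank_one_update card_enumerated ic abs_mult power_abs)
  finally show ?thesis .
qed

section \<open>Power means and the Poincare inequality\<close>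

text \<open>Bernoulli's inequality, in homogeneous form.\<close>

lemma power_ge_tangent:
  fixes a c :: real
  assumes "0 \<le> a" "0 \<le> c" "1 \<le> k"
  shows "c ^ k + real k * c ^ (k - 1) * (a - c) \<le> a ^ k"
proof (cases "c = 0")
  case True
  then show ?thesis using assms by (cases "k = 1") (auto simp: power_0_left)
next
  case False
  then have c: "c > 0" using assms by simp
  have "1 + real k * (a / c - 1) \<le> (1 + (a / c - 1)) ^ k"
    by (rule Bernoulli_inequality) (use assms c in simp)
  then have "c ^ k * (1 + real k * (a / c - 1)) \<le> c ^ k * (a / c) ^ k"
    using c by (intro mult_left_mono) auto
  also have "c ^ k * (a / c) ^ k = a ^ k"
    using c by (simp add: power_divide)
  also have "c ^ k * (1 + real k * (a / c - 1)) = c ^ k + real k * c ^ (k - 1) * (a - c)"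
    using c assms(3) by (cases k) (auto simp: field_simps)
  finally show ?thesis .
qed

text \<open>Jensen's inequality for the \<open>k\<close>-th power, by integrating the tangent inequality at the mean of \<open>\<bar>f\<bar>\<close>. The right-hand
  side may be infinite.\<close>

lemma power_mean_nn_integral:
  fixes f :: "'a \<Rightarrow> real"
  assumes "finite_measure M" and f: "integrable M f" and k: "1 \<le> k"
  shows "ennreal (\<bar>integral\<^sup>L M f\<bar> ^ k)
           \<le> ennreal (measure M (space M) ^ (k - 1)) * (\<integral>\<^sup>+x. ennreal (\<bar>f x\<bar> ^ k) \<partial>M)"
proof -
  interpret finite_measure M by fact
  let ?m = "measure M (space M)"
  have fm[measurable]: "f \<in> borel_measurable M" using f by auto
  show ?thesis
  proof (cases "?m = 0")
    case True
    then have "AE x in M. f x = 0"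
      using AE_iff_null_sets by (auto simp: emeasure_eq_measure intro!: AE_I'[of "space M"])
    then have "integral\<^sup>L M f = 0" by (rule integral_eq_zero_AE)
    then show ?thesis using k by (simp add: power_0_left)
  next
    case False
    then have m: "?m > 0" by (simp add: zero_less_measure_iff)
    show ?thesis
    proof (cases "integrable M (\<lambda>x. \<bar>f x\<bar> ^ k)")
      case False
      then have "(\<integral>\<^sup>+x. ennreal (\<bar>f x\<bar> ^ k) \<partial>M) = \<infinity>"
        by (auto simp: integrable_iff_bounded top.not_eq_extremum[symmetric])
      then show ?thesis using m by (simp add: ennreal_mult_top)
    next
      case int: True
      define c where "c = (\<integral>x. \<bar>f x\<bar> \<partial>M) / ?m"
      have c0: "c \<ge> 0" by (simp add: c_def)
      have fa: "integrable M (\<lambda>x. \<bar>f x\<bar>)" using f by simp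
      have "(\<integral>x. c ^ k + real k * c ^ (k - 1) * (\<bar>f x\<bar> - c) \<partial>M) \<le> (\<integral>x. \<bar>f x\<bar> ^ k \<partial>M)"
        using fa int c0 k by (intro integral_mono power_ge_tangent) auto
      moreover have "(\<integral>x. c ^ k + real k * c ^ (k - 1) * (\<bar>f x\<bar> - c) \<partial>M)
          = ?m * c ^ k + real k * c ^ (k - 1) * ((\<integral>x. \<bar>f x\<bar> \<partial>M) - ?m * c)"
        using fa by (simp add: Bochner_Integration.integral_add Bochner_Integration.integral_diff algebra_simps)
      moreover have "(\<integral>x. \<bar>f x\<bar> \<partial>M) - ?m * c = 0" using m by (simp add: c_def)
      ultimately have 1: "?m * c ^ k \<le> (\<integral>x. \<bar>f x\<bar> ^ k \<partial>M)" by simp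
      have "\<bar>integral\<^sup>L M f\<bar> ^ k \<le> (\<integral>x. \<bar>f x\<bar> \<partial>M) ^ k"
        by (intro power_mono integral_abs_bound) auto
      also have "\<dots> = ?m ^ (k - 1) * (?m * c ^ k)"
        using m k by (cases k) (auto simp: c_def power_divide)
      also have "\<dots> \<le> ?m ^ (k - 1) * (\<integral>x. \<bar>f x\<bar> ^ k \<partial>M)"
        using 1 m by (intro mult_left_mono) auto
      finally have "ennreal (\<bar>integral\<^sup>L M f\<bar> ^ k) \<le> ennreal (?m ^ (k - 1) * (\<integral>x. \<bar>f x\<bar> ^ k \<partial>M))"
        by (rule ennreal_leI)
      also have "\<dots> = ennreal (?m ^ (k - 1)) * ennreal (\<integral>x. \<bar>f x\<bar> ^ k \<partial>M)"
        by (rule ennreal_mult) auto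
      also have "ennreal (\<integral>x. \<bar>f x\<bar> ^ k \<partial>M) = (\<integral>\<^sup>+x. ennreal (\<bar>f x\<bar> ^ k) \<partial>M)"
        by (rule nn_integral_eq_integral[symmetric]) (use int in auto)
      finally show ?thesis .
    qed
  qed
qed

text \<open>The increment is the integral of \<open>\<phi>' / w\<close> with respect to the measure of density \<open>w\<close> and total mass \<open>W b - W a\<close>,
  to which the power mean inequality applies. On segments the weight will be constant; on rays it will be \<open>1 / \<tau>\<close>, for
  which equality holds when \<open>\<phi>\<close> is logarithmic, as it is for the extremal functions of spherical rings.\<close>

lemma weighted_increment_power:
  fixes \<phi> W :: "real \<Rightarrow> real"
  assumes ab: "a \<le> b" and k: "1 \<le> k"
    and \<phi>: "\<And>t. a \<le> t \<Longrightarrow> t \<le> b \<Longrightarrow> (\<phi> has_real_derivative \<phi>' t) (at t)"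
    and c\<phi>: "\<And>t. a \<le> t \<Longrightarrow> t \<le> b \<Longrightarrow> isCont \<phi>' t"
    and W: "\<And>t. a \<le> t \<Longrightarrow> t \<le> b \<Longrightarrow> (W has_real_derivative w t) (at t)"
    and cw: "\<And>t. a \<le> t \<Longrightarrow> t \<le> b \<Longrightarrow> isCont w t"
    and w0: "\<And>t. a \<le> t \<Longrightarrow> t \<le> b \<Longrightarrow> w t > 0"
  shows "ennreal (\<bar>\<phi> b - \<phi> a\<bar> ^ k) \<le> ennreal ((W b - W a) ^ (k - 1)) *
           (\<integral>\<^sup>+t\<in>{a..b}. ennreal (\<bar>\<phi>' t\<bar> ^ k / w t ^ (k - 1)) \<partial>lborel)"
proof -
  let ?I = "indicator {a..b} :: real \<Rightarrow> real"
  let ?p = "\<lambda>t. \<phi>' t * ?I t" and ?w = "\<lambda>t. w t * ?I t"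
  have hp: "has_bochner_integral lborel ?p (\<phi> b - \<phi> a)"
    by (rule has_bochner_integral_FTC_Icc_real) (use ab \<phi> c\<phi> in auto)
  have hw: "has_bochner_integral lborel ?w (W b - W a)"
    by (rule has_bochner_integral_FTC_Icc_real) (use ab W cw in auto)
  have [measurable]: "?p \<in> borel_measurable borel" "?w \<in> borel_measurable borel"
    using hp hw by (auto simp: has_bochner_integral_iff)
  have w_nonneg: "0 \<le> ?w t" for t using w0[of t] by (auto simp: indicator_def)
  define M where "M = density lborel (\<lambda>t. ennreal (?w t))"
  have emM: "emeasure M (space M) = ennreal (W b - W a)"
    using hw w_nonneg nn_integral_eq_integral[of lborel ?w]
    by (simp add: M_def emeasure_density has_bochner_integral_iff)
  then have fin: "finite_measure M"
    by (intro finite_measureI) simp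
  have WW: "0 \<le> W b - W a"
    using hw w_nonneg integral_nonneg_AE[of ?w lborel] by (auto simp: has_bochner_integral_iff)
  have mM: "measure M (space M) = W b - W a"
    using emM WW by (simp add: measure_def)
  define f where "f t = ?p t / ?w t" for t
  have [measurable]: "f \<in> borel_measurable borel" unfolding f_def by measurable
  have fw: "?w t * f t = ?p t" for t
    using w0[of t] by (auto simp: f_def indicator_def)
  have "integrable M f"
    unfolding M_def using hp w_nonneg
    by (subst integrable_density) (auto simp: fw has_bochner_integral_iff simp del: mult_eq_0_iff)
  moreover have "integral\<^sup>L M f = \<phi> b - \<phi> a"
    unfolding M_def using hp w_nonneg
    by (subst integral_density) (auto simp: fw has_bochner_integral_iff simp del: mult_eq_0_iff)
  moreover have "(\<integral>\<^sup>+t. ennreal (\<bar>f t\<bar> ^ k) \<partial>M) = (\<integral>\<^sup>+t\<in>{a..b}. ennreal (\<bar>\<phi>' t\<bar> ^ k / w t ^ (k - 1)) \<partial>lborel)"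
  proof -
    have "ennreal (?w t) * ennreal (\<bar>f t\<bar> ^ k) = ennreal (\<bar>\<phi>' t\<bar> ^ k / w t ^ (k - 1)) * indicator {a..b} t" for t
    proof (cases "t \<in> {a..b}")
      case True
      then have wt: "w t > 0" using w0 by auto
      have "w t * (\<bar>\<phi>' t / w t\<bar>) ^ k = \<bar>\<phi>' t\<bar> ^ k / w t ^ (k - 1)"
        using k wt by (cases k) (auto simp: power_divide abs_divide)
      then show ?thesis using True wt by (simp add: f_def ennreal_mult[symmetric])
    qed (auto simp: f_def)
    then show ?thesis unfolding M_def by (subst nn_integral_density) auto
  qed
  ultimately show ?thesis
    using power_mean_nn_integral[OF fin, of f k] k mM by simp
qed

lemma nn_integral_lborel_affine:
  fixes f :: "'a::euclidean_space \<Rightarrow> ennreal"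
  assumes [measurable]: "f \<in> borel_measurable borel" and c: "c \<noteq> 0"
  shows "(\<integral>\<^sup>+x. f (t + c *\<^sub>R x) \<partial>lborel) = ennreal (1 / \<bar>c\<bar> ^ DIM('a)) * (\<integral>\<^sup>+x. f x \<partial>lborel)"
proof -
  have "(\<integral>\<^sup>+x. f x \<partial>lborel) = ennreal (\<bar>c\<bar> ^ DIM('a)) * (\<integral>\<^sup>+x. f (t + c *\<^sub>R x) \<partial>lborel)"
    by (subst lborel_affine[OF c, of t]) (simp add: nn_integral_density nn_integral_distr nn_integral_cmult power_abs[symmetric])
  then show ?thesis using c
    by (simp add: mult.assoc[symmetric] ennreal_mult[symmetric])
qed

text \<open>Class \<open>C\<^sup>1\<close> without a support condition, for cutoffs and for transplanted competitors, whose supports are not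
  tied to a domain.\<close>

definition C1_gradient :: "('a::euclidean_space \<Rightarrow> real) \<Rightarrow> ('a \<Rightarrow> 'a) \<Rightarrow> bool" where
  "C1_gradient u g \<longleftrightarrow> (\<forall>x. GDERIV u x :> g x) \<and> continuous_on UNIV g"

lemma C1_gradient_along_line:
  assumes "C1_gradient u g"
  shows "((\<lambda>t. u (y + t *\<^sub>R v)) has_real_derivative (v \<bullet> g (y + t *\<^sub>R v))) (at t)"
    and "isCont (\<lambda>t. v \<bullet> g (y + t *\<^sub>R v)) t"
proof -
  have 1: "(u has_derivative (\<lambda>h. h \<bullet> g (y + t *\<^sub>R v))) (at (y + t *\<^sub>R v))"
    using assms by (simp add: C1_gradient_def gderiv_def)
  have 2: "((\<lambda>t. y + t *\<^sub>R v) has_derivative (\<lambda>h. h *\<^sub>R v)) (at t)"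
    by (auto intro!: derivative_eq_intros)
  show "((\<lambda>t. u (y + t *\<^sub>R v)) has_real_derivative (v \<bullet> g (y + t *\<^sub>R v))) (at t)"
    using has_derivative_compose[OF 2 1] unfolding has_field_derivative_def
    by (rule has_derivative_eq_rhs) (auto simp: mult.commute)
  have "continuous_on UNIV (\<lambda>t. v \<bullet> g (y + t *\<^sub>R v))"
    using assms unfolding C1_gradient_def
    by (auto intro!: continuous_intros continuous_on_compose2[of UNIV g])
  then show "isCont (\<lambda>t. v \<bullet> g (y + t *\<^sub>R v)) t"
    by (simp add: continuous_on_eq_continuous_at)
qed

lemma C1_gradient_continuous: "C1_gradient u g \<Longrightarrow> continuous_on UNIV u"
  unfolding C1_gradient_def gderiv_def
  by (meson continuous_at_imp_continuous_on has_derivative_continuous)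

lemma segment_increment_power:
  fixes u :: "'a::euclidean_space \<Rightarrow> real"
  assumes u: "C1_gradient u g" and k: "1 \<le> k"
  shows "ennreal (\<bar>u x - u y\<bar> ^ k) \<le>
     (\<integral>\<^sup>+t\<in>{0..1}. ennreal (norm (x - y) ^ k * norm (g (y + t *\<^sub>R (x - y))) ^ k) \<partial>lborel)"
proof -
  have "ennreal (\<bar>u (y + 1 *\<^sub>R (x - y)) - u (y + 0 *\<^sub>R (x - y))\<bar> ^ k) \<le> ennreal ((1 - 0) ^ (k - 1)) *
      (\<integral>\<^sup>+t\<in>{0..1}. ennreal (\<bar>(x - y) \<bullet> g (y + t *\<^sub>R (x - y))\<bar> ^ k / 1 ^ (k - 1)) \<partial>lborel)"
    by (rule weighted_increment_power[where W="\<lambda>t. t" and w="\<lambda>_. 1"])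
       (use k C1_gradient_along_line[OF u] in \<open>auto intro!: derivative_eq_intros\<close>)
  also have "\<dots> \<le> (\<integral>\<^sup>+t\<in>{0..1}. ennreal (norm (x - y) ^ k * norm (g (y + t *\<^sub>R (x - y))) ^ k) \<partial>lborel)"
    by (auto intro!: nn_integral_mono mult_right_mono ennreal_leI power_mono Cauchy_Schwarz_ineq2
        simp: power_mult_distrib[symmetric])
  finally show ?thesis by simp
qed

text \<open>The segment between two points of the ball stays in the ball. After the increment of \<open>u\<close> is written as an
  integral over \<open>t \<in> {0..1}\<close>, the point \<open>y + t *\<^sub>R (x - y)\<close> is substituted for \<open>x\<close> if \<open>t \<ge> 1/2\<close> and for \<open>y\<close> if \<open>t \<le> 1/2\<close>; in
  either case the Jacobian costs at most \<open>2 ^ DIM('a)\<close>.\<close>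

lemma poincare_ball:
  fixes u :: "'a::euclidean_space \<Rightarrow> real"
  assumes u: "C1_gradient u g" and r: "0 < r" and k: "1 \<le> k"
  shows "(\<integral>\<^sup>+x\<in>ball p r. (\<integral>\<^sup>+y\<in>ball p r. ennreal (\<bar>u x - u y\<bar> ^ k) \<partial>lborel) \<partial>lborel)
    \<le> ennreal ((2 * r) ^ k * 2 ^ DIM('a)) * emeasure lborel (ball p r) *
        (\<integral>\<^sup>+z\<in>ball p r. ennreal (norm (g z) ^ k) \<partial>lborel)"
proof -
  let ?B = "ball p r"
  have [measurable]: "u \<in> borel_measurable borel" "g \<in> borel_measurable borel"
    using u C1_gradient_continuous[OF u]
    by (auto intro!: borel_measurable_continuous_onI simp: C1_gradient_def)
  have [measurable]: "?B \<in> sets borel" by simp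
  define G where "G z = ennreal (norm (g z) ^ k) * indicator ?B z" for z
  have Gm[measurable]: "G \<in> borel_measurable borel" unfolding G_def
    by (intro borel_measurable_times_ennreal borel_measurable_indicator) auto
  let ?c = "ennreal ((2 * r) ^ k)"
  have pt: "ennreal (\<bar>u x - u y\<bar> ^ k) * indicator ?B y * indicator ?B x \<le>
       (\<integral>\<^sup>+t. ?c * (G (y + t *\<^sub>R (x - y)) * indicator ?B y * indicator ?B x * indicator {0..1::real} t) \<partial>lborel)" for x y
  proof (cases "x \<in> ?B \<and> y \<in> ?B")
    case True
    have nxy: "norm (x - y) \<le> 2 * r"
      using True dist_triangle_half_r[of p x "2*r" y] by (auto simp: dist_norm dist_commute)
    have nk: "norm (x - y) ^ k \<le> 2 ^ k * r ^ k"
      using power_mono[OF nxy, of k] by (simp add: power_mult_distrib)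
    have seg: "y + t *\<^sub>R (x - y) \<in> ?B" if "0 \<le> t" "t \<le> 1" for t
    proof -
      have "y + t *\<^sub>R (x - y) = (1 - t) *\<^sub>R y + t *\<^sub>R x" by (simp add: algebra_simps)
      then show ?thesis using convexD_alt[OF convex_ball[of p r], of y x t] True that by simp
    qed
    have "ennreal (\<bar>u x - u y\<bar> ^ k) \<le>
      (\<integral>\<^sup>+t\<in>{0..1}. ennreal (norm (x - y) ^ k * norm (g (y + t *\<^sub>R (x - y))) ^ k) \<partial>lborel)"
      by (rule segment_increment_power[OF u k])
    also have "\<dots> \<le> (\<integral>\<^sup>+t. ?c * (G (y + t *\<^sub>R (x - y)) * indicator ?B y * indicator ?B x * indicator {0..1::real} t) \<partial>lborel)"
      using True seg nk r
      by (auto intro!: nn_integral_mono ennreal_leI mult_right_mono power_mono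
          simp: G_def indicator_def ennreal_mult[symmetric] simp del: mem_ball)
    finally show ?thesis using True by simp
  qed (auto simp: indicator_def)
  have H: "(\<integral>\<^sup>+x. \<integral>\<^sup>+y. G (y + t *\<^sub>R (x - y)) * indicator ?B y * indicator ?B x \<partial>lborel \<partial>lborel)
       \<le> ennreal (2 ^ DIM('a)) * integral\<^sup>N lborel G * emeasure lborel ?B"
    (is "?H \<le> _") if t: "0 \<le> t" "t \<le> 1" for t
  proof -
    have aff: "(\<integral>\<^sup>+x. G (a + s *\<^sub>R x) \<partial>lborel) \<le> ennreal (2 ^ DIM('a)) * integral\<^sup>N lborel G" if "1/2 \<le> s" for a s
    proof -
      have "(1 / s) ^ DIM('a) \<le> 2 ^ DIM('a)" using that by (intro power_mono) (auto simp: field_simps)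
      then show ?thesis using that
        by (subst nn_integral_lborel_affine) (auto intro!: mult_right_mono ennreal_leI simp: power_divide)
    qed
    consider "1/2 \<le> t" | "1/2 \<le> 1 - t" by linarith
    then show ?thesis
    proof cases
      case 1
      have "?H = (\<integral>\<^sup>+y. \<integral>\<^sup>+x. G (y + t *\<^sub>R (x - y)) * indicator ?B y * indicator ?B x \<partial>lborel \<partial>lborel)"
        by (rule lborel_pair.Fubini') measurable
      also have "\<dots> \<le> (\<integral>\<^sup>+y. (\<integral>\<^sup>+x. G ((1 - t) *\<^sub>R y + t *\<^sub>R x) \<partial>lborel) * indicator ?B y \<partial>lborel)"
        by (subst nn_integral_multc[symmetric], measurable)
           (auto intro!: nn_integral_mono simp: indicator_def algebra_simps)
      also have "\<dots> \<le> (\<integral>\<^sup>+y. (ennreal (2 ^ DIM('a)) * integral\<^sup>N lborel G) * indicator ?B y \<partial>lborel)"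
        by (intro nn_integral_mono mult_right_mono aff 1) auto
      finally show ?thesis by (simp add: nn_integral_cmult)
    next
      case 2
      have "?H \<le> (\<integral>\<^sup>+x. (\<integral>\<^sup>+y. G (t *\<^sub>R x + (1 - t) *\<^sub>R y) \<partial>lborel) * indicator ?B x \<partial>lborel)"
        by (subst nn_integral_multc[symmetric], measurable)
           (auto intro!: nn_integral_mono simp: indicator_def algebra_simps)
      also have "\<dots> \<le> (\<integral>\<^sup>+x. (ennreal (2 ^ DIM('a)) * integral\<^sup>N lborel G) * indicator ?B x \<partial>lborel)"
        by (intro nn_integral_mono mult_right_mono aff 2) auto
      finally show ?thesis by (simp add: nn_integral_cmult)
    qed
  qed
  let ?F = "\<lambda>x y t. ?c * (G (y + t *\<^sub>R (x - y)) * indicator ?B y * indicator ?B x * indicator {0..1::real} t)"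
  have "(\<integral>\<^sup>+x\<in>?B. (\<integral>\<^sup>+y\<in>?B. ennreal (\<bar>u x - u y\<bar> ^ k) \<partial>lborel) \<partial>lborel)
     = (\<integral>\<^sup>+x. \<integral>\<^sup>+y. ennreal (\<bar>u x - u y\<bar> ^ k) * indicator ?B y * indicator ?B x \<partial>lborel \<partial>lborel)"
    by (simp add: nn_integral_multc)
  also have "\<dots> \<le> (\<integral>\<^sup>+x. \<integral>\<^sup>+y. \<integral>\<^sup>+t. ?F x y t \<partial>lborel \<partial>lborel \<partial>lborel)"
    by (intro nn_integral_mono pt)
  also have "\<dots> = (\<integral>\<^sup>+x. \<integral>\<^sup>+t. \<integral>\<^sup>+y. ?F x y t \<partial>lborel \<partial>lborel \<partial>lborel)"
    by (intro nn_integral_cong lborel_pair.Fubini'[symmetric]) measurable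
  also have "\<dots> = (\<integral>\<^sup>+t. \<integral>\<^sup>+x. \<integral>\<^sup>+y. ?F x y t \<partial>lborel \<partial>lborel \<partial>lborel)"
    by (intro lborel_pair.Fubini'[symmetric]) measurable
  also have "\<dots> = (\<integral>\<^sup>+t. ?c * ((\<integral>\<^sup>+x. \<integral>\<^sup>+y. G (y + t *\<^sub>R (x - y)) * indicator ?B y * indicator ?B x \<partial>lborel \<partial>lborel) * indicator {0..1} t) \<partial>lborel)"
    by (simp add: nn_integral_cmult nn_integral_multc)
  also have "\<dots> \<le> (\<integral>\<^sup>+t. ?c * (ennreal (2 ^ DIM('a)) * integral\<^sup>N lborel G * emeasure lborel ?B) * indicator {0..1::real} t \<partial>lborel)"
  proof (rule nn_integral_mono)
    fix t :: real
    show "?c * ((\<integral>\<^sup>+x. \<integral>\<^sup>+y. G (y + t *\<^sub>R (x - y)) * indicator ?B y * indicator ?B x \<partial>lborel \<partial>lborel) * indicator {0..1} t)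
      \<le> ?c * (ennreal (2 ^ DIM('a)) * integral\<^sup>N lborel G * emeasure lborel ?B) * indicator {0..1::real} t"
      by (cases "t \<in> {0..1}") (auto intro!: mult_left_mono H)
  qed
  also have "\<dots> = ?c * (ennreal (2 ^ DIM('a)) * integral\<^sup>N lborel G * emeasure lborel ?B)"
    by (simp add: nn_integral_cmult)
  also have "\<dots> = ennreal ((2 * r) ^ k * 2 ^ DIM('a)) * emeasure lborel ?B * integral\<^sup>N lborel G"
    using r by (simp add: ennreal_mult mult_ac)
  finally show ?thesis unfolding G_def .
qed

section \<open>Means over balls and dyadic shells\<close>

text \<open>A bound on the density is all that the Poincare inequality needs to compare a mean with the values of
  the function, and it is shared by the means over balls and over shells.\<close>

definition dominated_probability :: "'a::euclidean_space measure \<Rightarrow> real \<Rightarrow> 'a set \<Rightarrow> bool" where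
  "dominated_probability M H B \<longleftrightarrow> prob_space M \<and> sets M = sets borel \<and> 0 \<le> H \<and>
     (\<forall>f\<in>borel_measurable borel. (\<integral>\<^sup>+x. f x \<partial>M) \<le> ennreal H * (\<integral>\<^sup>+x\<in>B. f x \<partial>lborel))"

lemma integrable_bounded_continuous:
  fixes u :: "'a::euclidean_space \<Rightarrow> real"
  assumes "prob_space M" "sets M = sets borel" "continuous_on UNIV u" "\<And>x. \<bar>u x\<bar> \<le> U"
  shows "integrable M u"
proof -
  interpret prob_space M by fact
  show ?thesis
    by (rule integrable_const_bound[of u U])
       (use assms in \<open>auto intro!: borel_measurable_continuous_onI simp: measurable_cong_sets[OF assms(2) refl]\<close>)
qed

lemma mean_minus_const_power:
  fixes u :: "'a::euclidean_space \<Rightarrow> real"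
  assumes M: "prob_space M" "sets M = sets borel" and u: "continuous_on UNIV u" "\<And>x. \<bar>u x\<bar> \<le> U" and k: "1 \<le> k"
  shows "ennreal (\<bar>integral\<^sup>L M u - c\<bar> ^ k) \<le> (\<integral>\<^sup>+x. ennreal (\<bar>u x - c\<bar> ^ k) \<partial>M)"
proof -
  interpret prob_space M by fact
  have int: "integrable M u" by (rule integrable_bounded_continuous) fact+
  have "integral\<^sup>L M u - c = (\<integral>x. u x - c \<partial>M)" using int by (simp add: prob_space)
  then show ?thesis
    using power_mean_nn_integral[OF finite_measure_axioms, of "\<lambda>x. u x - c" k] int k by (simp add: prob_space)
qed

lemma mean_minus_const_power_dominated:
  fixes u :: "'a::euclidean_space \<Rightarrow> real"
  assumes M: "dominated_probability M H B" and u: "continuous_on UNIV u" "\<And>x. \<bar>u x\<bar> \<le> U" and k: "1 \<le> k"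
  shows "ennreal (\<bar>integral\<^sup>L M u - c\<bar> ^ k) \<le> ennreal H * (\<integral>\<^sup>+x\<in>B. ennreal (\<bar>u x - c\<bar> ^ k) \<partial>lborel)"
proof -
  have [measurable]: "u \<in> borel_measurable borel" using u(1) by (rule borel_measurable_continuous_onI)
  have "(\<lambda>x. ennreal (\<bar>u x - c\<bar> ^ k)) \<in> borel_measurable borel" by measurable
  then show ?thesis
    using mean_minus_const_power[of M u U k c] M u k unfolding dominated_probability_def
    by (meson order_trans)
qed

text \<open>Pull the power inside the mean, bound the mean by a multiple of the integral over the ball, and apply the Poincare
  inequality to the resulting double integral.\<close>

lemma deviation_from_mean:
  fixes u :: "'a::euclidean_space \<Rightarrow> real"
  assumes u: "C1_gradient u g" "\<And>x. \<bar>u x\<bar> \<le> U" and M: "dominated_probability M H (ball p r)"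
    and r: "0 < r" and k: "1 \<le> k"
  shows "(\<integral>\<^sup>+y\<in>ball p r. ennreal (\<bar>integral\<^sup>L M u - u y\<bar> ^ k) \<partial>lborel)
     \<le> ennreal (H * ((2 * r) ^ k * 2 ^ DIM('a) * (unit_ball_vol (DIM('a)) * r ^ DIM('a)))) *
         (\<integral>\<^sup>+z\<in>ball p r. ennreal (norm (g z) ^ k) \<partial>lborel)"
proof -
  have c: "continuous_on UNIV u" using C1_gradient_continuous[OF u(1)] .
  have [measurable]: "u \<in> borel_measurable borel" using c by (rule borel_measurable_continuous_onI)
  have [measurable]: "ball p r \<in> sets borel" by simp
  have H0: "0 \<le> H" using M by (simp add: dominated_probability_def)
  have "(\<integral>\<^sup>+y\<in>ball p r. ennreal (\<bar>integral\<^sup>L M u - u y\<bar> ^ k) \<partial>lborel) \<le>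
     (\<integral>\<^sup>+y. ennreal H * ((\<integral>\<^sup>+x\<in>ball p r. ennreal (\<bar>u x - u y\<bar> ^ k) \<partial>lborel) * indicator (ball p r) y) \<partial>lborel)"
  proof (rule nn_integral_mono)
    fix y
    show "ennreal (\<bar>integral\<^sup>L M u - u y\<bar> ^ k) * indicator (ball p r) y
      \<le> ennreal H * ((\<integral>\<^sup>+x\<in>ball p r. ennreal (\<bar>u x - u y\<bar> ^ k) \<partial>lborel) * indicator (ball p r) y)"
      using mean_minus_const_power_dominated[OF M c u(2) k, of "u y"] by (cases "y \<in> ball p r") auto
  qed
  also have "\<dots> = ennreal H * (\<integral>\<^sup>+y\<in>ball p r. (\<integral>\<^sup>+x\<in>ball p r. ennreal (\<bar>u x - u y\<bar> ^ k) \<partial>lborel) \<partial>lborel)"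
    by (rule nn_integral_cmult) measurable
  also have "\<dots> = ennreal H * (\<integral>\<^sup>+y\<in>ball p r. (\<integral>\<^sup>+x\<in>ball p r. ennreal (\<bar>u y - u x\<bar> ^ k) \<partial>lborel) \<partial>lborel)"
    by (simp only: abs_minus_commute)
  also have "\<dots> \<le> ennreal H * (ennreal ((2 * r) ^ k * 2 ^ DIM('a)) * emeasure lborel (ball p r) *
        (\<integral>\<^sup>+z\<in>ball p r. ennreal (norm (g z) ^ k) \<partial>lborel))"
    by (intro mult_left_mono poincare_ball u r k) auto
  also have "\<dots> = ennreal (H * ((2 * r) ^ k * 2 ^ DIM('a) * (unit_ball_vol (DIM('a)) * r ^ DIM('a)))) *
         (\<integral>\<^sup>+z\<in>ball p r. ennreal (norm (g z) ^ k) \<partial>lborel)"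
    using r H0 by (simp add: emeasure_ball ennreal_mult mult.assoc)
  finally show ?thesis .
qed

lemma means_difference:
  fixes u :: "'a::euclidean_space \<Rightarrow> real"
  assumes u: "C1_gradient u g" "\<And>x. \<bar>u x\<bar> \<le> U"
    and M: "dominated_probability M H (ball p r)" and M': "dominated_probability M' H' (ball p r)"
    and r: "0 < r" and k: "1 \<le> k"
  shows "ennreal (\<bar>integral\<^sup>L M u - integral\<^sup>L M' u\<bar> ^ k)
     \<le> ennreal (H' * (H * ((2 * r) ^ k * 2 ^ DIM('a) * (unit_ball_vol (DIM('a)) * r ^ DIM('a))))) *
         (\<integral>\<^sup>+z\<in>ball p r. ennreal (norm (g z) ^ k) \<partial>lborel)"
proof -
  have H0: "0 \<le> H" "0 \<le> H'" using M M' by (auto simp: dominated_probability_def)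
  have "ennreal (\<bar>integral\<^sup>L M u - integral\<^sup>L M' u\<bar> ^ k) = ennreal (\<bar>integral\<^sup>L M' u - integral\<^sup>L M u\<bar> ^ k)"
    by (simp add: abs_minus_commute)
  also have "\<dots> \<le> ennreal H' * (\<integral>\<^sup>+y\<in>ball p r. ennreal (\<bar>u y - integral\<^sup>L M u\<bar> ^ k) \<partial>lborel)"
    by (rule mean_minus_const_power_dominated[OF M' C1_gradient_continuous[OF u(1)] u(2) k])
  also have "\<dots> = ennreal H' * (\<integral>\<^sup>+y\<in>ball p r. ennreal (\<bar>integral\<^sup>L M u - u y\<bar> ^ k) \<partial>lborel)"
    by (simp only: abs_minus_commute)
  also have "\<dots> \<le> ennreal H' * (ennreal (H * ((2 * r) ^ k * 2 ^ DIM('a) * (unit_ball_vol (DIM('a)) * r ^ DIM('a)))) *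
         (\<integral>\<^sup>+z\<in>ball p r. ennreal (norm (g z) ^ k) \<partial>lborel))"
    by (intro mult_left_mono deviation_from_mean[OF u M r k]) auto
  also have "\<dots> = ennreal (H' * (H * ((2 * r) ^ k * 2 ^ DIM('a) * (unit_ball_vol (DIM('a)) * r ^ DIM('a))))) *
         (\<integral>\<^sup>+z\<in>ball p r. ennreal (norm (g z) ^ k) \<partial>lborel)"
    using r H0 by (simp add: ennreal_mult mult.assoc)
  finally show ?thesis .
qed

definition ball_mean :: "('a::euclidean_space \<Rightarrow> real) \<Rightarrow> 'a \<Rightarrow> real \<Rightarrow> real" where
  "ball_mean u x r = integral\<^sup>L (uniform_measure lborel (ball x r)) u"

lemma dominated_probability_uniform_ball:
  fixes x :: "'a::euclidean_space"
  assumes r: "0 < r" and B: "ball x r \<subseteq> B"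
  shows "dominated_probability (uniform_measure lborel (ball x r)) (1 / (unit_ball_vol (DIM('a)) * r ^ DIM('a))) B"
proof -
  let ?m = "unit_ball_vol (DIM('a)) * r ^ DIM('a)"
  have m: "?m > 0" using r by simp
  have em: "emeasure lborel (ball x r) = ennreal ?m" using r by (simp add: emeasure_ball)
  have "(\<integral>\<^sup>+y. f y \<partial>uniform_measure lborel (ball x r)) \<le> ennreal (1 / ?m) * (\<integral>\<^sup>+y\<in>B. f y \<partial>lborel)"
    if [measurable]: "f \<in> borel_measurable borel" for f
  proof -
    have "(\<integral>\<^sup>+y. f y \<partial>uniform_measure lborel (ball x r)) = (\<integral>\<^sup>+y\<in>ball x r. f y \<partial>lborel) / ennreal ?m"
      by (subst nn_integral_uniform_measure) (auto simp: em)
    also have "\<dots> = ennreal (1 / ?m) * (\<integral>\<^sup>+y\<in>ball x r. f y \<partial>lborel)"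
      using m by (simp add: divide_ennreal_def inverse_ennreal mult.commute inverse_eq_divide)
    also have "\<dots> \<le> ennreal (1 / ?m) * (\<integral>\<^sup>+y\<in>B. f y \<partial>lborel)"
      using B by (intro mult_left_mono nn_integral_mono) (auto simp: indicator_def)
    finally show ?thesis .
  qed
  moreover have "ennreal ?m \<noteq> 0" using m by (metis ennreal_eq_0_iff not_le)
  then have "prob_space (uniform_measure lborel (ball x r))"
    by (intro prob_space_uniform_measure) (auto simp only: em infinity_ennreal_def ennreal_neq_top)
  ultimately show ?thesis
    using m by (auto simp: dominated_probability_def)
qed

text \<open>The constant does not depend on the radius, because the exponent of the energy is the dimension.\<close>

lemma ball_mean_halving:
  fixes u :: "'a::euclidean_space \<Rightarrow> real"
  assumes u: "C1_gradient u g" "\<And>x. \<bar>u x\<bar> \<le> U" and r: "0 < r"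
  shows "ennreal (\<bar>ball_mean u x r - ball_mean u x (r / 2)\<bar> ^ DIM('a)) \<le>
     ennreal (8 ^ DIM('a) / unit_ball_vol (DIM('a))) * (\<integral>\<^sup>+z\<in>ball x r. ennreal (norm (g z) ^ DIM('a)) \<partial>lborel)"
proof -
  let ?v = "unit_ball_vol (DIM('a))" and ?d = "DIM('a)"
  have "1 / (?v * (r / 2) ^ ?d) * (1 / (?v * r ^ ?d) * ((2 * r) ^ ?d * 2 ^ ?d * (?v * r ^ ?d))) = 8 ^ ?d / ?v"
    using r by (simp add: field_simps power_mult_distrib power_divide) (simp add: power_mult_distrib[symmetric])
  then show ?thesis
    using means_difference[OF u dominated_probability_uniform_ball[OF r order_refl]
        dominated_probability_uniform_ball[of "r/2" x "ball x r"] r, of ?d] r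
    by (simp add: ball_mean_def DIM_ge_Suc0 subset_ball)
qed

text \<open>The density \<open>1 / norm x ^ DIM('a)\<close> is invariant under dilations. Its total mass over the shell is \<open>ln 2\<close> times
  the area of the unit sphere.\<close>

definition shell_weight :: "'a::euclidean_space \<Rightarrow> real" where
  "shell_weight x = (if 1 \<le> norm x \<and> norm x < 2 then 1 / norm x ^ DIM('a) else 0)"

definition shell_mass :: "'a::euclidean_space itself \<Rightarrow> real" where
  "shell_mass _ = integral\<^sup>L lborel (shell_weight :: 'a \<Rightarrow> real)"

definition shell_measure :: "real \<Rightarrow> 'a::euclidean_space measure" where
  "shell_measure \<rho> = distr (density lborel (\<lambda>x. ennreal (shell_weight x / shell_mass TYPE('a)))) borel (\<lambda>x. \<rho> *\<^sub>R x)"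

definition shell_mean :: "('a::euclidean_space \<Rightarrow> real) \<Rightarrow> real \<Rightarrow> real" where
  "shell_mean u \<rho> = integral\<^sup>L (shell_measure \<rho>) u"

lemma shell_weight_measurable [measurable]: "shell_weight \<in> borel_measurable borel"
  unfolding shell_weight_def[abs_def] by measurable

lemma shell_weight_bounds: "0 \<le> shell_weight x" "shell_weight x \<le> 1"
  by (auto simp: shell_weight_def intro!: divide_le_eq_1[THEN iffD2] one_le_power)

lemma integrable_shell_weight: "integrable lborel (shell_weight :: 'a::euclidean_space \<Rightarrow> real)"
proof (rule Bochner_Integration.integrable_bound)
  show "integrable lborel (indicator (ball 0 2) :: 'a \<Rightarrow> real)"
    by (simp add: integrable_real_indicator emeasure_ball)
  show "AE x::'a in lborel. norm (shell_weight x) \<le> norm (indicator (ball 0 2) x :: real)"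
  proof (rule AE_I2)
    fix x :: 'a
    show "norm (shell_weight x) \<le> norm (indicator (ball 0 2) x :: real)"
      using shell_weight_bounds[of x] by (auto simp: shell_weight_def indicator_def)
  qed
qed auto

lemma nn_integral_shell_weight:
  "(\<integral>\<^sup>+x. ennreal (shell_weight (x::'a::euclidean_space)) \<partial>lborel) = ennreal (shell_mass TYPE('a))"
  unfolding shell_mass_def
  by (rule nn_integral_eq_integral) (auto simp: integrable_shell_weight shell_weight_bounds)

lemma shell_mass_pos: "0 < shell_mass TYPE('a::euclidean_space)"
proof -
  obtain b :: 'a where b: "b \<in> Basis" using nonempty_Basis by blast
  let ?B = "ball ((3/2) *\<^sub>R b) (1/2)"
  have "1 \<le> norm x \<and> norm x < 2" if "x \<in> ?B" for x :: 'a
    using that b norm_triangle_ineq2[of "(3/2) *\<^sub>R b" x] norm_triangle_ineq2[of x "(3/2) *\<^sub>R b"]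
    by (simp add: dist_norm norm_minus_commute)
  then have *: "1 \<le> norm x \<and> norm x < 2" if "x \<in> ?B" for x :: 'a using that by blast
  have "(1/2) ^ DIM('a) * indicator ?B x \<le> shell_weight x" for x
  proof (cases "x \<in> ?B")
    case True
    have "norm x ^ DIM('a) \<le> 2 ^ DIM('a)" using *[OF True] by (intro power_mono) auto
    moreover have "0 < norm x ^ DIM('a)" using *[OF True] by (intro zero_less_power) linarith
    ultimately show ?thesis
      using True *[OF True] by (simp add: shell_weight_def power_divide frac_le del: mem_ball)
  qed (simp add: shell_weight_bounds)
  then have "(\<integral>x. (1/2) ^ DIM('a) * indicator ?B x \<partial>lborel) \<le> shell_mass TYPE('a)"
    unfolding shell_mass_def
    by (intro integral_mono integrable_shell_weight) (auto simp: emeasure_ball)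
  moreover have "(\<integral>x. (1/2) ^ DIM('a) * indicator ?B x \<partial>lborel) = (1/2) ^ DIM('a) * measure lborel ?B"
    by simp
  moreover have "measure lborel ?B > 0"
    using content_ball_pos[of "1/2" "(3/2) *\<^sub>R b"] by simp
  ultimately show ?thesis by (smt (verit) zero_less_power mult_pos_pos half_gt_zero_iff)
qed

lemma prob_space_shell_density:
  "prob_space (density lborel (\<lambda>x::'a::euclidean_space. ennreal (shell_weight x / shell_mass TYPE('a))))"
proof (rule prob_spaceI)
  let ?w = "shell_mass TYPE('a)"
  have w: "?w > 0" by (rule shell_mass_pos)
  have "(\<integral>\<^sup>+x. ennreal (shell_weight (x::'a) / ?w) \<partial>lborel) = (\<integral>\<^sup>+x. ennreal (1 / ?w) * ennreal (shell_weight (x::'a)) \<partial>lborel)"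
    using w by (intro nn_integral_cong) (simp add: ennreal_mult[symmetric] shell_weight_bounds)
  also have "\<dots> = 1"
    using w by (simp add: nn_integral_cmult nn_integral_shell_weight ennreal_mult[symmetric])
  finally show "emeasure (density lborel (\<lambda>x::'a. ennreal (shell_weight x / ?w)))
      (space (density lborel (\<lambda>x. ennreal (shell_weight x / ?w)))) = 1"
    by (simp add: emeasure_density)
qed

lemma dominated_probability_shell:
  fixes B :: "'a::euclidean_space set"
  assumes \<rho>: "0 < \<rho>" and B: "{z. \<rho> \<le> norm z \<and> norm z < 2 * \<rho>} \<subseteq> B" and Bm: "B \<in> sets borel"
  shows "dominated_probability (shell_measure \<rho>) (1 / (shell_mass TYPE('a) * \<rho> ^ DIM('a))) B"
proof -
  let ?w = "shell_mass TYPE('a)"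
  note [measurable] = Bm
  have w: "?w > 0" by (rule shell_mass_pos)
  have "(\<integral>\<^sup>+y. f y \<partial>shell_measure \<rho>) \<le> ennreal (1 / (?w * \<rho> ^ DIM('a))) * (\<integral>\<^sup>+y\<in>B. f y \<partial>lborel)"
    if [measurable]: "f \<in> borel_measurable borel" for f :: "'a \<Rightarrow> ennreal"
  proof -
    have "(\<integral>\<^sup>+y. f y \<partial>shell_measure \<rho>) = (\<integral>\<^sup>+x. ennreal (shell_weight x / ?w) * f (\<rho> *\<^sub>R x) \<partial>lborel)"
      by (simp add: shell_measure_def nn_integral_distr nn_integral_density)
    also have "\<dots> \<le> (\<integral>\<^sup>+x. ennreal (1 / ?w) * (f (0 + \<rho> *\<^sub>R x) * indicator B (0 + \<rho> *\<^sub>R x)) \<partial>lborel)"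
    proof (intro nn_integral_mono)
      fix x :: 'a
      show "ennreal (shell_weight x / ?w) * f (\<rho> *\<^sub>R x) \<le> ennreal (1 / ?w) * (f (0 + \<rho> *\<^sub>R x) * indicator B (0 + \<rho> *\<^sub>R x))"
      proof (cases "1 \<le> norm x \<and> norm x < 2")
        case True
        then have "\<rho> *\<^sub>R x \<in> B" using B \<rho> by auto
        then show ?thesis using shell_weight_bounds[of x] w
          by (auto intro!: mult_right_mono ennreal_leI divide_right_mono)
      qed (auto simp: shell_weight_def)
    qed
    also have "\<dots> = ennreal (1 / ?w) * (\<integral>\<^sup>+x. f (0 + \<rho> *\<^sub>R x) * indicator B (0 + \<rho> *\<^sub>R x) \<partial>lborel)"
      by (rule nn_integral_cmult) measurable
    also have "\<dots> = ennreal (1 / ?w) * (ennreal (1 / \<rho> ^ DIM('a)) * (\<integral>\<^sup>+y\<in>B. f y \<partial>lborel))"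
      using nn_integral_lborel_affine[of "\<lambda>y. f y * indicator B y" \<rho> 0] \<rho> by simp
    also have "\<dots> = ennreal (1 / (?w * \<rho> ^ DIM('a))) * (\<integral>\<^sup>+y\<in>B. f y \<partial>lborel)"
      using \<rho> w by (simp add: mult.assoc[symmetric] ennreal_mult[symmetric])
    finally show ?thesis .
  qed
  moreover have "prob_space (shell_measure \<rho> :: 'a measure)"
    unfolding shell_measure_def by (rule prob_space.prob_space_distr[OF prob_space_shell_density]) simp
  ultimately show ?thesis using w \<rho>
    by (auto simp: dominated_probability_def shell_measure_def)
qed

text \<open>Both means are dominated on the ball of radius \<open>2 * \<rho>\<close> about the origin.\<close>

lemma shell_mean_minus_ball_mean:
  fixes u :: "'a::euclidean_space \<Rightarrow> real"
  assumes u: "C1_gradient u g" "\<And>x. \<bar>u x\<bar> \<le> U" and s: "0 < s" "s \<le> \<rho>" and x: "norm x \<le> s"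
  shows "ennreal (\<bar>ball_mean u x s - shell_mean u \<rho>\<bar> ^ DIM('a)) \<le>
     ennreal ((16 * \<rho> / s) ^ DIM('a) / shell_mass TYPE('a)) * (\<integral>\<^sup>+z. ennreal (norm (g z) ^ DIM('a)) \<partial>lborel)"
proof -
  let ?v = "unit_ball_vol (DIM('a))" and ?d = "DIM('a)" and ?w = "shell_mass TYPE('a)"
  have \<rho>: "0 < 2 * \<rho>" using s by simp
  have sub: "ball x s \<subseteq> ball 0 (2 * \<rho>)"
  proof
    fix z assume "z \<in> ball x s"
    then have "norm (z - x) < s" by (simp add: dist_norm norm_minus_commute)
    then have "norm z < 2 * s" using x norm_triangle_sub[of z x] by linarith
    then show "z \<in> ball 0 (2 * \<rho>)" using s by simp
  qed
  have "ennreal (\<bar>ball_mean u x s - shell_mean u \<rho>\<bar> ^ ?d) \<le>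
     ennreal (1 / (?w * \<rho> ^ ?d) * (1 / (?v * s ^ ?d) * ((2 * (2 * \<rho>)) ^ ?d * 2 ^ ?d * (?v * (2 * \<rho>) ^ ?d)))) *
        (\<integral>\<^sup>+z\<in>ball 0 (2 * \<rho>). ennreal (norm (g z) ^ ?d) \<partial>lborel)"
    unfolding ball_mean_def shell_mean_def
    by (rule means_difference[OF u dominated_probability_uniform_ball[OF s(1) sub] dominated_probability_shell \<rho>])
       (use s in \<open>auto simp: DIM_ge_Suc0\<close>)
  also have "1 / (?w * \<rho> ^ ?d) * (1 / (?v * s ^ ?d) * ((2 * (2 * \<rho>)) ^ ?d * 2 ^ ?d * (?v * (2 * \<rho>) ^ ?d))) = (16 * \<rho> / s) ^ ?d / ?w"
  proof -
    have "(16::real) ^ ?d = 4 ^ ?d * (2 ^ ?d * 2 ^ ?d)" by (simp add: power_mult_distrib[symmetric])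
    moreover have "?v > 0" by simp
    ultimately show ?thesis using s shell_mass_pos[where 'a='a]
      by (simp add: field_simps power_mult_distrib power_divide del: unit_ball_vol_pos)
  qed
  also have "ennreal ((16 * \<rho> / s) ^ ?d / ?w) * (\<integral>\<^sup>+z\<in>ball 0 (2 * \<rho>). ennreal (norm (g z) ^ ?d) \<partial>lborel)
     \<le> ennreal ((16 * \<rho> / s) ^ ?d / ?w) * (\<integral>\<^sup>+z. ennreal (norm (g z) ^ ?d) \<partial>lborel)"
    by (intro mult_left_mono nn_integral_mono) (auto simp: indicator_def)
  finally show ?thesis .
qed

lemma nn_integral_reciprocal:
  assumes "0 < (r::real)"
  shows "(\<integral>\<^sup>+\<tau>. ennreal (1 / \<tau>) * indicator {r / 2<..r} \<tau> \<partial>lborel) \<le> ennreal (ln 2)"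
proof -
  have "has_bochner_integral lborel (\<lambda>\<tau>. 1 / \<tau> * indicator {r / 2..r} \<tau>) (ln r - ln (r / 2))"
    by (rule has_bochner_integral_FTC_Icc_real) (use assms in \<open>auto intro!: derivative_eq_intros continuous_intros simp: field_simps\<close>)
  then have "(\<integral>\<^sup>+\<tau>. ennreal (1 / \<tau> * indicator {r / 2..r} \<tau>) \<partial>lborel) = ennreal (ln r - ln (r / 2))"
    using assms by (auto simp: has_bochner_integral_iff indicator_def intro!: nn_integral_eq_integral[THEN trans])
  moreover have "ln r - ln (r / 2) = ln 2" using assms by (simp add: ln_div)
  moreover have "(\<integral>\<^sup>+\<tau>. ennreal (1 / \<tau>) * indicator {r / 2<..r} \<tau> \<partial>lborel) \<le> (\<integral>\<^sup>+\<tau>. ennreal (1 / \<tau> * indicator {r / 2..r} \<tau>) \<partial>lborel)"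
    by (intro nn_integral_mono) (auto simp: indicator_def)
  ultimately show ?thesis by simp
qed

text \<open>On each ray, the weighted increment estimate with \<open>W = ln\<close>; then integrate over the shell and substitute \<open>z = \<tau> *\<^sub>R x\<close>. Because of
  the dilation invariant density every \<open>z\<close> collects the weight \<open>\<integral> 1 / \<tau>\<close> over the interval
  \<open>{norm z / 2<..norm z}\<close>, which is \<open>ln 2\<close>. Since \<open>ln 2 / shell_mass\<close> is the reciprocal of the area of the unit sphere,
  the constant is the sharp one; the comparison with the logarithmic upper bound depends on this.\<close>

lemma shell_mean_radial_increment:
  fixes u :: "'a::euclidean_space \<Rightarrow> real"
  assumes u: "C1_gradient u g" "\<And>x. \<bar>u x\<bar> \<le> U" and ab: "0 < a" "a \<le> b"
  shows "ennreal (\<bar>shell_mean u a - shell_mean u b\<bar> ^ DIM('a)) \<le>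
     ennreal (ln (b / a) ^ (DIM('a) - 1) * (ln 2 / shell_mass TYPE('a))) *
       (\<integral>\<^sup>+z\<in>{z. a \<le> norm z \<and> norm z < 2 * b}. ennreal (\<bar>sgn z \<bullet> g z\<bar> ^ DIM('a)) \<partial>lborel)"
proof -
  let ?d = "DIM('a)" and ?w = "shell_mass TYPE('a)"
  let ?P = "density lborel (\<lambda>x::'a. ennreal (shell_weight x / ?w))"
  have w: "?w > 0" by (rule shell_mass_pos)
  have d: "1 \<le> ?d" by (simp add: DIM_ge_Suc0)
  have cu: "continuous_on UNIV u" using C1_gradient_continuous[OF u(1)] .
  have [measurable]: "u \<in> borel_measurable borel" "g \<in> borel_measurable borel"
    using u(1) cu by (auto intro!: borel_measurable_continuous_onI simp: C1_gradient_def)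
  have ps: "prob_space ?P" by (rule prob_space_shell_density)
  interpret P: prob_space ?P by (rule ps)
  have mean: "shell_mean u \<rho> = (\<integral>x. u (\<rho> *\<^sub>R x) \<partial>?P)" for \<rho>
    unfolding shell_mean_def shell_measure_def by (rule integral_distr) auto
  have int: "integrable ?P (\<lambda>x. u (\<rho> *\<^sub>R x))" for \<rho>
    by (rule integrable_bounded_continuous[OF ps, where U=U])
       (auto intro!: continuous_on_compose2[OF cu] continuous_intros u(2))
  define h where "h z = ennreal (\<bar>sgn z \<bullet> g z\<bar> ^ ?d)" for z
  have [measurable]: "h \<in> borel_measurable borel" unfolding h_def by measurable
  let ?A = "\<lambda>x::'a. indicator {x::'a. 1 \<le> norm x \<and> norm x < 2} x :: ennreal"
  let ?I = "indicator {a..b} :: real \<Rightarrow> ennreal"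
  let ?L = "ennreal (ln (b / a) ^ (?d - 1))"
  have ray: "ennreal (\<bar>u (a *\<^sub>R x) - u (b *\<^sub>R x)\<bar> ^ ?d) \<le> ?L *
      (\<integral>\<^sup>+\<tau>\<in>{a..b}. ennreal (\<bar>x \<bullet> g (\<tau> *\<^sub>R x)\<bar> ^ ?d * \<tau> ^ (?d - 1)) \<partial>lborel)" for x
  proof -
    have "ennreal (\<bar>u (0 + b *\<^sub>R x) - u (0 + a *\<^sub>R x)\<bar> ^ ?d) \<le> ennreal ((ln b - ln a) ^ (?d - 1)) *
      (\<integral>\<^sup>+\<tau>\<in>{a..b}. ennreal (\<bar>x \<bullet> g (0 + \<tau> *\<^sub>R x)\<bar> ^ ?d / (1 / \<tau>) ^ (?d - 1)) \<partial>lborel)"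
      by (rule weighted_increment_power)
         (use ab d C1_gradient_along_line[OF u(1)] in \<open>auto intro!: derivative_eq_intros continuous_intros simp del: add_0\<close>)
    then show ?thesis using ab by (simp add: abs_minus_commute ln_div power_one_over)
  qed
  have "ennreal (\<bar>shell_mean u a - shell_mean u b\<bar> ^ ?d) = ennreal (\<bar>\<integral>x. u (a *\<^sub>R x) - u (b *\<^sub>R x) \<partial>?P\<bar> ^ ?d)"
    using int by (simp add: mean)
  also have "\<dots> \<le> (\<integral>\<^sup>+x. ennreal (\<bar>u (a *\<^sub>R x) - u (b *\<^sub>R x)\<bar> ^ ?d) \<partial>?P)"
    using power_mean_nn_integral[OF P.finite_measure_axioms, of "\<lambda>x. u (a *\<^sub>R x) - u (b *\<^sub>R x)" ?d] int d
    by (simp add: P.prob_space[simplified])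
  also have "\<dots> \<le> (\<integral>\<^sup>+x. ?L * (\<integral>\<^sup>+\<tau>\<in>{a..b}. ennreal (\<bar>x \<bullet> g (\<tau> *\<^sub>R x)\<bar> ^ ?d * \<tau> ^ (?d - 1)) \<partial>lborel) \<partial>?P)"
    by (intro nn_integral_mono ray)
  also have "\<dots> = (\<integral>\<^sup>+x. ennreal (shell_weight x / ?w) * (?L * (\<integral>\<^sup>+\<tau>\<in>{a..b}. ennreal (\<bar>x \<bullet> g (\<tau> *\<^sub>R x)\<bar> ^ ?d * \<tau> ^ (?d - 1)) \<partial>lborel)) \<partial>lborel)"
    by (subst nn_integral_density) auto
  also have "\<dots> = (\<integral>\<^sup>+x. \<integral>\<^sup>+\<tau>. ?L * (ennreal (1 / ?w) * (h (\<tau> *\<^sub>R x) * ?A x * ennreal (\<tau> ^ (?d - 1)) * ?I \<tau>)) \<partial>lborel \<partial>lborel)"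
  proof (rule nn_integral_cong)
    fix x :: 'a
    have pt: "ennreal (shell_weight x / ?w) * (ennreal (\<bar>x \<bullet> g (\<tau> *\<^sub>R x)\<bar> ^ ?d * \<tau> ^ (?d - 1)) * ?I \<tau>)
        = ennreal (1 / ?w) * (h (\<tau> *\<^sub>R x) * ?A x * ennreal (\<tau> ^ (?d - 1)) * ?I \<tau>)" for \<tau>
    proof (cases "1 \<le> norm x \<and> norm x < 2 \<and> \<tau> \<in> {a..b}")
      case True
      then have x: "norm x > 0" and \<tau>: "\<tau> > 0" using ab by auto
      have "sgn (\<tau> *\<^sub>R x) = x /\<^sub>R norm x" using x \<tau> by (simp add: sgn_div_norm)
      then have "\<bar>sgn (\<tau> *\<^sub>R x) \<bullet> g (\<tau> *\<^sub>R x)\<bar> ^ ?d = \<bar>x \<bullet> g (\<tau> *\<^sub>R x)\<bar> ^ ?d / norm x ^ ?d"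
        using x by (simp add: abs_mult power_mult_distrib power_divide divide_inverse power_inverse mult.commute)
      then show ?thesis using True x \<tau> w
        by (simp add: h_def shell_weight_def ennreal_mult[symmetric] mult_ac)
    qed (auto simp: shell_weight_def)
    show "ennreal (shell_weight x / ?w) * (?L * (\<integral>\<^sup>+\<tau>\<in>{a..b}. ennreal (\<bar>x \<bullet> g (\<tau> *\<^sub>R x)\<bar> ^ ?d * \<tau> ^ (?d - 1)) \<partial>lborel))
        = (\<integral>\<^sup>+\<tau>. ?L * (ennreal (1 / ?w) * (h (\<tau> *\<^sub>R x) * ?A x * ennreal (\<tau> ^ (?d - 1)) * ?I \<tau>)) \<partial>lborel)"
      unfolding pt[symmetric]
      by (simp add: nn_integral_cmult mult.left_commute)
  qed
  also have "\<dots> = (\<integral>\<^sup>+\<tau>. \<integral>\<^sup>+x. ?L * (ennreal (1 / ?w) * (h (\<tau> *\<^sub>R x) * ?A x * ennreal (\<tau> ^ (?d - 1)) * ?I \<tau>)) \<partial>lborel \<partial>lborel)"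
    by (rule lborel_pair.Fubini') measurable
  also have "\<dots> = (\<integral>\<^sup>+\<tau>. \<integral>\<^sup>+z. ?L * (ennreal (1 / ?w) * (h z * (ennreal (1 / \<tau>) * ?A (z /\<^sub>R \<tau>) * ?I \<tau>))) \<partial>lborel \<partial>lborel)"
  proof (rule nn_integral_cong)
    fix \<tau> :: real
    show "(\<integral>\<^sup>+x. ?L * (ennreal (1 / ?w) * (h (\<tau> *\<^sub>R x) * ?A x * ennreal (\<tau> ^ (?d - 1)) * ?I \<tau>)) \<partial>lborel) =
       (\<integral>\<^sup>+z. ?L * (ennreal (1 / ?w) * (h z * (ennreal (1 / \<tau>) * ?A (z /\<^sub>R \<tau>) * ?I \<tau>))) \<partial>lborel)"
    proof (cases "\<tau> \<in> {a..b}")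
      case True
      then have \<tau>: "\<tau> > 0" using ab by auto
      have "1 / \<tau> = 1 / \<tau> ^ ?d * \<tau> ^ (?d - 1)"
        using \<tau> d by (cases ?d) (auto simp: field_simps)
      then have pw: "ennreal (1 / \<tau>) = ennreal (1 / \<tau> ^ ?d) * ennreal (\<tau> ^ (?d - 1))"
        using \<tau> by (simp only: ennreal_mult[symmetric] zero_le_divide_1_iff zero_le_power less_imp_le)
      have "(\<integral>\<^sup>+x. h (0 + \<tau> *\<^sub>R x) * ?A ((0 + \<tau> *\<^sub>R x) /\<^sub>R \<tau>) \<partial>lborel) =
          ennreal (1 / \<bar>\<tau>\<bar> ^ ?d) * (\<integral>\<^sup>+z. h z * ?A (z /\<^sub>R \<tau>) \<partial>lborel)"
        by (rule nn_integral_lborel_affine, measurable) (use \<tau> in simp)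
      then have *: "(\<integral>\<^sup>+x. h (\<tau> *\<^sub>R x) * ?A x \<partial>lborel) = ennreal (1 / \<tau> ^ ?d) * (\<integral>\<^sup>+z. h z * ?A (z /\<^sub>R \<tau>) \<partial>lborel)"
        using \<tau> by simp
      have "(\<integral>\<^sup>+x. ?L * (ennreal (1 / ?w) * (h (\<tau> *\<^sub>R x) * ?A x * ennreal (\<tau> ^ (?d - 1)) * ?I \<tau>)) \<partial>lborel)
         = ?L * (ennreal (1 / ?w) * ((\<integral>\<^sup>+x. h (\<tau> *\<^sub>R x) * ?A x \<partial>lborel) * ennreal (\<tau> ^ (?d - 1))))"
        using True by (simp add: nn_integral_cmult nn_integral_multc)
      also have "\<dots> = ?L * (ennreal (1 / ?w) * ((\<integral>\<^sup>+z. h z * ?A (z /\<^sub>R \<tau>) \<partial>lborel) * ennreal (1 / \<tau>)))"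
        unfolding * pw by (simp only: mult_ac)
      also have "\<dots> = (\<integral>\<^sup>+z. ?L * (ennreal (1 / ?w) * (h z * ?A (z /\<^sub>R \<tau>) * ennreal (1 / \<tau>))) \<partial>lborel)"
        by (simp add: nn_integral_cmult nn_integral_multc)
      finally show ?thesis using True by (simp add: mult_ac)
    qed simp
  qed
  also have "\<dots> = (\<integral>\<^sup>+z. \<integral>\<^sup>+\<tau>. ?L * (ennreal (1 / ?w) * (h z * (ennreal (1 / \<tau>) * ?A (z /\<^sub>R \<tau>) * ?I \<tau>))) \<partial>lborel \<partial>lborel)"
    by (rule lborel_pair.Fubini') measurable
  also have "\<dots> \<le> (\<integral>\<^sup>+z. ?L * (ennreal (1 / ?w) * (ennreal (ln 2) * (h z * indicator {z. a \<le> norm z \<and> norm z < 2 * b} z))) \<partial>lborel)"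
  proof (rule nn_integral_mono)
    fix z :: 'a
    have *: "(\<integral>\<^sup>+\<tau>. ennreal (1 / \<tau>) * ?A (z /\<^sub>R \<tau>) * ?I \<tau> \<partial>lborel) \<le> ennreal (ln 2) * indicator {z. a \<le> norm z \<and> norm z < 2 * b} z"
    proof (cases "a \<le> norm z \<and> norm z < 2 * b")
      case True
      have "(\<integral>\<^sup>+\<tau>. ennreal (1 / \<tau>) * ?A (z /\<^sub>R \<tau>) * ?I \<tau> \<partial>lborel) \<le> (\<integral>\<^sup>+\<tau>. ennreal (1 / \<tau>) * indicator {norm z / 2<..norm z} \<tau> \<partial>lborel)"
        using ab by (intro nn_integral_mono) (auto simp: indicator_def field_simps)
      also have "\<dots> \<le> ennreal (ln 2)"
        by (rule nn_integral_reciprocal) (use ab True in linarith)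
      finally show ?thesis using True by simp
    next
      case False
      have *: "ennreal (1 / \<tau>) * ?A (z /\<^sub>R \<tau>) * ?I \<tau> = 0" for \<tau>
        using False ab by (auto simp: indicator_def field_simps)
      show ?thesis unfolding * by simp
    qed
    have "(\<integral>\<^sup>+\<tau>. ?L * (ennreal (1 / ?w) * (h z * (ennreal (1 / \<tau>) * ?A (z /\<^sub>R \<tau>) * ?I \<tau>))) \<partial>lborel)
       = ?L * (ennreal (1 / ?w) * (h z * (\<integral>\<^sup>+\<tau>. ennreal (1 / \<tau>) * ?A (z /\<^sub>R \<tau>) * ?I \<tau> \<partial>lborel)))"
      by (simp add: nn_integral_cmult)
    also have "\<dots> \<le> ?L * (ennreal (1 / ?w) * (h z * (ennreal (ln 2) * indicator {z. a \<le> norm z \<and> norm z < 2 * b} z)))"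
      by (intro mult_left_mono *) auto
    finally show "(\<integral>\<^sup>+\<tau>. ?L * (ennreal (1 / ?w) * (h z * (ennreal (1 / \<tau>) * ?A (z /\<^sub>R \<tau>) * ?I \<tau>))) \<partial>lborel)
       \<le> ?L * (ennreal (1 / ?w) * (ennreal (ln 2) * (h z * indicator {z. a \<le> norm z \<and> norm z < 2 * b} z)))"
      by (simp add: mult_ac)
  qed
  also have "\<dots> = ?L * (ennreal (1 / ?w) * (ennreal (ln 2) * (\<integral>\<^sup>+z\<in>{z. a \<le> norm z \<and> norm z < 2 * b}. h z \<partial>lborel)))"
    by (simp add: nn_integral_cmult)
  also have "\<dots> = ennreal (ln (b / a) ^ (?d - 1) * (ln 2 / ?w)) * (\<integral>\<^sup>+z\<in>{z. a \<le> norm z \<and> norm z < 2 * b}. h z \<partial>lborel)"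
    using w ab by (simp add: mult.assoc[symmetric] ennreal_mult[symmetric])
  finally show ?thesis unfolding h_def .
qed

section \<open>Shell means of functions that are large on a continuum\<close>

lemma ennreal_mult3:
  "0 \<le> a \<Longrightarrow> 0 \<le> b \<Longrightarrow> 0 \<le> c \<Longrightarrow> ennreal a * (ennreal b * ennreal c) = ennreal (a * (b * c))"
  by (simp add: ennreal_mult)

text \<open>In the conformal exponent the energy does not control the values of a function at points where the energy
  concentrates; this lemma provides a sphere free of such points. The annulus of half-width \<open>s / 2 ^ j\<close> about the
  radius \<open>\<tau>\<close> carries, after integration over \<open>\<tau>\<close>, at most \<open>2 * s / 2 ^ j * E\<close>. The weights \<open>(3/2) ^ j\<close> leave a geometric series
  of ratio \<open>3/4\<close> and sum \<open>8 * E * s\<close>, so that for some \<open>\<tau> \<in> {0..s}\<close> the weighted sum is at most \<open>9 * E\<close>.\<close>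

lemma exists_radius_small_concentration:
  fixes G :: "'a::euclidean_space \<Rightarrow> ennreal"
  assumes [measurable]: "G \<in> borel_measurable borel"
    and G: "(\<integral>\<^sup>+z. G z \<partial>lborel) \<le> ennreal E" and E: "0 < E" and s: "0 < s"
  shows "\<exists>\<tau>\<in>{0..s}. \<forall>j::nat. (\<integral>\<^sup>+z\<in>{z. \<bar>norm z - \<tau>\<bar> < s / 2 ^ j}. G z \<partial>lborel) \<le> ennreal (9 * E * (2/3) ^ j)"
proof -
  define I where "I j \<tau> z = (indicator {z::'a. \<bar>norm z - \<tau>\<bar> < s / 2 ^ j} z :: ennreal)" for j :: nat and \<tau> z
  have Ieq: "I j \<tau> z = indicator {\<tau>. \<bar>norm z - \<tau>\<bar> < s / 2 ^ j} \<tau>" for j \<tau> z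
    by (simp add: I_def indicator_def)
  have Im[measurable]: "(\<lambda>(\<tau>, z). I j \<tau> z) \<in> borel_measurable (borel \<Otimes>\<^sub>M borel)" for j
    unfolding I_def by measurable
  define H where "H j \<tau> = (\<integral>\<^sup>+z. G z * I j \<tau> z \<partial>lborel)" for j \<tau>
  have [measurable]: "H j \<in> borel_measurable borel" for j unfolding H_def[abs_def] by measurable
  have Hint: "(\<integral>\<^sup>+\<tau>. H j \<tau> \<partial>lborel) \<le> ennreal (2 * s / 2 ^ j) * ennreal E" for j
  proof -
    have "(\<integral>\<^sup>+\<tau>. H j \<tau> \<partial>lborel) = (\<integral>\<^sup>+z. \<integral>\<^sup>+\<tau>. G z * I j \<tau> z \<partial>lborel \<partial>lborel)"
      unfolding H_def by (rule lborel_pair.Fubini') measurable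
    also have "\<dots> \<le> (\<integral>\<^sup>+z. G z * ennreal (2 * s / 2 ^ j) \<partial>lborel)"
    proof (rule nn_integral_mono)
      fix z :: 'a
      have "(\<integral>\<^sup>+\<tau>. G z * I j \<tau> z \<partial>lborel) = G z * (\<integral>\<^sup>+\<tau>. indicator {\<tau>. \<bar>norm z - \<tau>\<bar> < s / 2 ^ j} \<tau> \<partial>lborel)"
        unfolding Ieq by (rule nn_integral_cmult) measurable
      also have "{\<tau>. \<bar>norm z - \<tau>\<bar> < s / 2 ^ j} = {norm z - s / 2 ^ j <..< norm z + s / 2 ^ j}" by auto
      also have "(\<integral>\<^sup>+\<tau>. indicator {norm z - s / 2 ^ j <..< norm z + s / 2 ^ j} \<tau> \<partial>lborel) = ennreal (2 * s / 2 ^ j)"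
        using s by simp
      finally show "(\<integral>\<^sup>+\<tau>. G z * I j \<tau> z \<partial>lborel) \<le> G z * ennreal (2 * s / 2 ^ j)" by simp
    qed
    also have "\<dots> = ennreal (2 * s / 2 ^ j) * (\<integral>\<^sup>+z. G z \<partial>lborel)"
      by (simp add: nn_integral_multc mult.commute)
    also have "\<dots> \<le> ennreal (2 * s / 2 ^ j) * ennreal E" by (intro mult_left_mono G) auto
    finally show ?thesis .
  qed
  define F where "F \<tau> = (\<Sum>j. ennreal ((3/2) ^ j) * H j \<tau>)" for \<tau>
  have "(\<integral>\<^sup>+\<tau>\<in>{0..s}. F \<tau> \<partial>lborel) \<le> (\<integral>\<^sup>+\<tau>. F \<tau> \<partial>lborel)"
    by (intro nn_integral_mono) (auto simp: indicator_def)
  also have "\<dots> = (\<Sum>j. ennreal ((3/2) ^ j) * (\<integral>\<^sup>+\<tau>. H j \<tau> \<partial>lborel))"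
    unfolding F_def by (subst nn_integral_suminf) (auto simp: nn_integral_cmult)
  also have "\<dots> \<le> (\<Sum>j. ennreal (2 * s * E * (3/4) ^ j))"
  proof (rule suminf_le)
    fix j
    have "ennreal ((3/2) ^ j) * (\<integral>\<^sup>+\<tau>. H j \<tau> \<partial>lborel) \<le> ennreal ((3/2) ^ j) * (ennreal (2 * s / 2 ^ j) * ennreal E)"
      by (intro mult_left_mono Hint) auto
    also have "\<dots> = ennreal ((3/2) ^ j * (2 * s / 2 ^ j * E))"
      using s E by (intro ennreal_mult3) auto
    also have "(3/2) ^ j * (2 * s / 2 ^ j * E) = 2 * s * E * (3/4) ^ j"
      by (simp add: power_divide) (simp add: power_mult_distrib[symmetric])
    finally show "ennreal ((3/2) ^ j) * (\<integral>\<^sup>+\<tau>. H j \<tau> \<partial>lborel) \<le> ennreal (2 * s * E * (3/4) ^ j)" .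
  qed auto
  also have "\<dots> = ennreal (\<Sum>j. 2 * s * E * (3/4) ^ j)"
    using s E by (intro suminf_ennreal2) (auto intro!: summable_mult summable_geometric)
  also have "(\<Sum>j. 2 * s * E * (3/4) ^ j) = 8 * E * s"
    by (subst suminf_mult) (auto simp: suminf_geometric summable_geometric)
  finally have le: "(\<integral>\<^sup>+\<tau>\<in>{0..s}. F \<tau> \<partial>lborel) \<le> ennreal (8 * E * s)" .
  have "\<exists>\<tau>\<in>{0..s}. F \<tau> \<le> ennreal (9 * E)"
  proof (rule ccontr)
    assume "\<not> ?thesis"
    then have "ennreal (9 * E) * indicator {0..s} \<tau> \<le> F \<tau> * indicator {0..s} \<tau>" for \<tau>
      by (auto simp: indicator_def not_le intro: less_imp_le)
    then have "(\<integral>\<^sup>+\<tau>. ennreal (9 * E) * indicator {0..s} \<tau> \<partial>lborel) \<le> (\<integral>\<^sup>+\<tau>\<in>{0..s}. F \<tau> \<partial>lborel)"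
      by (intro nn_integral_mono)
    also have "(\<integral>\<^sup>+\<tau>. ennreal (9 * E) * indicator {0..s} \<tau> \<partial>lborel) = ennreal (9 * E * s)"
      using s E by (simp add: nn_integral_cmult ennreal_mult)
    also note le
    finally show False using s E by (simp add: ennreal_le_iff)
  qed
  then obtain \<tau> where \<tau>: "\<tau> \<in> {0..s}" "F \<tau> \<le> ennreal (9 * E)" by blast
  have "H j \<tau> \<le> ennreal (9 * E * (2/3) ^ j)" for j
  proof -
    have "ennreal ((3/2) ^ j) * H j \<tau> \<le> F \<tau>"
      unfolding F_def by (rule sum_le_suminf[of _ "{j}", simplified]) auto
    then have "ennreal ((3/2) ^ j) * H j \<tau> \<le> ennreal (9 * E)" using \<tau>(2) by (rule order_trans)
    then have "ennreal ((2/3) ^ j) * (ennreal ((3/2) ^ j) * H j \<tau>) \<le> ennreal ((2/3) ^ j) * ennreal (9 * E)"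
      by (rule mult_left_mono) auto
    moreover have "ennreal ((2/3) ^ j) * (ennreal ((3/2) ^ j) * H j \<tau>) = H j \<tau>"
      by (simp add: mult.assoc[symmetric] ennreal_mult[symmetric] power_mult_distrib[symmetric])
    ultimately show ?thesis using E by (simp add: ennreal_mult[symmetric] mult.commute)
  qed
  then show ?thesis using \<tau>(1) unfolding H_def I_def by (intro bexI[of _ \<tau>]) auto
qed

lemma ball_mean_tendsto:
  fixes u :: "'a::euclidean_space \<Rightarrow> real"
  assumes u: "continuous_on UNIV u" "\<And>x. \<bar>u x\<bar> \<le> U" and s: "0 < s"
  shows "(\<lambda>j. ball_mean u x (s / 2 ^ j)) \<longlonglongrightarrow> u x"
proof (rule LIMSEQ_I)
  fix e :: real assume e: "0 < e"
  have "isCont u x" using u(1) by (simp add: continuous_on_eq_continuous_at)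
  then obtain d where d: "d > 0" "\<And>z. dist z x < d \<Longrightarrow> dist (u z) (u x) < e / 2"
    using e unfolding continuous_at_eps_delta by (metis half_gt_zero)
  have "(\<lambda>j. s * (1/2) ^ j) \<longlonglongrightarrow> s * 0"
    by (intro tendsto_mult tendsto_const LIMSEQ_power_zero) simp
  then have "eventually (\<lambda>j. s * (1/2) ^ j < d) sequentially"
    using d(1) by (auto dest: order_tendstoD)
  then obtain N where N: "\<And>j. j \<ge> N \<Longrightarrow> s / 2 ^ j < d"
    by (auto simp: eventually_sequentially power_divide)
  have "norm (ball_mean u x (s / 2 ^ j) - u x) < e" if "j \<ge> N" for j
  proof -
    let ?r = "s / 2 ^ j"
    have r: "0 < ?r" using s by simp
    let ?m = "unit_ball_vol (DIM('a)) * ?r ^ DIM('a)"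
    have m: "?m > 0" using r by simp
    have "ennreal (\<bar>ball_mean u x ?r - u x\<bar> ^ 1) \<le> ennreal (1 / ?m) * (\<integral>\<^sup>+z\<in>ball x ?r. ennreal (\<bar>u z - u x\<bar> ^ 1) \<partial>lborel)"
      unfolding ball_mean_def
      by (rule mean_minus_const_power_dominated[OF dominated_probability_uniform_ball[OF r order_refl] u]) simp
    also have "\<dots> \<le> ennreal (1 / ?m) * (\<integral>\<^sup>+z. ennreal (e / 2) * indicator (ball x ?r) z \<partial>lborel)"
    proof (intro mult_left_mono nn_integral_mono)
      fix z
      show "ennreal (\<bar>u z - u x\<bar> ^ 1) * indicator (ball x ?r) z \<le> ennreal (e / 2) * indicator (ball x ?r) z"
        using d(2)[of z] N[OF that] dist_commute[of z x] by (auto simp: indicator_def dist_real_def intro!: ennreal_leI)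
    qed simp
    also have "\<dots> = ennreal (1 / ?m) * (ennreal (e / 2) * ennreal ?m)"
      by (subst nn_integral_cmult_indicator) (use r in \<open>auto simp: emeasure_ball\<close>)
    also have "\<dots> = ennreal (1 / ?m * (e / 2 * ?m))"
      using m e by (simp only: ennreal_mult[symmetric] less_imp_le zero_le_divide_1_iff half_gt_zero mult_nonneg_nonneg)
    also have "1 / ?m * (e / 2 * ?m) = e / 2"
      using m less_numeral_extra(3) by (metis divide_cancel_right nonzero_mult_div_cancel_right times_divide_eq_left mult_1 mult.commute times_divide_eq_right)
    finally show ?thesis using e by (simp add: ennreal_le_iff)
  qed
  then show "\<exists>no. \<forall>n\<ge>no. norm (ball_mean u x (s / 2 ^ n) - u x) < e" by blast
qed

lemma le_root_of_power_le:
  assumes "0 < d" "ennreal (\<bar>a\<bar> ^ d) \<le> ennreal C" "0 \<le> C"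
  shows "\<bar>a\<bar> \<le> root d C"
  using assms by (metis abs_ge_zero ennreal_le_iff real_root_le_iff real_root_pos2)

text \<open>Telescope over the balls of radius \<open>s / 2 ^ j\<close>. By the decay of their energies, consecutive means
  differ by the terms of a geometric series.\<close>

lemma value_minus_ball_mean:
  fixes u :: "'a::euclidean_space \<Rightarrow> real"
  assumes u: "C1_gradient u g" "\<And>x. \<bar>u x\<bar> \<le> U" and s: "0 < s" and E: "0 \<le> E"
    and conc: "\<And>j::nat. (\<integral>\<^sup>+z\<in>ball x (s / 2 ^ j). ennreal (norm (g z) ^ DIM('a)) \<partial>lborel) \<le> ennreal (9 * E * (2/3) ^ j)"
  shows "\<bar>ball_mean u x s - u x\<bar> \<le> root DIM('a) (8 ^ DIM('a) / unit_ball_vol (DIM('a)) * 9) / (1 - root DIM('a) (2/3)) * root DIM('a) E"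
proof -
  let ?d = "DIM('a)" and ?v = "unit_ball_vol (DIM('a))"
  let ?K = "8 ^ ?d / ?v"
  let ?q = "root ?d (2/3)"
  let ?A = "root ?d (?K * 9) * root ?d E"
  have K: "?K > 0" by simp
  have q: "0 < ?q" "?q < 1" by (auto simp: real_root_lt_1_iff)
  have A0: "0 \<le> ?A" using E K by (intro mult_nonneg_nonneg real_root_ge_zero) auto
  let ?m = "\<lambda>j::nat. ball_mean u x (s / 2 ^ j)"
  have step: "\<bar>?m j - ?m (Suc j)\<bar> \<le> ?A * ?q ^ j" for j
  proof -
    have "ennreal (\<bar>?m j - ?m (Suc j)\<bar> ^ ?d) \<le> ennreal ?K * (\<integral>\<^sup>+z\<in>ball x (s / 2 ^ j). ennreal (norm (g z) ^ ?d) \<partial>lborel)"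
      using ball_mean_halving[OF u, of "s / 2 ^ j" x] s by (simp add: mult.commute)
    also have "\<dots> \<le> ennreal ?K * ennreal (9 * E * (2/3) ^ j)"
      by (intro mult_left_mono conc) auto
    also have "\<dots> = ennreal (?K * (9 * E * (2/3) ^ j))"
      using E K by (intro ennreal_mult[symmetric]) auto
    finally have "\<bar>?m j - ?m (Suc j)\<bar> \<le> root ?d (?K * (9 * E * (2/3) ^ j))"
      using E K by (intro le_root_of_power_le) auto
    also have "\<dots> = ?A * ?q ^ j"
      by (simp only: mult.assoc[symmetric] real_root_mult real_root_power DIM_positive)
    finally show ?thesis .
  qed
  have tele: "\<bar>?m 0 - ?m j\<bar> \<le> ?A / (1 - ?q)" for j
  proof -
    have "\<bar>?m 0 - ?m j\<bar> \<le> ?A * (\<Sum>i<j. ?q ^ i)"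
    proof (induction j)
      case (Suc j)
      then show ?case using step[of j] by (simp add: algebra_simps)
    qed simp
    also have "(\<Sum>i<j. ?q ^ i) = (1 - ?q ^ j) / (1 - ?q)"
      using q by (simp add: sum_gp_strict)
    also have "?A * ((1 - ?q ^ j) / (1 - ?q)) \<le> ?A * (1 / (1 - ?q))"
      using q A0 by (intro mult_left_mono divide_right_mono) auto
    finally show ?thesis by simp
  qed
  have "(\<lambda>j. \<bar>?m 0 - ?m j\<bar>) \<longlonglongrightarrow> \<bar>?m 0 - u x\<bar>"
    by (intro tendsto_rabs tendsto_diff tendsto_const ball_mean_tendsto[OF C1_gradient_continuous[OF u(1)] u(2) s])
  then have "\<bar>?m 0 - u x\<bar> \<le> ?A / (1 - ?q)"
    by (rule LIMSEQ_le_const2) (use tele in blast)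
  then show ?thesis by (simp add: mult.commute)
qed

text \<open>A connected set that contains \<open>0\<close> and a point at distance at least \<open>s\<close> meets the sphere on which the energy does not
  concentrate, and at the common point \<open>u \<ge> 1\<close>. The value there, the mean over a ball of radius \<open>s\<close> and the shell mean at
  radius \<open>\<kappa> * s\<close> are successively close. The constant depends on \<open>\<kappa>\<close> and the dimension only.\<close>

lemma shell_mean_near_continuum:
  fixes \<kappa> :: real
  assumes \<kappa>: "1 \<le> \<kappa>"
  shows "\<exists>C\<ge>0. \<forall>(u :: 'a::euclidean_space \<Rightarrow> real) g U K y s E.
     C1_gradient u g \<longrightarrow> (\<forall>x. \<bar>u x\<bar> \<le> U) \<longrightarrow> connected K \<longrightarrow> 0 \<in> K \<longrightarrow> y \<in> K \<longrightarrow> 0 < s \<longrightarrow> s \<le> norm y \<longrightarrow>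
     (\<forall>x\<in>K. 1 \<le> u x) \<longrightarrow> 0 < E \<longrightarrow> (\<integral>\<^sup>+z. ennreal (norm (g z) ^ DIM('a)) \<partial>lborel) \<le> ennreal E \<longrightarrow>
     1 - C * root DIM('a) E \<le> shell_mean u (\<kappa> * s)"
proof -
  let ?d = "DIM('a)"
  let ?C1 = "root ?d (8 ^ ?d / unit_ball_vol (DIM('a)) * 9) / (1 - root ?d (2/3))"
  let ?C2 = "root ?d ((16 * \<kappa>) ^ ?d / shell_mass TYPE('a))"
  have C: "0 \<le> ?C1" "0 \<le> ?C2"
    using shell_mass_pos[where 'a='a] \<kappa> by (auto intro!: divide_nonneg_nonneg real_root_ge_zero simp: real_root_le_1_iff)
  have main: "1 - (?C1 + ?C2) * root ?d E \<le> shell_mean u (\<kappa> * s)"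
    if u: "C1_gradient u g" "\<And>x. \<bar>u x\<bar> \<le> U" and K: "connected K" "0 \<in> K" "y \<in> K"
      and s: "0 < s" "s \<le> norm y" and u1: "\<And>x. x \<in> K \<Longrightarrow> 1 \<le> u x"
      and E: "0 < E" "(\<integral>\<^sup>+z. ennreal (norm (g z) ^ ?d) \<partial>lborel) \<le> ennreal E"
    for u :: "'a \<Rightarrow> real" and g U K y s E
  proof -
    have [measurable]: "g \<in> borel_measurable borel"
      using u(1) by (auto intro!: borel_measurable_continuous_onI simp: C1_gradient_def)
    obtain \<tau> where \<tau>: "\<tau> \<in> {0..s}"
      and conc: "\<And>j::nat. (\<integral>\<^sup>+z\<in>{z. \<bar>norm z - \<tau>\<bar> < s / 2 ^ j}. ennreal (norm (g z) ^ ?d) \<partial>lborel) \<le> ennreal (9 * E * (2/3) ^ j)"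
      using exists_radius_small_concentration[of "\<lambda>z. ennreal (norm (g z) ^ ?d)" E s] E s by auto
    have "connected (norm ` K)"
      by (intro connected_continuous_image K continuous_intros)
    moreover have "0 \<in> norm ` K" "norm y \<in> norm ` K" using K by (auto intro: rev_image_eqI)
    ultimately have "\<tau> \<in> norm ` K"
      using \<tau> s connectedD_interval[of "norm ` K" 0 "norm y" \<tau>] by auto
    then obtain x where x: "x \<in> K" "norm x = \<tau>" by auto
    have sub: "ball x r \<subseteq> {z. \<bar>norm z - \<tau>\<bar> < r}" for r
    proof
      fix z assume "z \<in> ball x r"
      then have "norm (x - z) < r" by (simp add: dist_norm)
      then show "z \<in> {z. \<bar>norm z - \<tau>\<bar> < r}"
        using norm_triangle_ineq3[of x z] x(2) by (simp add: abs_minus_commute)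
    qed
    have "(\<integral>\<^sup>+z\<in>ball x (s / 2 ^ j). ennreal (norm (g z) ^ ?d) \<partial>lborel) \<le> ennreal (9 * E * (2/3) ^ j)" for j :: nat
      by (rule order_trans[OF nn_integral_mono conc[of j]]) (use sub[of "s / 2 ^ j"] in \<open>auto simp: indicator_def\<close>)
    then have 1: "\<bar>ball_mean u x s - u x\<bar> \<le> ?C1 * root ?d E"
      using E s by (intro value_minus_ball_mean[OF u]) auto
    have "s \<le> \<kappa> * s" using \<kappa> s by simp
    then have "ennreal (\<bar>ball_mean u x s - shell_mean u (\<kappa> * s)\<bar> ^ ?d) \<le>
        ennreal ((16 * (\<kappa> * s) / s) ^ ?d / shell_mass TYPE('a)) * (\<integral>\<^sup>+z. ennreal (norm (g z) ^ ?d) \<partial>lborel)"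
      using shell_mean_minus_ball_mean[OF u s(1), of "\<kappa> * s" x] x(2) \<tau> by simp
    also have "\<dots> \<le> ennreal ((16 * (\<kappa> * s) / s) ^ ?d / shell_mass TYPE('a)) * ennreal E"
      by (intro mult_left_mono E) auto
    also have "\<dots> = ennreal ((16 * \<kappa>) ^ ?d / shell_mass TYPE('a) * E)"
      using E s \<kappa> shell_mass_pos[where 'a='a] by (subst ennreal_mult[symmetric]) auto
    finally have "\<bar>ball_mean u x s - shell_mean u (\<kappa> * s)\<bar> \<le> root ?d ((16 * \<kappa>) ^ ?d / shell_mass TYPE('a) * E)"
      using E \<kappa> shell_mass_pos[where 'a='a] by (intro le_root_of_power_le) auto
    then have 2: "\<bar>ball_mean u x s - shell_mean u (\<kappa> * s)\<bar> \<le> ?C2 * root ?d E"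
      by (simp only: real_root_mult)
    show ?thesis using 1 2 u1[OF x(1)] by (simp add: algebra_simps)
  qed
  show ?thesis
  proof (intro exI[of _ "?C1 + ?C2"] conjI allI impI)
    show "0 \<le> ?C1 + ?C2" using C by linarith
  qed (rule main, assumption, erule spec, assumption+, erule (1) bspec, assumption+)
qed

section \<open>Competitors and their truncation\<close>

text \<open>A function of class \<open>C\<^sup>1\<close> in place of the positive part: \<open>0\<close> for \<open>s \<le> 0\<close>, quadratic on \<open>{0..\<delta>}\<close>, and \<open>s - \<delta> / 2\<close>
  for \<open>s \<ge> \<delta>\<close>.\<close>

definition ramp :: "real \<Rightarrow> real \<Rightarrow> real" where
  "ramp \<delta> s = ((max 0 s)\<^sup>2 - (max 0 (s - \<delta>))\<^sup>2) / (2 * \<delta>)"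

definition ramp_slope :: "real \<Rightarrow> real \<Rightarrow> real" where
  "ramp_slope \<delta> s = (max 0 s - max 0 (s - \<delta>)) / \<delta>"

lemma has_derivative_max0_square:
  "((\<lambda>s. (max 0 s)\<^sup>2) has_real_derivative 2 * max 0 s) (at (s::real))"
proof -
  consider "s < 0" | "s > 0" | "s = 0" by linarith
  then show ?thesis
  proof cases
    case 1
    have "((\<lambda>s. 0) has_real_derivative 0) (at s)" by simp
    then have "((\<lambda>s. (max 0 s)\<^sup>2) has_real_derivative 0) (at s)"
      by (rule has_field_derivative_transform_within_open[of _ _ _ "{..<0}"]) (use 1 in auto)
    then show ?thesis using 1 by simp
  next
    case 2
    have "((\<lambda>s. s\<^sup>2) has_real_derivative 2 * s) (at s)" by (auto intro!: derivative_eq_intros)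
    then have "((\<lambda>s. (max 0 s)\<^sup>2) has_real_derivative 2 * s) (at s)"
      by (rule has_field_derivative_transform_within_open[of _ _ _ "{0<..}"]) (use 2 in auto)
    then show ?thesis using 2 by simp
  next
    case 3
    have "((\<lambda>h. ((max 0 (0 + h))\<^sup>2 - (max 0 0)\<^sup>2) / h) \<longlongrightarrow> 0) (at (0::real))"
    proof (rule Lim_null_comparison)
      show "\<forall>\<^sub>F h in at 0. norm (((max 0 (0 + h))\<^sup>2 - (max 0 0)\<^sup>2) / h) \<le> \<bar>h\<bar>"
        by (intro always_eventually) (auto simp: max_def power2_eq_square)
      show "((\<lambda>h::real. \<bar>h\<bar>) \<longlongrightarrow> 0) (at 0)"
        by (intro tendsto_rabs_zero tendsto_ident_at)
    qed
    then show ?thesis using 3 by (simp add: DERIV_def)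
  qed
qed

lemma has_derivative_ramp: "\<delta> > 0 \<Longrightarrow> (ramp \<delta> has_real_derivative ramp_slope \<delta> s) (at s)"
  unfolding ramp_def[abs_def] ramp_slope_def
  by (rule has_derivative_max0_square[THEN DERIV_chain2] derivative_eq_intros refl | simp add: field_simps)+

lemma continuous_ramp_slope: "\<delta> > 0 \<Longrightarrow> continuous_on A (ramp_slope \<delta>)"
  unfolding ramp_slope_def[abs_def] by (intro continuous_intros) auto

lemma ramp_slope_bounds: "\<delta> > 0 \<Longrightarrow> 0 \<le> ramp_slope \<delta> s" "\<delta> > 0 \<Longrightarrow> ramp_slope \<delta> s \<le> 1"
  by (auto simp: ramp_slope_def max_def field_simps)

lemma ramp_values:
  "s \<le> 0 \<Longrightarrow> \<delta> > 0 \<Longrightarrow> ramp \<delta> s = 0" "\<delta> \<le> s \<Longrightarrow> \<delta> > 0 \<Longrightarrow> ramp \<delta> s = s - \<delta> / 2"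
  "s \<le> 0 \<Longrightarrow> \<delta> > 0 \<Longrightarrow> ramp_slope \<delta> s = 0" "\<delta> \<le> s \<Longrightarrow> \<delta> > 0 \<Longrightarrow> ramp_slope \<delta> s = 1"
  by (auto simp: ramp_def ramp_slope_def max_def power2_eq_square field_simps)

lemma C1_compact_support_in_C1_gradient: "C1_compact_support_in D u g \<Longrightarrow> C1_gradient u g"
  by (simp add: C1_compact_support_in_def C1_gradient_def)

lemma zero_outside_support:
  assumes "C1_compact_support_in D u g" "x \<notin> closure (support_on UNIV u)"
  shows "u x = 0" "g x = 0"
proof -
  have z: "u y = 0" if "y \<in> - closure (support_on UNIV u)" for y
    using that closure_subset[of "support_on UNIV u"] by (auto simp: support_on_def)
  then show "u x = 0" using assms by auto
  have "(u has_derivative (\<lambda>h. 0)) (at x)"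
    by (rule has_derivative_transform_within_open[where f="\<lambda>_. 0" and s="- closure (support_on UNIV u)"])
       (use assms z in auto)
  moreover have "(u has_derivative (\<lambda>h. h \<bullet> g x)) (at x)"
    using assms by (simp add: C1_compact_support_in_def gderiv_def)
  ultimately have "(\<lambda>h. h \<bullet> g x) = (\<lambda>h. 0)" by (rule has_derivative_unique[rotated])
  then show "g x = 0" by (metis inner_eq_zero_iff)
qed

lemma zero_outside_domain:
  assumes "C1_compact_support_in D u g" "x \<notin> D"
  shows "u x = 0" "g x = 0"
  using zero_outside_support[OF assms(1)] assms by (auto simp: C1_compact_support_in_def)

lemma C1_compact_support_bounded:
  assumes "C1_compact_support_in D u g"
  shows "\<exists>U. \<forall>x. \<bar>u x\<bar> \<le> U"
proof -
  let ?S = "closure (support_on UNIV u)"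
  have "continuous_on ?S u"
    using C1_gradient_continuous[OF C1_compact_support_in_C1_gradient[OF assms]] by (rule continuous_on_subset) simp
  moreover have "compact ?S" using assms by (simp add: C1_compact_support_in_def)
  ultimately have "compact (u ` ?S)" by (rule compact_continuous_image)
  then obtain U where "\<And>y. y \<in> u ` ?S \<Longrightarrow> norm y \<le> U" using compact_imp_bounded bounded_iff by metis
  then have "\<bar>u x\<bar> \<le> max U 0" for x
    using zero_outside_support(1)[OF assms, of x] by (cases "x \<in> ?S") (auto simp: le_max_iff_disj)
  then show ?thesis by blast
qed

abbreviation dirichlet :: "(real^'n \<Rightarrow> real^'n) \<Rightarrow> ennreal" where
  "dirichlet g \<equiv> \<integral>\<^sup>+x. ennreal (norm (g x) ^ CARD('n)) \<partial>lborel"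

lemma integrable_continuous_supported:
  fixes F :: "'a::euclidean_space \<Rightarrow> real"
  assumes "continuous_on UNIV F" "compact S" "\<And>x. x \<notin> S \<Longrightarrow> F x = 0"
  shows "integrable lborel F"
proof -
  have "integrable lborel (\<lambda>x. indicator S x *\<^sub>R F x)"
    by (rule borel_integrable_compact[OF assms(2) continuous_on_subset[OF assms(1)]]) simp
  moreover have "indicator S x *\<^sub>R F x = F x" for x using assms(3)[of x] by (cases "x \<in> S") auto
  ultimately show ?thesis by (simp only:)
qed

lemma integrable_gradient_power:
  fixes g :: "real^'n \<Rightarrow> real^'n"
  assumes "C1_compact_support_in D u g"
  shows "integrable lborel (\<lambda>x. norm (g x) ^ CARD('n))"
  using assms zero_outside_support(2)[OF assms]
  by (intro integrable_continuous_supported[where S="closure (support_on UNIV u)"])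
     (auto simp: C1_compact_support_in_def intro!: continuous_intros)

lemma dirichlet_eq_integral:
  fixes g :: "real^'n \<Rightarrow> real^'n"
  assumes "C1_compact_support_in D u g"
  shows "dirichlet g = ennreal (\<integral>x. norm (g x) ^ CARD('n) \<partial>lborel)"
  by (rule nn_integral_eq_integral) (use integrable_gradient_power[OF assms] in auto)

definition admissible :: "(real^'n) set \<Rightarrow> (real^'n) set \<Rightarrow> (real^'n \<Rightarrow> real) \<Rightarrow> (real^'n \<Rightarrow> real^'n) \<Rightarrow> bool" where
  "admissible D K u g \<longleftrightarrow> C1_compact_support_in D u g \<and> (\<forall>x\<in>K. 1 \<le> u x)"

lemma capacity_le_dirichlet:
  assumes "admissible D K u g"
  shows "capacity D K \<le> dirichlet g"
proof -
  have "capacity D K \<le> (\<integral>\<^sup>+x\<in>D - K. ennreal (norm (g x) ^ CARD('a)) \<partial>lborel)"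
    unfolding capacity_def by (rule Inf_lower) (use assms in \<open>auto simp: admissible_def\<close>)
  also have "\<dots> \<le> dirichlet g" by (intro nn_integral_mono) (auto simp: indicator_def)
  finally show ?thesis .
qed

lemma closure_support_in_compact:
  fixes f :: "'a::t2_space \<Rightarrow> real"
  assumes "support_on UNIV f \<subseteq> S" "compact S" "S \<subseteq> D"
  shows "compact (closure (support_on UNIV f)) \<and> closure (support_on UNIV f) \<subseteq> D"
proof -
  have *: "closure (support_on UNIV f) \<subseteq> S"
    using assms compact_imp_closed closure_minimal by blast
  then have "closure (support_on UNIV f) = S \<inter> closure (support_on UNIV f)" by blast
  then have "compact (closure (support_on UNIV f))"
    using compact_Int_closed[OF assms(2) closed_closure] by metis
  then show ?thesis using * assms(3) by blast
qed

text \<open>The capacity integrates over \<open>D - K\<close> only, and \<open>K\<close> may have positive measure even if it is an arc. Composing \<open>u\<close> with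
  a function that is constant above the level \<open>1\<close> removes the energy on \<open>K\<close>; since the
  composite has to be of class \<open>C\<^sup>1\<close>, the slope below the level \<open>1\<close> slightly exceeds \<open>1\<close>.\<close>

lemma truncate_competitor:
  assumes D: "open D" and K: "compact K" and ad: "admissible D K u g" and \<epsilon>: "0 < \<epsilon>" "\<epsilon> \<le> 1"
  shows "\<exists>u' g'. admissible D K u' g' \<and>
    dirichlet g' \<le> ennreal ((1 + \<epsilon>) ^ CARD('n)) * (\<integral>\<^sup>+x\<in>D - K. ennreal (norm (g (x::real^'n)) ^ CARD('n)) \<partial>lborel)"
proof -
  define \<delta> where "\<delta> = 2 * \<epsilon> / (1 + \<epsilon>)"
  have \<delta>: "0 < \<delta>" "\<delta> \<le> 1" using \<epsilon> by (auto simp: \<delta>_def field_simps)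
  define h where "h t = 1 - (1 + \<epsilon>) * ramp \<delta> (1 - t)" for t
  define h' where "h' t = (1 + \<epsilon>) * ramp_slope \<delta> (1 - t)" for t
  have hd: "(h has_real_derivative h' t) (at t)" for t
    unfolding h_def[abs_def] h'_def
    by (rule derivative_eq_intros has_derivative_ramp[OF \<delta>(1), THEN DERIV_chain2] refl | simp)+
  have h0: "h 0 = 0"
    using ramp_values(2)[of \<delta> 1] \<delta> \<epsilon> by (simp add: h_def \<delta>_def field_simps)
  have h1: "h t = 1" "h' t = 0" if "1 \<le> t" for t
    using that ramp_values(1,3)[of "1 - t" \<delta>] \<delta> by (simp_all add: h_def h'_def)
  have h'b: "0 \<le> h' t" "h' t \<le> 1 + \<epsilon>" for t
    using ramp_slope_bounds[OF \<delta>(1), of "1 - t"] \<epsilon> by (auto simp: h'_def mult_le_cancel_left1)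
  have ch': "continuous_on A h'" for A
    unfolding h'_def[abs_def] by (intro continuous_intros continuous_on_compose2[OF continuous_ramp_slope[OF \<delta>(1)]]) auto
  have C: "C1_compact_support_in D u g" and u1: "\<And>x. x \<in> K \<Longrightarrow> 1 \<le> u x" using ad by (auto simp: admissible_def)
  have cu: "continuous_on UNIV u"
    using C1_gradient_continuous[OF C1_compact_support_in_C1_gradient[OF C]] .
  let ?u = "\<lambda>x. h (u x)" and ?g = "\<lambda>x. h' (u x) *\<^sub>R g x"
  have "support_on UNIV ?u \<subseteq> support_on UNIV u" using h0 by (auto simp: support_on_def)
  then have sup: "compact (closure (support_on UNIV ?u)) \<and> closure (support_on UNIV ?u) \<subseteq> D"
    using C closure_subset[of "support_on UNIV u"]
    by (intro closure_support_in_compact[of _ "closure (support_on UNIV u)"]) (auto simp: C1_compact_support_in_def)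
  have "GDERIV ?u x :> ?g x" for x
    using GDERIV_DERIV_compose[of u x "g x" h "h' (u x)"] C hd by (simp add: C1_compact_support_in_def)
  moreover have "continuous_on UNIV ?g"
    using C cu by (intro continuous_intros continuous_on_compose2[OF ch'[of UNIV]]) (auto simp: C1_compact_support_in_def)
  ultimately have "C1_compact_support_in D ?u ?g" using sup by (simp add: C1_compact_support_in_def)
  moreover have "\<forall>x\<in>K. 1 \<le> ?u x" using h1 u1 by simp
  ultimately have adm: "admissible D K ?u ?g" by (simp add: admissible_def)
  have [measurable]: "g \<in> borel_measurable borel"
    using C by (auto simp: C1_compact_support_in_def intro!: borel_measurable_continuous_onI)
  have pt: "ennreal (norm (?g x) ^ CARD('n)) \<le> ennreal ((1 + \<epsilon>) ^ CARD('n)) * (ennreal (norm (g x) ^ CARD('n)) * indicator (D - K) x)" for x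
  proof (cases "x \<in> D - K")
    case True
    have "norm (?g x) ^ CARD('n) \<le> ((1 + \<epsilon>) * norm (g x)) ^ CARD('n)"
      using h'b[of "u x"] by (intro power_mono) (auto intro: mult_right_mono)
    then show ?thesis using True \<epsilon> by (simp add: ennreal_mult[symmetric] power_mult_distrib ennreal_leI)
  next
    case False
    then have "?g x = 0" using zero_outside_domain(2)[OF C, of x] h1(2)[of "u x"] u1[of x] by auto
    then have *: "norm (?g x) ^ CARD('n) = 0" by (simp add: power_0_left)
    show ?thesis unfolding * by simp
  qed
  have "dirichlet ?g \<le> ennreal ((1 + \<epsilon>) ^ CARD('n)) * (\<integral>\<^sup>+x\<in>D - K. ennreal (norm (g x) ^ CARD('n)) \<partial>lborel)"
  proof -
    have [measurable]: "D - K \<in> sets borel" using D K by (intro sets.Diff borel_open borel_compact)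
    show ?thesis using pt by (subst nn_integral_cmult[symmetric]) (auto intro!: nn_integral_mono)
  qed
  then show ?thesis using adm by blast
qed

text \<open>The energy in the infimum may thus be taken over the whole space, where substitutions are convenient.\<close>

lemma capacity_less_competitor:
  fixes D :: "(real^'n) set"
  assumes D: "open D" and K: "compact K" and c: "capacity D K < c"
  shows "\<exists>u g. admissible D K u g \<and> dirichlet g < c"
proof -
  obtain u g where ad: "admissible D K u g"
    and lt: "(\<integral>\<^sup>+x\<in>D - K. ennreal (norm (g x) ^ CARD('n)) \<partial>lborel) < c" (is "?A < c")
    using c unfolding capacity_def Inf_less_iff admissible_def by blast
  have "?A < \<infinity>" using lt by (auto simp: less_top[symmetric])
  then obtain a where a: "?A = ennreal a" "0 \<le> a" by (cases ?A) auto
  have "((\<lambda>\<epsilon>. ennreal ((1 + \<epsilon>) ^ CARD('n) * a)) \<longlongrightarrow> ennreal ((1 + 0) ^ CARD('n) * a)) (at_right 0)"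
    by (intro tendsto_intros tendsto_ennrealI)
  then have "eventually (\<lambda>\<epsilon>. ennreal ((1 + \<epsilon>) ^ CARD('n) * a) < c) (at_right (0::real))"
    using lt a by (auto dest: order_tendstoD)
  moreover have "eventually (\<lambda>\<epsilon>. 0 < \<epsilon> \<and> \<epsilon> \<le> (1::real)) (at_right 0)"
    unfolding eventually_at_filter eventually_nhds_metric by (auto intro!: exI[of _ 1] simp: dist_real_def)
  ultimately have "eventually (\<lambda>\<epsilon>. ennreal ((1 + \<epsilon>) ^ CARD('n) * a) < c \<and> 0 < \<epsilon> \<and> \<epsilon> \<le> 1) (at_right (0::real))"
    by (rule eventually_conj)
  then obtain \<epsilon> :: real where \<epsilon>: "0 < \<epsilon>" "\<epsilon> \<le> 1" "ennreal ((1 + \<epsilon>) ^ CARD('n) * a) < c"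
    using eventually_happens[of _ "at_right (0::real)"] by (auto simp: trivial_limit_at_right_real)
  obtain u' g' where "admissible D K u' g'" "dirichlet g' \<le> ennreal ((1 + \<epsilon>) ^ CARD('n)) * ?A"
    using truncate_competitor[OF D K ad \<epsilon>(1,2)] by blast
  then show ?thesis using \<epsilon> a
    by (intro exI[of _ u'] exI[of _ g']) (auto simp: ennreal_mult[symmetric] intro: le_less_trans)
qed

lemma modulus_metric_less_competitor:
  fixes D :: "(real^'n) set"
  assumes D: "open D" and xy: "x \<noteq> y" and c: "modulus_metric D x y < c"
  shows "\<exists>\<gamma> u g. arc \<gamma> \<and> path_image \<gamma> \<subseteq> D \<and> pathstart \<gamma> = x \<and> pathfinish \<gamma> = y \<and>
     admissible D (path_image \<gamma>) u g \<and> dirichlet g < c"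
proof -
  obtain \<gamma> where \<gamma>: "arc \<gamma>" "path_image \<gamma> \<subseteq> D" "pathstart \<gamma> = x" "pathfinish \<gamma> = y" "capacity D (path_image \<gamma>) < c"
    using c xy by (auto simp: modulus_metric_def INF_less_iff)
  then show ?thesis
    using capacity_less_competitor[OF D _ \<gamma>(5)] compact_arc_image by blast
qed

lemma modulus_metric_le_dirichlet:
  fixes D :: "(real^'n) set"
  assumes "arc \<gamma>" "path_image \<gamma> \<subseteq> D" "pathstart \<gamma> = x" "pathfinish \<gamma> = y" "x \<noteq> y"
    "admissible D (path_image \<gamma>) u g"
  shows "modulus_metric D x y \<le> dirichlet g"
proof -
  have "modulus_metric D x y \<le> capacity D (path_image \<gamma>)"
    using assms by (auto simp: modulus_metric_def intro!: INF_lower)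
  then show ?thesis using capacity_le_dirichlet[OF assms(6)] by (rule order_trans)
qed

section \<open>Pulling back arcs and competitors\<close>

text \<open>The range is open by invariance of domain. It is closed, being the union of the compact image of \<open>C\<close>
  and of a closed set that \<open>\<Phi>\<close> fixes pointwise. So \<open>\<Phi>\<close> is onto.\<close>

lemma homeomorphism_of_compact_perturbation:
  fixes \<Phi> :: "'a::euclidean_space \<Rightarrow> 'a"
  assumes cont: "continuous_on UNIV \<Phi>" and inj: "inj \<Phi>"
    and C: "compact C" "C \<subseteq> D" and id: "\<And>x. x \<notin> C \<Longrightarrow> \<Phi> x = x"
  shows "\<exists>\<Psi>. continuous_on UNIV \<Psi> \<and> (\<forall>x. \<Psi> (\<Phi> x) = x) \<and> (\<forall>x. \<Phi> (\<Psi> x) = x) \<and> \<Psi> ` D \<subseteq> D"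
proof -
  have op: "open (range \<Phi>)" using invariance_of_domain[OF cont open_UNIV inj] .
  have on_closure: "\<Phi> x = x" if "x \<in> closure (- C)" for x
  proof -
    have "closed {x. \<Phi> x = x}"
      by (intro closed_Collect_eq cont continuous_on_id)
    then have "closure (- C) \<subseteq> {x. \<Phi> x = x}" by (intro closure_minimal) (use id in auto)
    then show ?thesis using that by auto
  qed
  have "range \<Phi> = \<Phi> ` C \<union> closure (- C)"
  proof
    show "range \<Phi> \<subseteq> \<Phi> ` C \<union> closure (- C)"
      using id closure_subset[of "- C"] by force
    show "\<Phi> ` C \<union> closure (- C) \<subseteq> range \<Phi>"
      using on_closure by (metis Un_least image_mono rangeI subsetI subset_UNIV)
  qed
  moreover have "compact (\<Phi> ` C)"
    using C(1) cont by (intro compact_continuous_image) (auto intro: continuous_on_subset)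
  ultimately have "closed (range \<Phi>)" by (simp only: closed_Un compact_imp_closed closed_closure)
  then have surj: "range \<Phi> = UNIV"
    using op clopen[of "range \<Phi>"] by auto
  obtain \<Psi> where "homeomorphism UNIV (range \<Phi>) \<Phi> \<Psi>"
    using invariance_of_domain_homeomorphism[OF open_UNIV cont _ inj] by auto
  then have \<Psi>: "continuous_on UNIV \<Psi>" "\<And>x. \<Psi> (\<Phi> x) = x" "\<And>x. \<Phi> (\<Psi> x) = x"
    unfolding surj by (auto simp: homeomorphism_def)
  have "\<Psi> y \<in> D" if "y \<in> D" for y
  proof (cases "\<Psi> y \<in> C")
    case False
    then have "\<Psi> y = y" using id[of "\<Psi> y"] \<Psi>(3) by simp
    then show ?thesis using that by simp
  qed (use C in auto)
  then show ?thesis using \<Psi> by (intro exI[of _ \<Psi>]) auto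
qed

lemma competitor_pullback:
  fixes \<Phi> :: "real^'n \<Rightarrow> real^'n"
  assumes u: "C1_compact_support_in D u g"
    and cont: "continuous_on UNIV c" "continuous_on UNIV p" "continuous_on UNIV q"
    and der: "\<And>x. (\<Phi> has_derivative (\<lambda>h. c x *\<^sub>R (h + (p x \<bullet> h) *\<^sub>R q x))) (at x)"
    and C: "compact C" "C \<subseteq> D" and id: "\<And>x. x \<notin> C \<Longrightarrow> \<Phi> x = x"
  shows "C1_compact_support_in D (u \<circ> \<Phi>) (\<lambda>x. c x *\<^sub>R (g (\<Phi> x) + (q x \<bullet> g (\<Phi> x)) *\<^sub>R p x))"
proof -
  have c\<Phi>: "continuous_on UNIV \<Phi>"
    using der by (meson continuous_at_imp_continuous_on has_derivative_continuous)
  let ?S = "closure (support_on UNIV u)"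
  have S: "compact ?S" "?S \<subseteq> D" using u by (auto simp: C1_compact_support_in_def)
  have "closed (\<Phi> -` ?S)" using c\<Phi> by (simp add: closed_vimage continuous_on_eq_continuous_at continuous_at_imp_continuous_on)
  then have "compact ((?S \<union> C) \<inter> \<Phi> -` ?S)" using S C by (intro compact_Int_closed compact_Un)
  moreover have "support_on UNIV (u \<circ> \<Phi>) \<subseteq> (?S \<union> C) \<inter> \<Phi> -` ?S"
  proof
    fix x assume "x \<in> support_on UNIV (u \<circ> \<Phi>)"
    then have "\<Phi> x \<in> ?S" using closure_subset[of "support_on UNIV u"] by (auto simp: support_on_def)
    then show "x \<in> (?S \<union> C) \<inter> \<Phi> -` ?S" using id[of x] by auto
  qed
  ultimately have sup: "compact (closure (support_on UNIV (u \<circ> \<Phi>))) \<and> closure (support_on UNIV (u \<circ> \<Phi>)) \<subseteq> D"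
    using S C by (intro closure_support_in_compact[where S="(?S \<union> C) \<inter> \<Phi> -` ?S"]) blast+
  have cg: "continuous_on UNIV g" using u by (simp add: C1_compact_support_in_def)
  have gd: "GDERIV (u \<circ> \<Phi>) x :> c x *\<^sub>R (g (\<Phi> x) + (q x \<bullet> g (\<Phi> x)) *\<^sub>R p x)" for x
  proof -
    have 1: "(u has_derivative (\<lambda>h. h \<bullet> g (\<Phi> x))) (at (\<Phi> x))"
      using u by (simp add: C1_compact_support_in_def gderiv_def)
    show ?thesis
      unfolding gderiv_def o_def
      by (rule has_derivative_eq_rhs[OF has_derivative_compose[OF der 1]])
         (auto simp: inner_add_left inner_add_right algebra_simps inner_commute)
  qed
  show ?thesis
    using sup gd unfolding C1_compact_support_in_def
    by (auto intro!: continuous_intros cont continuous_on_compose2[OF cg c\<Phi>])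
qed

text \<open>The conformal factor \<open>c\<close> enters the \<open>n\<close>-th power of the gradient and the Jacobian alike and cancels. The hypothesis on
  \<open>H\<close> therefore concerns the rank-one part of the derivative only.\<close>

lemma dirichlet_pullback_le:
  fixes \<Phi> :: "real^'n \<Rightarrow> real^'n"
  assumes g: "continuous_on UNIV g"
    and cont: "continuous_on UNIV c" "continuous_on UNIV p" "continuous_on UNIV q"
    and der: "\<And>x. (\<Phi> has_derivative (\<lambda>h. c x *\<^sub>R (h + (p x \<bullet> h) *\<^sub>R q x))) (at x)"
    and inj: "inj \<Phi>"
    and H: "integrable lborel H" "\<And>z. 0 \<le> H z"
    and le: "\<And>x. norm (g (\<Phi> x) + (q x \<bullet> g (\<Phi> x)) *\<^sub>R p x) ^ CARD('n) \<le> \<bar>1 + p x \<bullet> q x\<bar> * H (\<Phi> x)"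
  shows "dirichlet (\<lambda>x. c x *\<^sub>R (g (\<Phi> x) + (q x \<bullet> g (\<Phi> x)) *\<^sub>R p x)) \<le> ennreal (integral\<^sup>L lborel H)"
proof -
  have c\<Phi>: "continuous_on UNIV \<Phi>"
    using der by (meson continuous_at_imp_continuous_on has_derivative_continuous)
  have [measurable]: "H \<in> borel_measurable borel" "\<Phi> \<in> borel_measurable borel" "c \<in> borel_measurable borel"
    "p \<in> borel_measurable borel" "q \<in> borel_measurable borel"
    using H(1) c\<Phi> cont by (auto intro!: borel_measurable_continuous_onI)
  have "dirichlet (\<lambda>x. c x *\<^sub>R (g (\<Phi> x) + (q x \<bullet> g (\<Phi> x)) *\<^sub>R p x)) \<le>
     (\<integral>\<^sup>+x\<in>UNIV. ennreal (\<bar>c x\<bar> ^ CARD('n) * \<bar>1 + p x \<bullet> q x\<bar> * H (\<Phi> x)) \<partial>lborel)"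
  proof (rule nn_integral_mono)
    fix x
    have "norm (c x *\<^sub>R (g (\<Phi> x) + (q x \<bullet> g (\<Phi> x)) *\<^sub>R p x)) ^ CARD('n) =
       \<bar>c x\<bar> ^ CARD('n) * norm (g (\<Phi> x) + (q x \<bullet> g (\<Phi> x)) *\<^sub>R p x) ^ CARD('n)"
      by (simp add: power_mult_distrib)
    also have "\<dots> \<le> \<bar>c x\<bar> ^ CARD('n) * (\<bar>1 + p x \<bullet> q x\<bar> * H (\<Phi> x))"
      by (intro mult_left_mono le) auto
    finally show "ennreal (norm (c x *\<^sub>R (g (\<Phi> x) + (q x \<bullet> g (\<Phi> x)) *\<^sub>R p x)) ^ CARD('n)) \<le>
      ennreal (\<bar>c x\<bar> ^ CARD('n) * \<bar>1 + p x \<bullet> q x\<bar> * H (\<Phi> x)) * indicator UNIV x"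
      by (simp add: mult.assoc ennreal_leI)
  qed
  also have "\<dots> \<le> ennreal (integral\<^sup>L lborel H)"
    by (rule change_of_variables_le[OF open_UNIV inj der H]) measurable
  finally show ?thesis .
qed

text \<open>If \<open>u\<close> is a competitor for the arc \<open>\<gamma>\<close> from \<open>x0\<close> to \<open>\<Phi> z\<close>, then \<open>u \<circ> \<Phi>\<close> is one for the preimage of \<open>\<gamma>\<close>, which
  joins \<open>x0\<close> to \<open>z\<close>. The function \<open>H\<close> bounds the energy of \<open>u \<circ> \<Phi>\<close> in the coordinates of \<open>u\<close>.\<close>

lemma modulus_metric_pullback_le:
  fixes \<Phi> :: "real^'n \<Rightarrow> real^'n"
  assumes \<gamma>: "arc \<gamma>" "path_image \<gamma> \<subseteq> D" "pathstart \<gamma> = x0" "pathfinish \<gamma> = \<Phi> z"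
    and u: "admissible D (path_image \<gamma>) u g"
    and cont: "continuous_on UNIV c" "continuous_on UNIV p" "continuous_on UNIV q"
    and der: "\<And>x. (\<Phi> has_derivative (\<lambda>h. c x *\<^sub>R (h + (p x \<bullet> h) *\<^sub>R q x))) (at x)"
    and C: "compact C" "C \<subseteq> D" and id: "\<And>x. x \<notin> C \<Longrightarrow> \<Phi> x = x"
    and inj: "inj \<Phi>" and x0: "\<Phi> x0 = x0" "z \<noteq> x0"
    and H: "integrable lborel H" "\<And>z. 0 \<le> H z"
    and le: "\<And>x. norm (g (\<Phi> x) + (q x \<bullet> g (\<Phi> x)) *\<^sub>R p x) ^ CARD('n) \<le> \<bar>1 + p x \<bullet> q x\<bar> * H (\<Phi> x)"
  shows "modulus_metric D x0 z \<le> ennreal (integral\<^sup>L lborel H)"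
proof -
  have c\<Phi>: "continuous_on UNIV \<Phi>"
    using der by (meson continuous_at_imp_continuous_on has_derivative_continuous)
  obtain \<Psi> where \<Psi>: "continuous_on UNIV \<Psi>" "\<And>x. \<Psi> (\<Phi> x) = x" "\<And>x. \<Phi> (\<Psi> x) = x" "\<Psi> ` D \<subseteq> D"
    using homeomorphism_of_compact_perturbation[OF c\<Phi> inj C id] by blast
  have C1: "C1_compact_support_in D u g" and u1: "\<And>x. x \<in> path_image \<gamma> \<Longrightarrow> 1 \<le> u x"
    using u by (auto simp: admissible_def)
  let ?g = "\<lambda>x. c x *\<^sub>R (g (\<Phi> x) + (q x \<bullet> g (\<Phi> x)) *\<^sub>R p x)"
  have inj\<Psi>: "inj \<Psi>" by (metis \<Psi>(3) injI)
  have "arc (\<Psi> \<circ> \<gamma>)"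
    using \<gamma>(1) inj\<Psi> \<Psi>(1) unfolding arc_def
    by (auto intro!: path_continuous_image comp_inj_on intro: continuous_on_subset inj_on_subset)
  moreover have pim: "path_image (\<Psi> \<circ> \<gamma>) = \<Psi> ` path_image \<gamma>" by (simp add: path_image_compose)
  moreover have "\<Psi> ` path_image \<gamma> \<subseteq> D" using \<gamma>(2) \<Psi>(4) by blast
  moreover have "pathstart (\<Psi> \<circ> \<gamma>) = x0" "pathfinish (\<Psi> \<circ> \<gamma>) = z"
    using \<gamma>(3,4) \<Psi>(2) x0 by (metis pathstart_compose, metis pathfinish_compose)
  moreover have "admissible D (path_image (\<Psi> \<circ> \<gamma>)) (u \<circ> \<Phi>) ?g"
    unfolding admissible_def pim
    using competitor_pullback[OF C1 cont der C id] u1 \<Psi>(3) by auto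
  ultimately have "modulus_metric D x0 z \<le> dirichlet ?g"
    using modulus_metric_le_dirichlet[of "\<Psi> \<circ> \<gamma>" D x0 z "u \<circ> \<Phi>" ?g] x0(2) by simp
  also have "\<dots> \<le> ennreal (integral\<^sup>L lborel H)"
    using C1 by (intro dirichlet_pullback_le[OF _ cont der inj H le]) (simp add: C1_compact_support_in_def)
  finally show ?thesis .
qed

section \<open>Logarithmic cutoff functions\<close>

text \<open>In the variable \<open>s = ln (norm x)\<close>, a \<open>C\<^sup>1\<close> version of \<open>ln b - s\<close>, truncated above and below: it is \<open>ln b - ln a - 1\<close> up to
  \<open>s = ln a\<close>, decreases with slope \<open>1\<close> between \<open>ln a + 1\<close> and \<open>ln b - 1\<close>, and vanishes from \<open>s = ln b\<close> on.\<close>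

definition log_profile :: "real \<Rightarrow> real \<Rightarrow> real \<Rightarrow> real" where
  "log_profile a b s = ln b - ln a - 1 - ramp 1 (s - ln a) + ramp 1 (s - ln b + 1)"

text \<open>The derivative with the opposite sign, between \<open>0\<close> and \<open>1\<close>.\<close>

definition log_slope :: "real \<Rightarrow> real \<Rightarrow> real \<Rightarrow> real" where
  "log_slope a b s = ramp_slope 1 (s - ln a) - ramp_slope 1 (s - ln b + 1)"

text \<open>The maximum keeps the argument of \<open>ln\<close> away from \<open>0\<close>. It does not change the function, because the profile is constant
  up to \<open>ln a\<close>.\<close>

definition log_cutoff :: "real \<Rightarrow> real \<Rightarrow> 'a::euclidean_space \<Rightarrow> real" where
  "log_cutoff a b x = log_profile a b (ln (max a (norm x)))"

definition log_cutoff_slope :: "real \<Rightarrow> real \<Rightarrow> 'a::euclidean_space \<Rightarrow> real" where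
  "log_cutoff_slope a b x = log_slope a b (ln (max a (norm x)))"

definition log_cutoff_gradient :: "real \<Rightarrow> real \<Rightarrow> 'a::euclidean_space \<Rightarrow> 'a" where
  "log_cutoff_gradient a b x = - (log_cutoff_slope a b x / (max a (norm x))\<^sup>2) *\<^sub>R x"

lemma log_profile_deriv: "(log_profile a b has_real_derivative - log_slope a b s) (at s)"
  unfolding log_profile_def[abs_def] log_slope_def
  by (rule derivative_eq_intros has_derivative_ramp[THEN DERIV_chain2] refl | simp)+

lemma log_profile_values:
  "s \<le> ln a \<Longrightarrow> ln a \<le> ln b - 1 \<Longrightarrow> log_profile a b s = ln b - ln a - 1"
  "ln b \<le> s \<Longrightarrow> ln a \<le> ln b - 1 \<Longrightarrow> log_profile a b s = 0"
  by (auto simp: log_profile_def ramp_values)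

lemma ramp_slope_mono: "s \<le> t \<Longrightarrow> ramp_slope 1 s \<le> ramp_slope 1 t"
  by (auto simp: ramp_slope_def max_def)

lemma log_slope_bounds:
  assumes "ln a \<le> ln b - 1"
  shows "0 \<le> log_slope a b s" "log_slope a b s \<le> 1"
  using ramp_slope_mono[of "s - ln b + 1" "s - ln a"] assms
    ramp_slope_bounds[of 1 "s - ln a"] ramp_slope_bounds[of 1 "s - ln b + 1"]
  by (auto simp: log_slope_def)

lemma log_slope_values:
  "s \<le> ln a \<Longrightarrow> ln a \<le> ln b - 1 \<Longrightarrow> log_slope a b s = 0"
  "ln b \<le> s \<Longrightarrow> ln a \<le> ln b - 1 \<Longrightarrow> log_slope a b s = 0"
  "ln a + 1 \<le> s \<Longrightarrow> s \<le> ln b - 1 \<Longrightarrow> log_slope a b s = 1"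
  by (auto simp: log_slope_def ramp_values)

lemma log_profile_lipschitz:
  assumes "ln a \<le> ln b - 1"
  shows "\<bar>log_profile a b s - log_profile a b t\<bar> \<le> \<bar>s - t\<bar>"
proof -
  have "norm (log_profile a b s - log_profile a b t) \<le> 1 * norm (s - t)"
  proof (rule field_differentiable_bound[where S=UNIV and f'="\<lambda>s. - log_slope a b s"])
    show "(log_profile a b has_field_derivative - log_slope a b z) (at z within UNIV)" for z
      using log_profile_deriv by simp
    show "norm (- log_slope a b z) \<le> 1" for z using log_slope_bounds[OF assms, of z] by simp
  qed auto
  then show ?thesis by simp
qed

text \<open>Under this condition the two rounded corners of the profile do not overlap.\<close>

locale log_cutoff_radii =
  fixes a b :: real
  assumes a_pos: "0 < a" and ab: "exp 2 * a \<le> b"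
begin

lemma b_pos: "0 < b" using a_pos ab by (meson exp_gt_zero less_le_trans mult_pos_pos)

lemma ln_ab: "ln a \<le> ln b - 2"
proof -
  have "ln (exp 2 * a) \<le> ln b" using ab a_pos b_pos by (subst ln_le_cancel_iff) auto
  then show ?thesis using a_pos by (simp add: ln_mult)
qed

lemma ln_ab1: "ln a \<le> ln b - 1" using ln_ab by simp

lemma log_cutoff_inner: "norm x \<le> a \<Longrightarrow> log_cutoff a b x = ln (b / a) - 1"
  using a_pos b_pos ln_ab1 by (simp add: log_cutoff_def log_profile_values ln_div)

lemma log_cutoff_outer: "b \<le> norm x \<Longrightarrow> log_cutoff a b x = 0"
proof -
  assume "b \<le> norm x"
  moreover have "ln b \<le> ln (max a (norm x))" using calculation b_pos by simp
  ultimately show ?thesis by (simp add: log_cutoff_def log_profile_values ln_ab1)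
qed

lemma log_cutoff_eq_profile: "x \<noteq> 0 \<Longrightarrow> log_cutoff a b x = log_profile a b (ln (norm x))"
  using a_pos ln_ab1 by (cases "norm x \<le> a") (auto simp: log_cutoff_def log_profile_values max_def)

lemma log_cutoff_slope_bounds: "0 \<le> log_cutoff_slope a b x" "log_cutoff_slope a b x \<le> 1"
  by (auto simp: log_cutoff_slope_def log_slope_bounds ln_ab1)

lemma log_cutoff_slope_inner: "norm x \<le> a \<Longrightarrow> log_cutoff_slope a b x = 0"
  using a_pos ln_ab1 by (simp add: log_cutoff_slope_def log_slope_values)

lemma log_cutoff_slope_outer: "b \<le> norm x \<Longrightarrow> log_cutoff_slope a b x = 0"
proof -
  assume "b \<le> norm x"
  moreover have "ln b \<le> ln (max a (norm x))" using calculation b_pos by simp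
  ultimately show ?thesis by (simp add: log_cutoff_slope_def log_slope_values ln_ab1)
qed

lemma log_cutoff_slope_middle:
  assumes "exp 1 * a \<le> norm x" "norm x \<le> b / exp 1"
  shows "log_cutoff_slope a b x = 1"
proof -
  have x: "0 < norm x" using assms(1) a_pos by (meson exp_gt_zero less_le_trans mult_pos_pos)
  have "ln (exp 1 * a) \<le> ln (norm x)" "ln (norm x) \<le> ln (b / exp 1)"
    using assms x a_pos b_pos by (subst ln_le_cancel_iff; simp)+
  then have l: "ln a + 1 \<le> ln (norm x)" "ln (norm x) \<le> ln b - 1"
    using a_pos b_pos by (simp_all add: ln_mult ln_div)
  moreover have "a \<le> norm x"
  proof -
    have "ln a \<le> ln (norm x)" using l by simp
    then show ?thesis using a_pos x by simp
  qed
  ultimately show ?thesis by (simp add: log_cutoff_slope_def log_slope_values max_def)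
qed

lemma continuous_log_cutoff_slope: "continuous_on A (log_cutoff_slope a b)"
  unfolding log_cutoff_slope_def[abs_def] log_slope_def
  using a_pos by (intro continuous_intros continuous_on_compose2[OF continuous_ramp_slope[of 1 UNIV]]) auto

lemma log_cutoff_C1: "C1_gradient (log_cutoff a b) (log_cutoff_gradient a b)"
proof -
  have "continuous_on UNIV (log_cutoff_gradient a b :: 'a \<Rightarrow> 'a)"
    unfolding log_cutoff_gradient_def[abs_def]
    using a_pos by (intro continuous_intros continuous_log_cutoff_slope) auto
  moreover have "GDERIV (log_cutoff a b) x :> log_cutoff_gradient a b x" for x :: 'a
  proof (cases "norm x < a")
    case True
    have "((\<lambda>_::'a. ln (b / a) - 1) has_derivative (\<lambda>h. 0)) (at x)" by simp
    then have "(log_cutoff a b has_derivative (\<lambda>h. 0)) (at x)"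
      by (rule has_derivative_transform_within_open[of _ _ _ _ "ball 0 a"]) (use True in \<open>auto simp: log_cutoff_inner\<close>)
    then show ?thesis using True
      by (simp add: gderiv_def log_cutoff_gradient_def log_cutoff_slope_inner)
  next
    case False
    then have x: "x \<noteq> 0" "norm x > 0" "a \<le> norm x" using a_pos by auto
    have "((\<lambda>r. log_profile a b (ln r)) has_real_derivative - log_slope a b (ln (norm x)) * (1 / norm x)) (at (norm x))"
      by (rule DERIV_chain2[OF log_profile_deriv]) (use x in \<open>auto intro!: derivative_eq_intros\<close>)
    then have "GDERIV (\<lambda>x. log_profile a b (ln (norm x))) x :> (- log_slope a b (ln (norm x)) * (1 / norm x)) *\<^sub>R sgn x"
      by (rule GDERIV_DERIV_compose[OF GDERIV_norm[OF x(1)]])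
    moreover have "(- log_slope a b (ln (norm x)) * (1 / norm x)) *\<^sub>R sgn x = log_cutoff_gradient a b x"
      using x by (simp add: log_cutoff_gradient_def log_cutoff_slope_def max_def sgn_div_norm power2_eq_square field_simps)
    ultimately have "GDERIV (\<lambda>x. log_profile a b (ln (norm x))) x :> log_cutoff_gradient a b x"
      by (simp only:)
    then have "((\<lambda>x. log_profile a b (ln (norm x))) has_derivative (\<lambda>h. h \<bullet> log_cutoff_gradient a b x)) (at x)"
      by (simp only: gderiv_def)
    then have "(log_cutoff a b has_derivative (\<lambda>h. h \<bullet> log_cutoff_gradient a b x)) (at x)"
      by (rule has_derivative_transform_within_open[of _ _ _ _ "- {0}"]) (use x in \<open>auto simp: log_cutoff_eq_profile\<close>)
    then show ?thesis by (simp add: gderiv_def)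
  qed
  ultimately show ?thesis by (simp add: C1_gradient_def)
qed

lemma norm_log_cutoff_gradient_le:
  "norm (log_cutoff_gradient a b x) \<le> 1 / a"
  "x \<noteq> 0 \<Longrightarrow> norm (log_cutoff_gradient a b x) \<le> 1 / norm x"
  "norm x < a \<or> b \<le> norm x \<Longrightarrow> log_cutoff_gradient a b x = 0"
proof -
  let ?m = "max a (norm x)"
  have m: "0 < ?m" using a_pos by simp
  have "norm (log_cutoff_gradient a b x) = log_cutoff_slope a b x * (norm x / ?m\<^sup>2)"
    using log_cutoff_slope_bounds[of x] by (simp add: log_cutoff_gradient_def)
  also have "\<dots> \<le> 1 * (norm x / ?m\<^sup>2)" by (intro mult_right_mono log_cutoff_slope_bounds) simp
  also have "\<dots> \<le> ?m / ?m\<^sup>2" by (simp add: divide_right_mono)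
  also have "\<dots> = 1 / ?m" using m by (simp add: power2_eq_square)
  finally have *: "norm (log_cutoff_gradient a b x) \<le> 1 / ?m" .
  moreover have "1 / ?m \<le> 1 / a" using a_pos by (intro divide_left_mono) auto
  ultimately show "norm (log_cutoff_gradient a b x) \<le> 1 / a" by simp
  show "norm (log_cutoff_gradient a b x) \<le> 1 / norm x" if "x \<noteq> 0"
  proof -
    have "1 / ?m \<le> 1 / norm x" using that m by (intro divide_left_mono) auto
    then show ?thesis using * by simp
  qed
  show "log_cutoff_gradient a b x = 0" if "norm x < a \<or> b \<le> norm x"
    using that log_cutoff_slope_inner[of x] log_cutoff_slope_outer[of x] by (auto simp: log_cutoff_gradient_def)
qed

lemma log_cutoff_lipschitz:
  fixes x y :: "'a::euclidean_space"
  shows "\<bar>log_cutoff a b x - log_cutoff a b y\<bar> \<le> 1 / a * norm (x - y)"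
proof -
  have "norm (log_cutoff a b x - log_cutoff a b y) \<le> 1 / a * norm (x - y)"
  proof (rule differentiable_bound[where S=UNIV and f'="\<lambda>x h. h \<bullet> log_cutoff_gradient a b x"])
    show "(log_cutoff a b has_derivative (\<lambda>h. h \<bullet> log_cutoff_gradient a b z)) (at z within UNIV)" for z :: 'a
      using log_cutoff_C1[where 'a='a] by (simp add: C1_gradient_def gderiv_def)
    show "onorm (\<lambda>h. h \<bullet> log_cutoff_gradient a b z) \<le> 1 / a" for z :: 'a
    proof (rule onorm_bound)
      show "norm (h \<bullet> log_cutoff_gradient a b z) \<le> 1 / a * norm h" for h
        using Cauchy_Schwarz_ineq2[of h "log_cutoff_gradient a b z"] norm_log_cutoff_gradient_le(1)[of z]
        by (simp, metis (no_types, opaque_lifting) divide_inverse mult.commute mult_left_mono norm_ge_zero order_trans mult_1)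
    qed (use a_pos in simp)
  qed auto
  then show ?thesis by simp
qed

end

section \<open>The modulus metric is locally Lipschitz\<close>

text \<open>Passage from near-minimisers to the infimum \<open>m\<close>. The ceiling \<open>\<theta>0\<close> allows an a priori bound on the energy
  of the near-minimisers.\<close>

lemma le_mult_of_le_mult_greater:
  fixes m m' :: ennreal
  assumes k: "0 < k" and le: "\<And>\<theta>. m < \<theta> \<Longrightarrow> \<theta> < \<theta>0 \<Longrightarrow> m' \<le> ennreal k * \<theta>" and m: "m < \<theta>0"
  shows "m' \<le> ennreal k * m"
proof -
  have "m' / ennreal k \<le> m"
  proof (rule dense_ge_bounded[OF m])
    fix \<theta> assume "m < \<theta>" "\<theta> < \<theta>0"
    then show "m' / ennreal k \<le> \<theta>" using k le by (intro divide_le_posI_ennreal) auto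
  qed
  then have "m' / ennreal k * ennreal k \<le> m * ennreal k" by (rule mult_right_mono) simp
  moreover have "m' / ennreal k * ennreal k = m'"
    using k by (simp add: ennreal_divide_times mult_divide_eq_ennreal)
  ultimately show ?thesis by (simp add: mult.commute)
qed

lemma one_plus_power_le:
  fixes t :: real
  assumes "0 \<le> t" "t \<le> 1"
  shows "(1 + t) ^ n \<le> 1 + (2 ^ n - 1) * t"
proof (induction n)
  case (Suc n)
  have "(1 + t) ^ Suc n \<le> (1 + (2 ^ n - 1) * t) * (1 + t)"
    using Suc assms by (simp add: mult_right_mono mult.commute)
  also have "\<dots> = 1 + 2 ^ n * t + (2 ^ n - 1) * (t * t)" by (simp add: algebra_simps)
  also have "\<dots> \<le> 1 + 2 ^ n * t + (2 ^ n - 1) * t"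
    using assms by (intro add_left_mono mult_left_mono mult_left_le) auto
  also have "\<dots> = 1 + (2 ^ Suc n - 1) * t" by (simp add: algebra_simps)
  finally show ?case .
qed simp

text \<open>The left-hand side bounds the factor by which the energy grows under the substitution \<open>x + \<eta> x *\<^sub>R w\<close> when
  \<open>t\<close> is the Lipschitz constant of \<open>\<eta>\<close> times \<open>norm w\<close>.\<close>

lemma distortion_factor_le:
  fixes t :: real
  assumes "0 \<le> t" "t \<le> 1/2"
  shows "(1 + t) ^ n / (1 - t) \<le> 1 + 4 * 2 ^ n * t"
proof -
  have "(1 + t) ^ n / (1 - t) \<le> (1 + (2 ^ n - 1) * t) * (1 + 2 * t)"
  proof -
    have "1 \<le> (1 + 2 * t) * (1 - t)"
    proof -
      have "0 \<le> t * (1 - 2 * t)" using assms by simp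
      then show ?thesis by (simp add: algebra_simps)
    qed
    then have "1 / (1 - t) \<le> 1 + 2 * t" using assms by (simp add: pos_divide_le_eq)
    then have "(1 + t) ^ n * (1 / (1 - t)) \<le> (1 + (2 ^ n - 1) * t) * (1 + 2 * t)"
      using assms by (intro mult_mono one_plus_power_le) auto
    then show ?thesis by simp
  qed
  also have "\<dots> = 1 + (2 ^ n + 1) * t + 2 * (2 ^ n - 1) * (t * t)" by (simp add: algebra_simps)
  also have "\<dots> \<le> 1 + (2 ^ n + 1) * t + 2 * (2 ^ n - 1) * t"
    using assms by (intro add_left_mono mult_left_mono mult_left_le) auto
  also have "\<dots> = 1 + (3 * 2 ^ n - 1) * t" by (simp add: algebra_simps)
  also have "\<dots> \<le> 1 + 4 * 2 ^ n * t"
  proof (intro add_left_mono mult_right_mono)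
    show "3 * 2 ^ n - 1 \<le> 4 * (2::real) ^ n" using zero_le_power[of "2::real" n] by linarith
  qed (use assms in auto)
  finally show ?thesis .
qed

text \<open>The map \<open>\<Phi> x = x + \<eta> x *\<^sub>R (z - z')\<close>, with a bump function \<open>\<eta>\<close> that is \<open>1\<close> near \<open>y\<close> and \<open>0\<close> away from it,
  moves \<open>z'\<close> to \<open>z\<close>, fixes \<open>x0\<close> and distorts energies by a factor \<open>1 + O(dist z z')\<close>.\<close>

lemma modulus_metric_locally_lipschitz:
  fixes D :: "(real^'n) set"
  assumes D: "open D" and y: "y \<in> D" "y \<noteq> x0"
  shows "\<exists>C\<ge>0. \<exists>\<rho>>0. ball y \<rho> \<subseteq> D \<and> x0 \<notin> ball y \<rho> \<and>
     (\<forall>z\<in>ball y \<rho>. \<forall>z'\<in>ball y \<rho>. modulus_metric D x0 z' \<le> ennreal (1 + C * dist z z') * modulus_metric D x0 z)"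
proof -
  have "open (D - {x0})" using D by auto
  then obtain b where b: "b > 0" "cball y b \<subseteq> D - {x0}"
    using y by (meson Diff_iff insertE empty_iff open_contains_cball)
  \<comment> \<open>This ratio makes the cutoff equal to \<open>ln (b / a) - 1 = 1\<close> on the ball of radius \<open>a\<close>.\<close>
  define a where "a = b / exp 2"
  have a: "0 < a" "a < b" using b by (auto simp: a_def field_simps)
  interpret log_cutoff_radii a b
    using a by unfold_locales (simp_all add: a_def)
  have M1: "ln (b / a) - 1 = 1" using a b by (simp add: a_def)
  define \<eta> where "\<eta> x = log_cutoff a b (x - y)" for x
  define G where "G x = log_cutoff_gradient a b (x - y)" for x
  \<comment> \<open>Points of the ball of radius \<open>\<rho>\<close> are less than \<open>a / 2\<close> apart. As \<open>\<eta>\<close> has Lipschitz constant \<open>1 / a\<close>, the displacement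
    \<open>\<eta> x *\<^sub>R w\<close> below is a contraction.\<close>
  define \<rho> where "\<rho> = a / 4"
  have \<rho>: "0 < \<rho>" using a by (simp add: \<rho>_def)
  define C where "C = 4 * 2 ^ CARD('n) / a"
  have C: "0 \<le> C" using a by (simp add: C_def)
  have G1: "(\<eta> has_derivative (\<lambda>h. G x \<bullet> h)) (at x)" for x
  proof -
    have 1: "(log_cutoff a b has_derivative (\<lambda>h. h \<bullet> log_cutoff_gradient a b (x - y))) (at (x - y))"
      using log_cutoff_C1[where 'a="real^'n"] by (simp add: C1_gradient_def gderiv_def)
    have 2: "((\<lambda>x. x - y) has_derivative (\<lambda>h. h)) (at x)" by (auto intro!: derivative_eq_intros)
    have eq: "\<eta> = (\<lambda>x. log_cutoff a b (x - y))" by (simp add: fun_eq_iff \<eta>_def)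
    show ?thesis unfolding eq
      by (rule has_derivative_eq_rhs[OF has_derivative_compose[OF 2 1]]) (simp add: G_def inner_commute fun_eq_iff)
  qed
  have cG: "continuous_on UNIV G"
  proof -
    have "continuous_on UNIV (log_cutoff_gradient a b :: real^'n \<Rightarrow> real^'n)"
      using log_cutoff_C1[where 'a="real^'n"] by (simp add: C1_gradient_def)
    then show ?thesis unfolding G_def
      by (rule continuous_on_compose2) (auto intro!: continuous_intros)
  qed
  have step: "modulus_metric D x0 z' \<le> ennreal (1 + C * dist z z') * modulus_metric D x0 z"
    if z: "z \<in> ball y \<rho>" "z' \<in> ball y \<rho>" for z z'
  proof -
    define w where "w = z - z'"
    define t where "t = norm w / a"
    have nw: "norm w < 2 * \<rho>"
      using z dist_triangle_half_r[of y z "2 * \<rho>" z'] by (simp add: w_def dist_norm)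
    have t: "0 \<le> t" "t \<le> 1/2" using nw a by (auto simp: t_def \<rho>_def field_simps)
    define \<Phi> where "\<Phi> x = x + \<eta> x *\<^sub>R w" for x
    have der: "(\<Phi> has_derivative (\<lambda>h. 1 *\<^sub>R (h + (G x \<bullet> h) *\<^sub>R w))) (at x)" for x
      unfolding \<Phi>_def[abs_def] by (auto intro!: derivative_eq_intros G1)
    have inj: "inj \<Phi>"
    proof (rule injI)
      fix x x' assume eq: "\<Phi> x = \<Phi> x'"
      then have "x - x' = (\<eta> x' - \<eta> x) *\<^sub>R w" by (simp add: \<Phi>_def algebra_simps)
      then have "norm (x - x') = \<bar>\<eta> x' - \<eta> x\<bar> * norm w" by simp
      also have "\<dots> \<le> (1 / a * norm (x' - x)) * norm w"
        using log_cutoff_lipschitz[of "x' - y" "x - y"] by (intro mult_right_mono) (auto simp: \<eta>_def)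
      also have "\<dots> = t * norm (x - x')" by (simp add: t_def norm_minus_commute)
      also have "\<dots> \<le> 1/2 * norm (x - x')" using t by (intro mult_right_mono) auto
      finally show "x = x'" by simp
    qed
    have id: "\<Phi> x = x" if "x \<notin> cball y b" for x
      using that log_cutoff_outer[of "x - y"] by (simp add: \<Phi>_def \<eta>_def dist_norm norm_minus_commute)
    have x0: "\<Phi> x0 = x0" using b by (intro id) auto
    have zx: "z \<noteq> x0" "z' \<noteq> x0"
      using z b a by (auto simp: \<rho>_def subset_iff dist_norm)
    have \<Phi>z: "\<Phi> z' = z"
      using z log_cutoff_inner[of "z' - y"] M1 a
      by (simp add: \<Phi>_def \<eta>_def w_def \<rho>_def dist_norm norm_minus_commute)
    have D': "cball y b \<subseteq> D" using b by blast
    let ?k = "(1 + t) ^ CARD('n) / (1 - t)"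
    have k: "0 < ?k" using t by (intro divide_pos_pos zero_less_power) auto
    show ?thesis
    proof (cases "modulus_metric D x0 z < \<infinity>")
      case False
      then have "modulus_metric D x0 z = \<infinity>" by (simp add: less_top[symmetric])
      moreover have "0 < 1 + C * dist z z'" using C by (simp add: add_pos_nonneg)
      ultimately show ?thesis by (simp add: ennreal_mult_top)
    next
      case True
      have "modulus_metric D x0 z' \<le> ennreal ?k * modulus_metric D x0 z"
      proof (rule le_mult_of_le_mult_greater[OF k _ True])
        fix \<theta> assume \<theta>: "modulus_metric D x0 z < \<theta>"
        obtain \<gamma> u g where \<gamma>: "arc \<gamma>" "path_image \<gamma> \<subseteq> D" "pathstart \<gamma> = x0" "pathfinish \<gamma> = z"
          and u: "admissible D (path_image \<gamma>) u g" and E: "dirichlet g < \<theta>"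
          using modulus_metric_less_competitor[OF D _ \<theta>] zx by metis
        have C1: "C1_compact_support_in D u g" using u by (simp add: admissible_def)
        let ?H = "\<lambda>z. ?k * norm (g z) ^ CARD('n)"
        have "modulus_metric D x0 z' \<le> ennreal (integral\<^sup>L lborel ?H)"
        proof (rule modulus_metric_pullback_le[where \<Phi>=\<Phi> and c="\<lambda>_. 1" and p=G and q="\<lambda>_. w" and C="cball y b", OF \<gamma>(1,2,3) _ u])
          show "norm (g (\<Phi> x) + (w \<bullet> g (\<Phi> x)) *\<^sub>R G x) ^ CARD('n) \<le> \<bar>1 + G x \<bullet> w\<bar> * ?H (\<Phi> x)" for x
          proof -
            let ?v = "g (\<Phi> x)"
            have Gx: "norm (G x) \<le> 1 / a" using norm_log_cutoff_gradient_le(1) by (simp add: G_def)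
            have "\<bar>G x \<bullet> w\<bar> \<le> norm (G x) * norm w" by (rule Cauchy_Schwarz_ineq2)
            also have "\<dots> \<le> t" using mult_right_mono[OF Gx, of "norm w"] by (simp add: t_def)
            finally have Gw: "1 - t \<le> \<bar>1 + G x \<bullet> w\<bar>" by linarith
            have "norm (?v + (w \<bullet> ?v) *\<^sub>R G x) \<le> norm ?v + \<bar>w \<bullet> ?v\<bar> * norm (G x)"
              using norm_triangle_ineq[of ?v "(w \<bullet> ?v) *\<^sub>R G x"] by simp
            also have "\<dots> \<le> norm ?v + (norm w * norm ?v) * (1 / a)"
              by (intro add_left_mono mult_mono Cauchy_Schwarz_ineq2 Gx) auto
            also have "\<dots> = (1 + t) * norm ?v" by (simp add: t_def algebra_simps)
            finally have "norm (?v + (w \<bullet> ?v) *\<^sub>R G x) ^ CARD('n) \<le> ((1 + t) * norm ?v) ^ CARD('n)"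
              by (intro power_mono) auto
            also have "\<dots> = (1 - t) * ?H (\<Phi> x)" using t by (simp add: power_mult_distrib)
            also have "\<dots> \<le> \<bar>1 + G x \<bullet> w\<bar> * ?H (\<Phi> x)"
              using Gw t by (intro mult_right_mono) (auto intro!: divide_nonneg_nonneg mult_nonneg_nonneg)
            finally show ?thesis .
          qed
          show "0 \<le> ?H x" for x
            using t by (intro mult_nonneg_nonneg divide_nonneg_nonneg) auto
          show "integrable lborel ?H" using integrable_gradient_power[OF C1] by simp
        qed (use \<gamma> der id inj x0 zx \<Phi>z D' k cG in \<open>auto intro!: continuous_intros\<close>)
        also have "\<dots> = ennreal ?k * dirichlet g"
          unfolding dirichlet_eq_integral[OF C1] integral_mult_right_zero
          using k by (intro ennreal_mult) (auto simp: integral_nonneg)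
        also have "\<dots> \<le> ennreal ?k * \<theta>" using E by (intro mult_left_mono) auto
        finally show "modulus_metric D x0 z' \<le> ennreal ?k * \<theta>" .
      qed
      also have "\<dots> \<le> ennreal (1 + C * dist z z') * modulus_metric D x0 z"
        using distortion_factor_le[OF t, of "CARD('n)"]
        by (intro mult_right_mono ennreal_leI) (auto simp: C_def t_def w_def dist_norm)
      finally show ?thesis .
    qed
  qed
  have "\<rho> < b" using a by (simp add: \<rho>_def)
  then have sub: "ball y \<rho> \<subseteq> cball y b" by auto
  show ?thesis
    using C \<rho> step sub b by (intro exI[of _ C] conjI exI[of _ \<rho>]) auto
qed

section \<open>Radial compression\<close>

lemma twice_minus_square_nonneg:
  fixes \<delta> :: real
  assumes "0 \<le> \<delta>" "\<delta> \<le> 1"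
  shows "0 \<le> 2 * \<delta> - \<delta>\<^sup>2"
proof -
  have "0 \<le> \<delta> * (2 - \<delta>)" using assms by (intro mult_nonneg_nonneg) auto
  then show ?thesis by (simp add: algebra_simps power2_eq_square)
qed

text \<open>By Pythagoras, the square of the norm drops by \<open>2 * \<delta> - \<delta>\<^sup>2\<close> times the square of the component along \<open>e\<close>. The factor
  \<open>norm v ^ (n - 2)\<close> that remains is at least \<open>\<bar>e \<bullet> v\<bar> ^ (n - 2)\<close>; this uses \<open>n \<ge> 2\<close>.\<close>

lemma norm_shrink_component_power:
  fixes v e :: "'a::real_inner"
  assumes e: "norm e = 1" and \<delta>: "0 \<le> \<delta>" "\<delta> \<le> 1" and n: "2 \<le> n"
  shows "norm (v - (\<delta> * (e \<bullet> v)) *\<^sub>R e) ^ n \<le> norm v ^ n - (2 * \<delta> - \<delta>\<^sup>2) * \<bar>e \<bullet> v\<bar> ^ n"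
proof -
  let ?r = "e \<bullet> v" and ?w = "v - (\<delta> * (e \<bullet> v)) *\<^sub>R e" and ?k = "2 * \<delta> - \<delta>\<^sup>2"
  have ee: "e \<bullet> e = 1" using e by (simp add: norm_eq_1)
  have k: "0 \<le> ?k"
    using \<delta> by (rule twice_minus_square_nonneg)
  have sq: "(norm ?w)\<^sup>2 = (norm v)\<^sup>2 - ?k * ?r\<^sup>2"
    unfolding power2_norm_eq_inner
    by (simp add: inner_diff_left inner_diff_right ee inner_commute[of v e] power2_eq_square algebra_simps)
  have rv: "\<bar>?r\<bar> \<le> norm v" using Cauchy_Schwarz_ineq2[of e v] e by simp
  have wv: "norm ?w \<le> norm v"
    using sq k by (intro power2_le_imp_le[of "norm ?w" "norm v"]) (auto simp: mult_nonneg_nonneg)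
  obtain m where m: "n = m + 2" using n by (metis add.commute le_Suc_ex)
  have "norm ?w ^ n = norm ?w ^ m * (norm ?w)\<^sup>2" by (simp only: m power_add)
  also have "\<dots> \<le> norm v ^ m * (norm ?w)\<^sup>2"
    by (intro mult_right_mono power_mono wv) auto
  also have "\<dots> = norm v ^ n - ?k * (norm v ^ m * \<bar>?r\<bar>\<^sup>2)"
    unfolding sq m power_add by (simp only: power2_abs right_diff_distrib mult_ac)
  also have "\<dots> \<le> norm v ^ n - ?k * (\<bar>?r\<bar> ^ m * \<bar>?r\<bar>\<^sup>2)"
    using rv k by (intro diff_left_mono mult_left_mono mult_right_mono power_mono) auto
  also have "\<bar>?r\<bar> ^ m * \<bar>?r\<bar>\<^sup>2 = \<bar>?r\<bar> ^ n" by (simp only: m power_add)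
  finally show ?thesis .
qed

abbreviation radial_density :: "real^'n \<Rightarrow> real \<Rightarrow> real \<Rightarrow> (real^'n \<Rightarrow> real^'n) \<Rightarrow> real^'n \<Rightarrow> real" where
  "radial_density p a b g z \<equiv>
     indicator {z. a \<le> norm (z - p) \<and> norm (z - p) < b} z * \<bar>sgn (z - p) \<bullet> g z\<bar> ^ CARD('n)"

lemma radial_density_le:
  fixes g :: "real^'n \<Rightarrow> real^'n"
  shows "radial_density p a b g z \<le> norm (g z) ^ CARD('n)"
proof -
  have "\<bar>sgn (z - p) \<bullet> g z\<bar> \<le> norm (sgn (z - p)) * norm (g z)" by (rule Cauchy_Schwarz_ineq2)
  also have "\<dots> \<le> 1 * norm (g z)" by (intro mult_right_mono) (auto simp: norm_sgn)
  finally have "\<bar>sgn (z - p) \<bullet> g z\<bar> ^ CARD('n) \<le> norm (g z) ^ CARD('n)" by (intro power_mono) auto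
  then show ?thesis by (simp add: indicator_def)
qed

lemma integrable_radial_density:
  fixes g :: "real^'n \<Rightarrow> real^'n"
  assumes u: "C1_compact_support_in D u g"
  shows "integrable lborel (radial_density p a b g)"
proof (rule Bochner_Integration.integrable_bound[OF integrable_gradient_power[OF u]])
  have "continuous_on UNIV g" using u by (simp add: C1_compact_support_in_def)
  then have [measurable]: "g \<in> borel_measurable borel" by (rule borel_measurable_continuous_onI)
  show "radial_density p a b g \<in> borel_measurable lborel" by measurable
  show "AE z in lborel. norm (radial_density p a b g z) \<le> norm (norm (g z) ^ CARD('n))"
    using radial_density_le[where p=p and a=a and b=b and g=g] by (intro AE_I2) simp
qed

context log_cutoff_radii
begin

lemma log_cutoff_nonneg_le:
  "0 \<le> log_cutoff a b x" "log_cutoff a b x \<le> ln (b / a) - 1"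
proof -
  let ?s = "ln (max a (norm x))"
  have mono: "log_profile a b t \<le> log_profile a b s" if "s \<le> t" for s t
    by (rule DERIV_nonpos_imp_nonincreasing[OF that])
       (use log_profile_deriv log_slope_bounds[OF ln_ab1] in \<open>auto intro!: exI[of _ "- log_slope a b _"]\<close>)
  have "log_profile a b (max ?s (ln b)) \<le> log_profile a b ?s" by (rule mono) simp
  then show "0 \<le> log_cutoff a b x" by (simp add: log_cutoff_def log_profile_values ln_ab1)
  have "ln a \<le> ?s" using a_pos by simp
  then have "log_profile a b ?s \<le> log_profile a b (ln a)" by (rule mono)
  then show "log_cutoff a b x \<le> ln (b / a) - 1"
    using a_pos b_pos by (simp add: log_cutoff_def log_profile_values ln_ab1 ln_div)
qed

text \<open>The map preserves rays, and in the variable \<open>s = ln (norm (x - x0))\<close> it is \<open>s + \<epsilon> * log_profile a b s\<close>, where the profile has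
  Lipschitz constant \<open>1\<close>.\<close>

lemma inj_radial_stretch:
  fixes x0 :: "'a::euclidean_space"
  assumes \<epsilon>: "0 \<le> \<epsilon>" "\<epsilon> < 1"
  shows "inj (\<lambda>x. x0 + exp (\<epsilon> * log_cutoff a b (x - x0)) *\<^sub>R (x - x0))"
proof (rule injI)
  fix x x' :: 'a
  let ?q = "x - x0" and ?q' = "x' - x0"
  assume "x0 + exp (\<epsilon> * log_cutoff a b ?q) *\<^sub>R ?q = x0 + exp (\<epsilon> * log_cutoff a b ?q') *\<^sub>R ?q'"
  then have eq: "exp (\<epsilon> * log_cutoff a b ?q) *\<^sub>R ?q = exp (\<epsilon> * log_cutoff a b ?q') *\<^sub>R ?q'" by simp
  show "x = x'"
  proof (cases "?q = 0 \<or> ?q' = 0")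
    case True
    then show ?thesis using eq by auto
  next
    case False
    have "norm (exp (\<epsilon> * log_cutoff a b ?q) *\<^sub>R ?q) = norm (exp (\<epsilon> * log_cutoff a b ?q') *\<^sub>R ?q')" using eq by simp
    then have "exp (\<epsilon> * log_cutoff a b ?q) * norm ?q = exp (\<epsilon> * log_cutoff a b ?q') * norm ?q'" by simp
    then have "ln (exp (\<epsilon> * log_cutoff a b ?q) * norm ?q) = ln (exp (\<epsilon> * log_cutoff a b ?q') * norm ?q')" by simp
    then have l: "ln (norm ?q) - ln (norm ?q') = \<epsilon> * (log_cutoff a b ?q' - log_cutoff a b ?q)"
      using False by (simp add: ln_mult algebra_simps)
    have lip: "\<bar>log_cutoff a b ?q' - log_cutoff a b ?q\<bar> \<le> \<bar>ln (norm ?q') - ln (norm ?q)\<bar>"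
      using False log_profile_lipschitz[OF ln_ab1] by (simp add: log_cutoff_eq_profile)
    have "\<bar>ln (norm ?q) - ln (norm ?q')\<bar> = \<epsilon> * \<bar>log_cutoff a b ?q' - log_cutoff a b ?q\<bar>"
      unfolding l abs_mult using \<epsilon>(1) by simp
    also have "\<dots> \<le> \<epsilon> * \<bar>ln (norm ?q') - ln (norm ?q)\<bar>"
      by (rule mult_left_mono[OF lip \<epsilon>(1)])
    also have "\<dots> = \<epsilon> * \<bar>ln (norm ?q) - ln (norm ?q')\<bar>" by (simp only: abs_minus_commute)
    finally have "\<bar>ln (norm ?q) - ln (norm ?q')\<bar> \<le> \<epsilon> * \<bar>ln (norm ?q) - ln (norm ?q')\<bar>" .
    then have "(1 - \<epsilon>) * \<bar>ln (norm ?q) - ln (norm ?q')\<bar> \<le> 0" by (simp add: algebra_simps)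
    then have "ln (norm ?q) = ln (norm ?q')" using \<epsilon>(2) by (simp add: mult_le_0_iff)
    then have "log_cutoff a b ?q = log_cutoff a b ?q'" using False by (simp add: log_cutoff_eq_profile)
    then show ?thesis using eq by simp
  qed
qed

lemma radial_stretch_has_derivative:
  fixes x0 :: "'a::euclidean_space"
  shows "((\<lambda>x. x0 + exp (\<epsilon> * log_cutoff a b (x - x0)) *\<^sub>R (x - x0)) has_derivative
     (\<lambda>h. exp (\<epsilon> * log_cutoff a b (x - x0)) *\<^sub>R (h + ((\<epsilon> *\<^sub>R log_cutoff_gradient a b (x - x0)) \<bullet> h) *\<^sub>R (x - x0)))) (at x)"
proof -
  let ?Q = "\<lambda>x. log_cutoff a b (x - x0)" and ?G = "log_cutoff_gradient a b (x - x0)"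
  have 1: "(log_cutoff a b has_derivative (\<lambda>h. h \<bullet> ?G)) (at (x - x0))"
    using log_cutoff_C1[where 'a='a] by (simp add: C1_gradient_def gderiv_def)
  have 2: "((\<lambda>x. x - x0) has_derivative (\<lambda>h. h)) (at x)" by (auto intro!: derivative_eq_intros)
  have Q: "(?Q has_derivative (\<lambda>h. h \<bullet> ?G)) (at x)" using has_derivative_compose[OF 2 1] .
  have 3: "((\<lambda>x. \<epsilon> * ?Q x) has_derivative (\<lambda>h. \<epsilon> * (h \<bullet> ?G))) (at x)"
    by (rule has_derivative_mult_right[OF Q])
  have "(exp has_derivative (\<lambda>h. exp (\<epsilon> * ?Q x) * h)) (at (\<epsilon> * ?Q x))"
    using DERIV_exp[of "\<epsilon> * ?Q x"] by (simp add: has_field_derivative_def)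
  from has_derivative_compose[OF 3 this]
  have 4: "((\<lambda>x. exp (\<epsilon> * ?Q x)) has_derivative (\<lambda>h. exp (\<epsilon> * ?Q x) * (\<epsilon> * (h \<bullet> ?G)))) (at x)" .
  have 5: "((\<lambda>x. exp (\<epsilon> * ?Q x) *\<^sub>R (x - x0)) has_derivative
     (\<lambda>h. exp (\<epsilon> * ?Q x) *\<^sub>R h + (exp (\<epsilon> * ?Q x) * (\<epsilon> * (h \<bullet> ?G))) *\<^sub>R (x - x0))) (at x)"
    by (rule has_derivative_scaleR[OF 4 2])
  have "((\<lambda>x. x0 + exp (\<epsilon> * ?Q x) *\<^sub>R (x - x0)) has_derivative
     (\<lambda>h. 0 + (exp (\<epsilon> * ?Q x) *\<^sub>R h + (exp (\<epsilon> * ?Q x) * (\<epsilon> * (h \<bullet> ?G))) *\<^sub>R (x - x0)))) (at x)"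
    by (rule has_derivative_add[OF has_derivative_const 5])
  then show ?thesis
    by (rule has_derivative_eq_rhs) (simp add: fun_eq_iff scaleR_add_right inner_commute)
qed

text \<open>The map \<open>\<Phi> x = x0 + exp (\<epsilon> * Q (x - x0)) *\<^sub>R (x - x0)\<close>, with the logarithmic cutoff \<open>Q\<close>, is linear near \<open>x0\<close> and the
  identity outside the ball of radius \<open>b\<close>. If \<open>k\<close> is the slope of \<open>Q\<close> in \<open>- ln (norm (x - x0))\<close>, the derivative of \<open>\<Phi>\<close> is
  conformal up to a factor \<open>1 - \<epsilon> * k\<close> in the radial direction. So the radial component of the gradient is multiplied by
  \<open>1 - \<epsilon> * k\<close>, and the Jacobian, which costs at most \<open>1 / (1 - \<epsilon>)\<close>, enters through the substitution.\<close>

lemma modulus_metric_radial_stretch: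
  fixes D :: "(real^'n) set"
  assumes n: "2 \<le> CARD('n)"
    and D: "cball x0 b \<subseteq> D" and \<epsilon>: "0 < \<epsilon>" "\<epsilon> \<le> 1/2" "\<epsilon> * (ln (b / a) - 1) \<le> 1"
    and \<gamma>: "arc \<gamma>" "path_image \<gamma> \<subseteq> D" "pathstart \<gamma> = x0" "pathfinish \<gamma> = y"
    and y: "y \<noteq> x0" "norm (y - x0) \<le> a" and u: "admissible D (path_image \<gamma>) u g"
  shows "modulus_metric D x0 (x0 + exp (- \<epsilon> * (ln (b / a) - 1)) *\<^sub>R (y - x0)) \<le>
     ennreal (\<integral>z. norm (g z) ^ CARD('n) / (1 - \<epsilon>) -
        2 * \<epsilon> * (radial_density x0 (exp 2 * a) (b / exp 1) g z) \<partial>lborel)"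
proof -
  let ?M = "ln (b / a) - 1"
  let ?A = "{z. exp 2 * a \<le> norm (z - x0) \<and> norm (z - x0) < b / exp 1}"
  let ?R = "\<lambda>z. indicator ?A z * \<bar>sgn (z - x0) \<bullet> g z\<bar> ^ CARD('n)"
  let ?H = "\<lambda>z. norm (g z) ^ CARD('n) / (1 - \<epsilon>) - 2 * \<epsilon> * ?R z"
  define \<Phi> where "\<Phi> x = x0 + exp (\<epsilon> * log_cutoff a b (x - x0)) *\<^sub>R (x - x0)" for x
  define G where "G x = log_cutoff_gradient a b (x - x0)" for x
  have M: "0 \<le> ?M" using log_cutoff_nonneg_le[of "0::real"] by linarith
  have C1: "C1_compact_support_in D u g" using u by (simp add: admissible_def)
  have cg: "continuous_on UNIV g" using C1 by (simp add: C1_compact_support_in_def)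
  have [measurable]: "g \<in> borel_measurable borel" using cg by (rule borel_measurable_continuous_onI)
  have int_g: "integrable lborel (\<lambda>z. norm (g z) ^ CARD('n))" using integrable_gradient_power[OF C1] .
  have R_le: "?R z \<le> norm (g z) ^ CARD('n)" for z by (rule radial_density_le)
  have int_R: "integrable lborel ?R" by (rule integrable_radial_density[OF C1])
  have int_H: "integrable lborel ?H" using int_g int_R by simp
  have H_nonneg: "0 \<le> ?H z" for z
  proof -
    have "2 * \<epsilon> * ?R z \<le> 1 * norm (g z) ^ CARD('n)" using R_le[of z] \<epsilon> by (intro mult_mono) auto
    also have "\<dots> \<le> norm (g z) ^ CARD('n) / (1 - \<epsilon>)" using \<epsilon> by (simp add: pos_le_divide_eq mult_left_le)
    finally show ?thesis by simp
  qed
  have cG: "continuous_on UNIV G"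
  proof -
    have "continuous_on UNIV (log_cutoff_gradient a b :: real^'n \<Rightarrow> real^'n)"
      using log_cutoff_C1[where 'a="real^'n"] by (simp add: C1_gradient_def)
    then show ?thesis unfolding G_def
      by (rule continuous_on_compose2) (auto intro!: continuous_intros)
  qed
  have cQ: "continuous_on UNIV (\<lambda>x::real^'n. log_cutoff a b (x - x0))"
    by (rule continuous_on_compose2[OF C1_gradient_continuous[OF log_cutoff_C1]]) (auto intro!: continuous_intros)
  let ?z = "x0 + exp (- \<epsilon> * ?M) *\<^sub>R (y - x0)"
  have zx: "?z - x0 = exp (- \<epsilon> * ?M) *\<^sub>R (y - x0)" by simp
  have nz: "norm (?z - x0) \<le> a"
  proof -
    have "norm (?z - x0) = exp (- \<epsilon> * ?M) * norm (y - x0)" unfolding zx by simp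
    also have "\<dots> \<le> 1 * norm (y - x0)" using \<epsilon> M by (intro mult_right_mono) auto
    finally show ?thesis using y(2) by linarith
  qed
  have \<Phi>z: "\<Phi> ?z = y"
  proof -
    have "\<Phi> ?z = x0 + exp (\<epsilon> * ?M) *\<^sub>R (exp (- \<epsilon> * ?M) *\<^sub>R (y - x0))"
      unfolding \<Phi>_def log_cutoff_inner[OF nz] unfolding zx ..
    also have "\<dots> = y" unfolding scaleR_scaleR exp_add[symmetric] by simp
    finally show ?thesis .
  qed
  show ?thesis
  proof (rule modulus_metric_pullback_le[where \<Phi>=\<Phi> and c="\<lambda>x. exp (\<epsilon> * log_cutoff a b (x - x0))" and
        p="\<lambda>x. \<epsilon> *\<^sub>R G x" and q="\<lambda>x. x - x0" and C="cball x0 b", OF \<gamma>(1,2,3) _ u])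
    show "(\<Phi> has_derivative (\<lambda>h. exp (\<epsilon> * log_cutoff a b (x - x0)) *\<^sub>R (h + ((\<epsilon> *\<^sub>R G x) \<bullet> h) *\<^sub>R (x - x0)))) (at x)" for x
      unfolding \<Phi>_def[abs_def] G_def by (rule radial_stretch_has_derivative)
    show "inj \<Phi>" unfolding \<Phi>_def[abs_def] using \<epsilon> by (intro inj_radial_stretch) auto
    show "\<Phi> x = x" if "x \<notin> cball x0 b" for x
      using that log_cutoff_outer[of "x - x0"] by (simp add: \<Phi>_def dist_norm norm_minus_commute)
    show "norm (g (\<Phi> x) + ((x - x0) \<bullet> g (\<Phi> x)) *\<^sub>R (\<epsilon> *\<^sub>R G x)) ^ CARD('n) \<le> \<bar>1 + (\<epsilon> *\<^sub>R G x) \<bullet> (x - x0)\<bar> * ?H (\<Phi> x)" for x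
    proof -
      let ?q = "x - x0" and ?v = "g (\<Phi> x)"
      let ?k = "log_cutoff_slope a b ?q"
      let ?e = "sgn ?q"
      let ?\<delta> = "\<epsilon> * ?k"
      have k: "0 \<le> ?k" "?k \<le> 1" using log_cutoff_slope_bounds by auto
      have "?\<delta> \<le> \<epsilon>" "0 \<le> ?\<delta>" using k \<epsilon> by (auto simp: mult_left_le)
      then have \<delta>: "0 \<le> ?\<delta>" "?\<delta> \<le> \<epsilon>" "?\<delta> \<le> 1/2" using \<epsilon>(2) by linarith+
      have P: "0 \<le> norm ?v ^ CARD('n)" by simp
      have Gq: "(?q \<bullet> w) *\<^sub>R G x = - (?k * (?e \<bullet> w)) *\<^sub>R ?e \<and> G x \<bullet> ?q = - ?k" for w
      proof (cases "?k = 0")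
        case True
        then show ?thesis by (simp add: G_def log_cutoff_gradient_def)
      next
        case False
        then have "a < norm ?q" using log_cutoff_slope_inner[of ?q] by (meson not_le)
        then have q: "norm ?q \<noteq> 0" "max a (norm ?q) = norm ?q" using a_pos by auto
        then have Gx: "G x = - (?k / (norm ?q)\<^sup>2) *\<^sub>R ?q" by (simp add: G_def log_cutoff_gradient_def)
        have "G x \<bullet> ?q = - ?k"
          unfolding Gx using q(1) by (simp add: power2_norm_eq_inner[symmetric])
        moreover have "(?q \<bullet> w) *\<^sub>R G x = - (?k * (?e \<bullet> w)) *\<^sub>R ?e"
          unfolding Gx by (simp add: sgn_div_norm power2_eq_square divide_inverse mult_ac)
        ultimately show ?thesis by blast
      qed
      have eq1: "?v + (?q \<bullet> ?v) *\<^sub>R (\<epsilon> *\<^sub>R G x) = ?v - (?\<delta> * (?e \<bullet> ?v)) *\<^sub>R ?e"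
      proof -
        have "(?q \<bullet> ?v) *\<^sub>R (\<epsilon> *\<^sub>R G x) = \<epsilon> *\<^sub>R ((?q \<bullet> ?v) *\<^sub>R G x)" by simp
        also have "\<dots> = - ((?\<delta> * (?e \<bullet> ?v)) *\<^sub>R ?e)" using Gq[of ?v] by (simp add: mult.assoc)
        finally show ?thesis by simp
      qed
      have eq2: "\<bar>1 + (\<epsilon> *\<^sub>R G x) \<bullet> ?q\<bar> = 1 - ?\<delta>" using Gq[of 0] \<delta> by simp
      have sg: "sgn (\<Phi> x - x0) = ?e" by (simp add: \<Phi>_def sgn_scaleR)
      have lhs: "norm (?v - (?\<delta> * (?e \<bullet> ?v)) *\<^sub>R ?e) ^ CARD('n) \<le> norm ?v ^ CARD('n) - (2 * ?\<delta> - ?\<delta>\<^sup>2) * \<bar>?e \<bullet> ?v\<bar> ^ CARD('n)"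
      proof (cases "?q = 0")
        case True
        then show ?thesis by (simp add: power_0_left)
      next
        case False
        then show ?thesis using \<delta> n by (intro norm_shrink_component_power) (auto simp: norm_sgn)
      qed
      also have "\<dots> \<le> (1 - ?\<delta>) * ?H (\<Phi> x)"
      \<comment> \<open>\<open>\<Phi>\<close> moves points away from \<open>x0\<close>, by a factor of at most \<open>exp 1\<close>. Since the annulus \<open>?A\<close> starts at \<open>exp 2 * a\<close>,
        preimages of its points lie where the slope of the cutoff is exactly \<open>1\<close>.\<close>
      proof (cases "\<Phi> x \<in> ?A")
        case True
        have nq: "norm (\<Phi> x - x0) = exp (\<epsilon> * log_cutoff a b ?q) * norm ?q" by (simp add: \<Phi>_def)
        have Q: "0 \<le> log_cutoff a b ?q" "log_cutoff a b ?q \<le> ?M" using log_cutoff_nonneg_le by auto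
        have le1: "exp (\<epsilon> * log_cutoff a b ?q) \<le> exp 1"
        proof -
          have "\<epsilon> * log_cutoff a b ?q \<le> \<epsilon> * ?M" using Q \<epsilon> by (intro mult_left_mono) auto
          then show ?thesis using \<epsilon>(3) by simp
        qed
        have "exp 2 * a \<le> exp 1 * norm ?q"
          using True nq mult_right_mono[OF le1, of "norm ?q"] by simp
        then have "exp 1 * (exp 1 * a) \<le> exp 1 * norm ?q" by (simp add: exp_add[symmetric] mult.assoc[symmetric])
        then have 1: "exp 1 * a \<le> norm ?q" by simp
        have "1 * norm ?q \<le> exp (\<epsilon> * log_cutoff a b ?q) * norm ?q"
          using Q \<epsilon> by (intro mult_right_mono) auto
        then have 2: "norm ?q \<le> b / exp 1" using True nq by simp
        have kk: "?k = 1" using log_cutoff_slope_middle[OF 1 2] .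
        define P where "P = norm ?v ^ CARD('n)"
        define r where "r = \<bar>?e \<bullet> ?v\<bar> ^ CARD('n)"
        have "?H (\<Phi> x) = P / (1 - \<epsilon>) - 2 * \<epsilon> * r"
          unfolding P_def r_def sg using True by (simp del: mem_Collect_eq)
        then have "(1 - \<epsilon>) * ?H (\<Phi> x) = P - (1 - \<epsilon>) * (2 * \<epsilon> * r)"
          using \<epsilon> by (simp add: right_diff_distrib)
        moreover have "(1 - \<epsilon>) * (2 * \<epsilon> * r) = (2 * \<epsilon> - \<epsilon>\<^sup>2) * r - \<epsilon>\<^sup>2 * r"
          by (simp add: power2_eq_square algebra_simps)
        moreover have "0 \<le> \<epsilon>\<^sup>2 * r" by (simp add: r_def)
        ultimately have "P - (2 * \<epsilon> - \<epsilon>\<^sup>2) * r \<le> (1 - \<epsilon>) * ?H (\<Phi> x)" by linarith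
        then show ?thesis unfolding kk mult_1_right P_def r_def .
      next
        case False
        have "norm ?v ^ CARD('n) - (2 * ?\<delta> - ?\<delta>\<^sup>2) * \<bar>?e \<bullet> ?v\<bar> ^ CARD('n) \<le> norm ?v ^ CARD('n)"
        proof -
          have "?\<delta> \<le> 1" using \<delta> by linarith
          then have "0 \<le> 2 * ?\<delta> - ?\<delta>\<^sup>2" by (rule twice_minus_square_nonneg[OF \<delta>(1)])
          then have "0 \<le> (2 * ?\<delta> - ?\<delta>\<^sup>2) * \<bar>?e \<bullet> ?v\<bar> ^ CARD('n)" by (rule mult_nonneg_nonneg) simp
          then show ?thesis by linarith
        qed
        also have "\<dots> \<le> (1 - ?\<delta>) / (1 - \<epsilon>) * norm ?v ^ CARD('n)"
        proof -
          have "1 \<le> (1 - ?\<delta>) / (1 - \<epsilon>)"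
            using \<delta>(2) \<epsilon>(2) by (subst pos_le_divide_eq) auto
          from mult_right_mono[OF this P] show ?thesis by (simp only: mult_1_left)
        qed
        also have "\<dots> = (1 - ?\<delta>) * ?H (\<Phi> x)" using False by (simp del: mem_Collect_eq)
        finally show ?thesis .
      qed
      finally show ?thesis unfolding eq1 eq2 .
    qed
    show "pathfinish \<gamma> = \<Phi> ?z" unfolding \<Phi>z by (rule \<gamma>(4))
    show "continuous_on UNIV (\<lambda>x. exp (\<epsilon> * log_cutoff a b (x - x0)))" by (intro continuous_intros cQ)
    show "continuous_on UNIV (\<lambda>x. \<epsilon> *\<^sub>R G x)" by (intro continuous_intros cG)
    show "continuous_on UNIV (\<lambda>x. x - x0)" by (intro continuous_intros)
    show "\<Phi> x0 = x0" by (simp add: \<Phi>_def)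
    show "?z \<noteq> x0" using y(1) by simp
    show "compact (cball x0 b)" by simp
    show "cball x0 b \<subseteq> D" by (rule D)
    show "integrable lborel ?H" by (rule int_H)
    show "0 \<le> ?H w" for w by (rule H_nonneg)
  qed
qed

end

section \<open>The logarithmic upper bound\<close>

lemma nn_integral_dyadic_annulus:
  fixes \<rho> :: real
  assumes \<rho>: "0 < \<rho>"
  shows "(\<integral>\<^sup>+z\<in>{z::'a::euclidean_space. \<rho> \<le> norm z \<and> norm z < 2 * \<rho>}. ennreal (1 / norm z ^ DIM('a)) \<partial>lborel)
    = ennreal (shell_mass TYPE('a))"
proof -
  define f where "f z = ennreal (shell_weight (z /\<^sub>R \<rho>) / \<rho> ^ DIM('a))" for z :: 'a
  have [measurable]: "f \<in> borel_measurable borel" unfolding f_def[abs_def] by measurable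
  have "ennreal (1 / norm z ^ DIM('a)) * indicator {z. \<rho> \<le> norm z \<and> norm z < 2 * \<rho>} z = f z" for z :: 'a
    using \<rho> by (auto simp: f_def shell_weight_def indicator_def field_simps power_mult_distrib power_divide)
  then have "(\<integral>\<^sup>+z\<in>{z::'a. \<rho> \<le> norm z \<and> norm z < 2 * \<rho>}. ennreal (1 / norm z ^ DIM('a)) \<partial>lborel) = (\<integral>\<^sup>+z. f z \<partial>lborel)"
    by simp
  also have "\<dots> = ennreal (\<rho> ^ DIM('a)) * (ennreal (1 / \<bar>\<rho>\<bar> ^ DIM('a)) * (\<integral>\<^sup>+z. f z \<partial>lborel))"
    using \<rho> by (simp add: mult.assoc[symmetric] ennreal_mult[symmetric])
  also have "ennreal (1 / \<bar>\<rho>\<bar> ^ DIM('a)) * (\<integral>\<^sup>+z. f z \<partial>lborel) = (\<integral>\<^sup>+x. f (0 + \<rho> *\<^sub>R x) \<partial>lborel)"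
    by (rule nn_integral_lborel_affine[symmetric]) (use \<rho> in auto)
  also have "\<dots> = (\<integral>\<^sup>+x. ennreal (1 / \<rho> ^ DIM('a)) * ennreal (shell_weight (x::'a)) \<partial>lborel)"
    using \<rho> by (intro nn_integral_cong) (simp add: f_def ennreal_mult[symmetric] shell_weight_bounds)
  also have "\<dots> = ennreal (1 / \<rho> ^ DIM('a)) * ennreal (shell_mass TYPE('a))"
    by (simp add: nn_integral_cmult nn_integral_shell_weight)
  also have "ennreal (\<rho> ^ DIM('a)) * \<dots> = ennreal (shell_mass TYPE('a))"
    using \<rho> by (simp add: mult.assoc[symmetric] ennreal_mult[symmetric])
  finally show ?thesis .
qed

text \<open>All dyadic annuli have the same weight by dilation invariance. Covering by whole ones costs the additive
  constant, which is negligible for large \<open>b / a\<close>.\<close>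

lemma nn_integral_annulus_le:
  fixes a b :: real
  assumes a: "0 < a" "a \<le> b"
  shows "(\<integral>\<^sup>+z\<in>{z::'a::euclidean_space. a \<le> norm z \<and> norm z < b}. ennreal (1 / norm z ^ DIM('a)) \<partial>lborel)
    \<le> ennreal (shell_mass TYPE('a) * (ln (b / a) / ln 2 + 1))"
proof -
  let ?w = "shell_mass TYPE('a)"
  let ?F = "\<lambda>c d. \<integral>\<^sup>+z\<in>{z::'a. c \<le> norm z \<and> norm z < d}. ennreal (1 / norm z ^ DIM('a)) \<partial>lborel"
  have w: "0 < ?w" by (rule shell_mass_pos)
  have dy: "?F a (2 ^ N * a) \<le> ennreal (real N * ?w)" for N
  proof (induction N)
    case (Suc N)
    have "?F a (2 ^ Suc N * a) \<le> (\<integral>\<^sup>+z. ennreal (1 / norm z ^ DIM('a)) * indicator {z::'a. a \<le> norm z \<and> norm z < 2 ^ N * a} z +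
        ennreal (1 / norm z ^ DIM('a)) * indicator {z::'a. 2 ^ N * a \<le> norm z \<and> norm z < 2 * (2 ^ N * a)} z \<partial>lborel)"
      by (intro nn_integral_mono) (auto simp: indicator_def)
    also have "\<dots> = ?F a (2 ^ N * a) + ?F (2 ^ N * a) (2 * (2 ^ N * a))"
      by (rule nn_integral_add) measurable
    also have "?F (2 ^ N * a) (2 * (2 ^ N * a)) = ennreal ?w"
      using a by (intro nn_integral_dyadic_annulus) simp
    also have "?F a (2 ^ N * a) + ennreal ?w \<le> ennreal (real N * ?w) + ennreal ?w"
      by (intro add_right_mono Suc)
    also have "\<dots> = ennreal (real (Suc N) * ?w)"
      using w by (subst ennreal_plus[symmetric]) (auto simp: algebra_simps)
    finally show ?case .
  next
    case 0
    have "{z::'a. a \<le> norm z \<and> norm z < 2 ^ 0 * a} = {}" by auto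
    then show ?case by simp
  qed
  define N where "N = nat \<lceil>log 2 (b / a)\<rceil>"
  have l0: "0 \<le> log 2 (b / a)" using a by simp
  have Nl: "log 2 (b / a) \<le> real N" "real N \<le> log 2 (b / a) + 1" using l0 by (auto simp: N_def)
  have "b / a = 2 powr (log 2 (b / a))" using a by simp
  also have "\<dots> \<le> 2 powr real N" using Nl by simp
  also have "\<dots> = 2 ^ N" by (simp add: powr_realpow)
  finally have bN: "b \<le> 2 ^ N * a" using a by (simp add: field_simps)
  have "?F a b \<le> ?F a (2 ^ N * a)" using bN by (intro nn_integral_mono) (auto simp: indicator_def)
  also have "\<dots> \<le> ennreal (real N * ?w)" by (rule dy)
  also have "\<dots> \<le> ennreal (?w * (ln (b / a) / ln 2 + 1))"
    using Nl w by (intro ennreal_leI) (simp add: mult.commute log_def)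
  finally show ?thesis .
qed

lemma (in log_cutoff_radii) ln_ratio_ge: "2 \<le> ln (b / a)"
  using ln_ab a_pos b_pos by (simp add: ln_div)

lemma (in log_cutoff_radii) a_le_b: "a \<le> b"
proof -
  have "1 * a \<le> exp 2 * a" using a_pos by (intro mult_right_mono) auto
  then show ?thesis using ab by linarith
qed

text \<open>The segment from \<open>x0\<close> to \<open>y\<close>, with the logarithmic cutoff divided by its maximum.\<close>

lemma (in log_cutoff_radii) modulus_metric_le_log:
  fixes D :: "(real^'n) set"
  assumes D: "cball x0 b \<subseteq> D" and y: "y \<noteq> x0" "norm (y - x0) \<le> a"
  shows "modulus_metric D x0 y \<le> ennreal (shell_mass TYPE(real^'n) * (ln (b / a) / ln 2 + 1) / (ln (b / a) - 1) ^ CARD('n))"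
proof -
  let ?M = "ln (b / a) - 1" and ?w = "shell_mass TYPE(real^'n)"
  have M: "1 \<le> ?M" using ln_ratio_ge by simp
  define u where "u x = log_cutoff a b (x - x0) / ?M" for x
  define g where "g x = (1 / ?M) *\<^sub>R log_cutoff_gradient a b (x - x0)" for x
  have LC: "C1_gradient (log_cutoff a b :: real^'n \<Rightarrow> real) (log_cutoff_gradient a b)" by (rule log_cutoff_C1)
  have cont: "continuous_on UNIV (\<lambda>x::real^'n. log_cutoff_gradient a b (x - x0))"
  proof -
    have "continuous_on UNIV (log_cutoff_gradient a b :: real^'n \<Rightarrow> real^'n)"
      using LC by (simp add: C1_gradient_def)
    then show ?thesis by (rule continuous_on_compose2) (auto intro!: continuous_intros)
  qed
  have gd: "GDERIV u x :> g x" for x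
  proof -
    have 1: "(log_cutoff a b has_derivative (\<lambda>h. h \<bullet> log_cutoff_gradient a b (x - x0))) (at (x - x0))"
      using LC by (simp add: C1_gradient_def gderiv_def)
    have 2: "((\<lambda>x. x - x0) has_derivative (\<lambda>h. h)) (at x)" by (auto intro!: derivative_eq_intros)
    have "((\<lambda>x. (1 / ?M) * log_cutoff a b (x - x0)) has_derivative (\<lambda>h. (1 / ?M) * (h \<bullet> log_cutoff_gradient a b (x - x0)))) (at x)"
      by (rule has_derivative_mult_right[OF has_derivative_compose[OF 2 1]])
    moreover have "u = (\<lambda>x. (1 / ?M) * log_cutoff a b (x - x0))" by (simp add: fun_eq_iff u_def)
    ultimately show ?thesis unfolding gderiv_def by (simp only: g_def inner_scaleR_right)
  qed
  have "support_on UNIV u \<subseteq> cball x0 b"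
  proof
    fix x assume "x \<in> support_on UNIV u"
    then have "log_cutoff a b (x - x0) \<noteq> 0" by (auto simp: support_on_def u_def)
    then have "norm (x - x0) < b" using log_cutoff_outer[of "x - x0"] by (meson not_le)
    then show "x \<in> cball x0 b" by (simp add: dist_norm norm_minus_commute)
  qed
  then have sup: "compact (closure (support_on UNIV u)) \<and> closure (support_on UNIV u) \<subseteq> D"
    by (rule closure_support_in_compact[OF _ compact_cball D])
  have cg: "continuous_on UNIV g" unfolding g_def by (intro continuous_intros cont)
  have "C1_compact_support_in D u g"
    unfolding C1_compact_support_in_def using gd sup cg by blast
  moreover have "1 \<le> u x" if "x \<in> path_image (linepath x0 y)" for x
  proof -
    have "x \<in> closed_segment x0 y" using that by simp
    then have "norm (x - x0) \<le> norm (y - x0)" using segment_bound(1) by blast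
    then have "u x = 1" using y M log_cutoff_inner[of "x - x0"] by (simp add: u_def)
    then show ?thesis by simp
  qed
  ultimately have ad: "admissible D (path_image (linepath x0 y)) u g" by (simp add: admissible_def)
  have sub: "path_image (linepath x0 y) \<subseteq> D"
  proof
    fix x assume "x \<in> path_image (linepath x0 y)"
    then have "x \<in> closed_segment x0 y" by simp
    then have "norm (x - x0) \<le> norm (y - x0)" using segment_bound(1) by blast
    then have "norm (x - x0) \<le> b" using y(2) a_le_b by linarith
    then have "x \<in> cball x0 b" by (simp add: dist_norm norm_minus_commute)
    then show "x \<in> D" using D by blast
  qed
  have "modulus_metric D x0 y \<le> dirichlet g"
    by (rule modulus_metric_le_dirichlet[OF _ sub _ _ _ ad]) (use y in auto)
  also have "\<dots> = (\<integral>\<^sup>+x. ennreal (norm (g (x0 + 1 *\<^sub>R x)) ^ CARD('n)) \<partial>lborel)"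
  proof -
    have [measurable]: "g \<in> borel_measurable borel" using cg by (rule borel_measurable_continuous_onI)
    show ?thesis
      using nn_integral_lborel_affine[of "\<lambda>x. ennreal (norm (g x) ^ CARD('n))" 1 x0] by simp
  qed
  also have "\<dots> \<le> (\<integral>\<^sup>+x. ennreal (1 / ?M ^ CARD('n)) * (ennreal (1 / norm (x::real^'n) ^ CARD('n)) * indicator {x. a \<le> norm x \<and> norm x < b} x) \<partial>lborel)"
  proof (rule nn_integral_mono)
    fix x :: "real^'n"
    show "ennreal (norm (g (x0 + 1 *\<^sub>R x)) ^ CARD('n)) \<le>
      ennreal (1 / ?M ^ CARD('n)) * (ennreal (1 / norm x ^ CARD('n)) * indicator {x. a \<le> norm x \<and> norm x < b} x)"
    proof (cases "a \<le> norm x \<and> norm x < b")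
      case True
      then have "x \<noteq> 0" using a_pos by auto
      have "norm (g (x0 + 1 *\<^sub>R x)) = 1 / ?M * norm (log_cutoff_gradient a b x)" using M by (simp add: g_def)
      also have "\<dots> \<le> 1 / ?M * (1 / norm x)"
        by (rule mult_left_mono[OF norm_log_cutoff_gradient_le(2)[OF \<open>x \<noteq> 0\<close>]]) (use M in simp)
      finally have "norm (g (x0 + 1 *\<^sub>R x)) \<le> 1 / ?M * (1 / norm x)" .
      then have "norm (g (x0 + 1 *\<^sub>R x)) ^ CARD('n) \<le> (1 / ?M * (1 / norm x)) ^ CARD('n)"
        by (intro power_mono) auto
      then show ?thesis using True M
        by (simp add: ennreal_mult[symmetric] power_mult_distrib power_divide ennreal_leI)
    next
      case False
      then have *: "norm (g (x0 + 1 *\<^sub>R x)) ^ CARD('n) = 0"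
        using norm_log_cutoff_gradient_le(3)[of x] by (simp add: g_def not_le not_less power_0_left)
      show ?thesis unfolding * by simp
    qed
  qed
  also have "\<dots> = ennreal (1 / ?M ^ CARD('n)) * (\<integral>\<^sup>+x\<in>{x::real^'n. a \<le> norm x \<and> norm x < b}. ennreal (1 / norm x ^ CARD('n)) \<partial>lborel)"
    by (rule nn_integral_cmult) measurable
  also have "\<dots> \<le> ennreal (1 / ?M ^ CARD('n)) * ennreal (?w * (ln (b / a) / ln 2 + 1))"
  proof (rule mult_left_mono)
    show "(\<integral>\<^sup>+x\<in>{x::real^'n. a \<le> norm x \<and> norm x < b}. ennreal (1 / norm x ^ CARD('n)) \<partial>lborel) \<le> ennreal (?w * (ln (b / a) / ln 2 + 1))"
      using nn_integral_annulus_le[OF a_pos a_le_b, where 'a="real^'n"] by simp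
  qed simp
  also have "\<dots> = ennreal (?w * (ln (b / a) / ln 2 + 1) / ?M ^ CARD('n))"
    using M shell_mass_pos[where 'a="real^'n"] ln_ratio_ge by (subst ennreal_mult[symmetric]) auto
  finally show ?thesis .
qed

section \<open>Shell means and a boundary of positive capacity\<close>

lemma C1_gradient_translate:
  assumes "C1_gradient u g"
  shows "C1_gradient (\<lambda>x. u (x0 + x)) (\<lambda>x. g (x0 + x))"
proof -
  have "((\<lambda>x. u (x0 + x)) has_derivative (\<lambda>h. h \<bullet> g (x0 + x))) (at x)" for x
  proof -
    have 1: "(u has_derivative (\<lambda>h. h \<bullet> g (x0 + x))) (at (x0 + x))"
      using assms by (simp add: C1_gradient_def gderiv_def)
    have 2: "((\<lambda>x. x0 + x) has_derivative (\<lambda>h. h)) (at x)" by (auto intro!: derivative_eq_intros)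
    show ?thesis using has_derivative_compose[OF 2 1] .
  qed
  moreover have "continuous_on UNIV (\<lambda>x. g (x0 + x))"
  proof -
    have "continuous_on UNIV g" using assms by (simp add: C1_gradient_def)
    then show ?thesis by (rule continuous_on_compose2) (auto intro!: continuous_intros)
  qed
  ultimately show ?thesis by (simp add: C1_gradient_def gderiv_def)
qed

lemma nn_integral_translate:
  fixes f :: "'a::euclidean_space \<Rightarrow> ennreal"
  assumes "f \<in> borel_measurable borel"
  shows "(\<integral>\<^sup>+x. f (x0 + x) \<partial>lborel) = (\<integral>\<^sup>+x. f x \<partial>lborel)"
  using nn_integral_lborel_affine[OF assms, of 1 x0] by simp

text \<open>Reflection in the sphere of radius \<open>R\<close> about \<open>x0\<close>. Division by zero gives \<open>x0\<close> the image \<open>x0\<close> in place of the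
  point at infinity.\<close>

definition inversion :: "'a::real_inner \<Rightarrow> real \<Rightarrow> 'a \<Rightarrow> 'a" where
  "inversion x0 R x = x0 + (R\<^sup>2 / (norm (x - x0))\<^sup>2) *\<^sub>R (x - x0)"

lemma norm_inversion: "norm (inversion x0 R x - x0) = R\<^sup>2 / norm (x - x0)"
  by (cases "x = x0") (auto simp: inversion_def power2_eq_square)

lemma inversion_inversion: "R \<noteq> 0 \<Longrightarrow> inversion x0 R (inversion x0 R x) = x"
proof -
  assume R: "R \<noteq> 0"
  have "inversion x0 R x - x0 = (R\<^sup>2 / (norm (x - x0))\<^sup>2) *\<^sub>R (x - x0)" by (simp add: inversion_def)
  then have "inversion x0 R (inversion x0 R x) = x0 + (R\<^sup>2 / (R\<^sup>2 / norm (x - x0))\<^sup>2 * (R\<^sup>2 / (norm (x - x0))\<^sup>2)) *\<^sub>R (x - x0)"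
    unfolding inversion_def[of x0 R "inversion x0 R x"] norm_inversion by simp
  also have "\<dots> = x" using R by (cases "x = x0") (auto simp: power2_eq_square)
  finally show ?thesis .
qed

lemma has_derivative_inversion:
  fixes x0 :: "'a::real_inner"
  assumes "x \<noteq> x0"
  shows "(inversion x0 R has_derivative
    (\<lambda>h. (R\<^sup>2 / (norm (x - x0))\<^sup>2) *\<^sub>R (h + (((-2 / (norm (x - x0))\<^sup>2) *\<^sub>R (x - x0)) \<bullet> h) *\<^sub>R (x - x0)))) (at x)"
proof -
  let ?q = "x - x0"
  have q: "?q \<bullet> ?q \<noteq> 0" using assms by simp
  have eq: "inversion x0 R = (\<lambda>x. x0 + (R\<^sup>2 / ((x - x0) \<bullet> (x - x0))) *\<^sub>R (x - x0))"
    by (simp add: fun_eq_iff inversion_def power2_norm_eq_inner)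
  have 1: "((\<lambda>x. (x - x0) \<bullet> (x - x0)) has_derivative (\<lambda>h. ?q \<bullet> h + h \<bullet> ?q)) (at x)"
    by (auto intro!: derivative_eq_intros)
  have 2: "((\<lambda>x. R\<^sup>2 / ((x - x0) \<bullet> (x - x0))) has_derivative (\<lambda>h. - (R\<^sup>2 * (?q \<bullet> h + h \<bullet> ?q)) / ((?q \<bullet> ?q) * (?q \<bullet> ?q)))) (at x)"
    by (rule has_derivative_eq_rhs[OF has_derivative_divide[OF has_derivative_const 1 q]])
       (simp add: fun_eq_iff divide_inverse mult_ac)
  have 3: "((\<lambda>x. x - x0) has_derivative (\<lambda>h. h)) (at x)" by (auto intro!: derivative_eq_intros)
  have "((\<lambda>x. x0 + (R\<^sup>2 / ((x - x0) \<bullet> (x - x0))) *\<^sub>R (x - x0)) has_derivative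
     (\<lambda>h. 0 + ((R\<^sup>2 / (?q \<bullet> ?q)) *\<^sub>R h + (- (R\<^sup>2 * (?q \<bullet> h + h \<bullet> ?q)) / ((?q \<bullet> ?q) * (?q \<bullet> ?q))) *\<^sub>R ?q))) (at x)"
    by (rule has_derivative_add[OF has_derivative_const has_derivative_scaleR[OF 2 3]])
  then show ?thesis unfolding eq
  proof (rule has_derivative_eq_rhs, intro ext)
    fix h
    have "- (R\<^sup>2 * (?q \<bullet> h + h \<bullet> ?q)) / ((?q \<bullet> ?q) * (?q \<bullet> ?q)) = (R\<^sup>2 / (?q \<bullet> ?q)) * ((-2 / (?q \<bullet> ?q)) * (?q \<bullet> h))"
    proof -
      have "- (R\<^sup>2 * (t + t)) / (s * s) = (R\<^sup>2 / s) * ((-2 / s) * t)" if "s \<noteq> 0" for s t :: real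
        using that by (simp add: field_simps)
      from this[OF q, of "?q \<bullet> h"] show ?thesis by (simp only: inner_commute[of h ?q])
    qed
    then show "0 + ((R\<^sup>2 / (?q \<bullet> ?q)) *\<^sub>R h + (- (R\<^sup>2 * (?q \<bullet> h + h \<bullet> ?q)) / ((?q \<bullet> ?q) * (?q \<bullet> ?q))) *\<^sub>R ?q) =
      (R\<^sup>2 / (norm ?q)\<^sup>2) *\<^sub>R (h + (((-2 / (norm ?q)\<^sup>2) *\<^sub>R ?q) \<bullet> h) *\<^sub>R ?q)"
      by (simp only: power2_norm_eq_inner scaleR_add_right scaleR_scaleR inner_scaleR_left add_0)
  qed
qed

text \<open>Reflection in the hyperplane orthogonal to \<open>q\<close>; this is why the inversion is conformal.\<close>

lemma norm_reflect:
  fixes q v :: "'a::real_inner"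
  assumes "q \<noteq> 0"
  shows "norm (v + (q \<bullet> v) *\<^sub>R ((-2 / (norm q)\<^sup>2) *\<^sub>R q)) = norm v"
proof -
  define k where "k = -2 / (norm q)\<^sup>2"
  have k: "k * (q \<bullet> q) = -2" using assms by (simp add: k_def power2_norm_eq_inner)
  have "(v + (q \<bullet> v) *\<^sub>R (k *\<^sub>R q)) \<bullet> (v + (q \<bullet> v) *\<^sub>R (k *\<^sub>R q)) =
      v \<bullet> v + (q \<bullet> v) * (q \<bullet> v) * k * (2 + k * (q \<bullet> q))"
    by (simp add: inner_add_left inner_add_right inner_commute[of v q] algebra_simps)
  then have "(norm (v + (q \<bullet> v) *\<^sub>R (k *\<^sub>R q)))\<^sup>2 = (norm v)\<^sup>2"
    unfolding power2_norm_eq_inner k by simp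
  then show ?thesis unfolding k_def by (simp add: power2_eq_iff_nonneg)
qed

lemma frontier_point_outside:
  fixes D :: "(real^'n) set"
  assumes "open D"
  shows "Some x \<in> extended_space frontier_of (Some ` D) \<Longrightarrow> x \<notin> D"
proof -
  have "openin extended_space (Some ` D)" using assms by simp
  then have "extended_space interior_of (Some ` D) = Some ` D" by (rule interior_of_openin)
  then show "Some x \<in> extended_space frontier_of (Some ` D) \<Longrightarrow> x \<notin> D"
    by (auto simp: frontier_of_def)
qed

text \<open>The inversion about \<open>x0\<close> is a Moebius transformation, and it moves the frontier of \<open>D\<close> into a bounded part of \<open>\<real>\<^sup>n\<close> because the
  frontier stays away from \<open>x0\<close>. A bounded domain around the image with zero capacity would show that the frontier
  has zero capacity. The centre \<open>x0\<close> belongs to \<open>K\<close> if the frontier contains the point at infinity.\<close>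

lemma positive_capacity_inverted_boundary:
  fixes D :: "(real^'n) set"
  assumes D: "open D" "x0 \<in> D" and pos: "positive_capacity (extended_space frontier_of (Some ` D))"
    and R: "0 < R" "cball x0 R \<subseteq> D"
  shows "\<exists>K. K \<subseteq> ball x0 R \<and> (\<forall>x\<in>K. x = x0 \<or> inversion x0 R x \<notin> D) \<and>
    (\<forall>G. open G \<and> connected G \<and> bounded G \<and> K \<subseteq> G \<longrightarrow> capacity G K \<noteq> 0)"
proof -
  let ?F = "extended_space frontier_of (Some ` D)"
  let ?T = "sphere_reflection x0 R"
  define K where "K = {x. Some x \<in> ?T ` ?F}"
  have nz: "\<not> zero_capacity ?F" using pos by (simp add: positive_capacity_def)
  have T: "moebius ?T" using moebius_sphere[OF moebius_id R(1), of x0] by simp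
  have noinf: "None \<notin> ?T ` ?F"
  proof
    assume "None \<in> ?T ` ?F"
    then obtain y where y: "y \<in> ?F" "?T y = None" by force
    then have "y = Some x0" by (cases y) (auto split: if_splits)
    then show False using frontier_point_outside[OF D(1)] y(1) D(2) by blast
  qed
  have TK: "?T ` ?F = Some ` K"
  proof
    show "?T ` ?F \<subseteq> Some ` K"
    proof
      fix y assume y: "y \<in> ?T ` ?F"
      then obtain x where "y = Some x" using noinf by (cases y) auto
      then show "y \<in> Some ` K" using y by (simp add: K_def)
    qed
    show "Some ` K \<subseteq> ?T ` ?F" by (auto simp: K_def)
  qed
  have K: "x \<in> ball x0 R \<and> (x = x0 \<or> inversion x0 R x \<notin> D)" if "x \<in> K" for x
  proof (cases "x = x0")
    case True
    then show ?thesis using R by simp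
  next
    case False
    obtain y where y: "y \<in> ?F" "?T y = Some x" using \<open>x \<in> K\<close> unfolding K_def by force
    then obtain z where z: "y = Some z" using False by (cases y) auto
    then have zD: "z \<notin> D" using y(1) frontier_point_outside[OF D(1)] by blast
    then have zx: "z \<noteq> x0" "R < norm (z - x0)"
      using D(2) R by (auto simp: subset_iff dist_norm norm_minus_commute not_le)
    have xz: "x = inversion x0 R z" using y(2) z zx by (simp add: inversion_def)
    then have "inversion x0 R x = z" using R by (simp add: inversion_inversion)
    moreover have "norm (x - x0) < R"
      unfolding xz norm_inversion using zx R by (simp add: power2_eq_square divide_less_eq mult_strict_left_mono)
    ultimately show ?thesis using zD by (simp add: dist_norm norm_minus_commute)
  qed
  moreover have "capacity G K \<noteq> 0" if "open G" "connected G" "bounded G" "K \<subseteq> G" for G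
  proof
    assume "capacity G K = 0"
    then have "zero_capacity ?F"
      unfolding zero_capacity_def using pos T TK that unfolding positive_capacity_def by blast
    then show False using nz by simp
  qed
  ultimately show ?thesis by (intro exI[of _ K]) auto
qed

lemma sum_power_le:
  fixes x y :: real
  assumes "0 \<le> x" "0 \<le> y"
  shows "(x + y) ^ n \<le> 2 ^ n * (x ^ n + y ^ n)"
proof -
  have "(x + y) ^ n \<le> (2 * max x y) ^ n" using assms by (intro power_mono) auto
  also have "\<dots> = 2 ^ n * max x y ^ n" by (simp add: power_mult_distrib)
  also have "\<dots> \<le> 2 ^ n * (x ^ n + y ^ n)"
    using assms by (intro mult_left_mono) (auto simp: max_def)
  finally show ?thesis .
qed

text \<open>As \<open>u\<close> has compact support, \<open>u \<circ> inversion x0 R\<close> vanishes in a punctured neighbourhood of \<open>x0\<close> and its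
  extension by \<open>0\<close> is of class \<open>C\<^sup>1\<close>.\<close>

lemma inverted_competitor:
  fixes u :: "real^'n \<Rightarrow> real" and x0 :: "real^'n"
  assumes u: "C1_compact_support_in D u g" and R: "0 < R"
  defines "U \<equiv> \<lambda>x. if x = x0 then 0 else u (inversion x0 R x)"
    and "V \<equiv> \<lambda>x. if x = x0 then 0 else (R\<^sup>2 / (norm (x - x0))\<^sup>2) *\<^sub>R (g (inversion x0 R x) +
           ((x - x0) \<bullet> g (inversion x0 R x)) *\<^sub>R ((-2 / (norm (x - x0))\<^sup>2) *\<^sub>R (x - x0)))"
  shows "C1_gradient U V" and "x \<noteq> x0 \<Longrightarrow> norm (V x) = (R / norm (x - x0))\<^sup>2 * norm (g (inversion x0 R x))"
proof -
  let ?S = "closure (support_on UNIV u)"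
  have "bounded ?S" using u by (simp add: C1_compact_support_in_def compact_imp_bounded)
  then obtain B where B: "0 < B" "\<And>x. x \<in> ?S \<Longrightarrow> norm (x - x0) \<le> B"
  proof -
    obtain e where e: "\<And>y. y \<in> ?S \<Longrightarrow> dist x0 y \<le> e"
      using \<open>bounded ?S\<close> bounded_any_center[of ?S x0] by auto
    show thesis
    proof (rule that[of "max e 1"])
      show "norm (x - x0) \<le> max e 1" if "x \<in> ?S" for x
        using e[OF that] by (simp add: dist_norm norm_minus_commute le_max_iff_disj)
    qed simp
  qed
  define \<delta> where "\<delta> = R\<^sup>2 / B"
  have \<delta>: "0 < \<delta>" using R B by (simp add: \<delta>_def)
  have near: "inversion x0 R x \<notin> ?S" if "x \<noteq> x0" "norm (x - x0) < \<delta>" for x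
  proof -
    have "B * norm (x - x0) < R\<^sup>2" using that(2) B by (simp add: \<delta>_def pos_less_divide_eq mult.commute)
    then have "B < R\<^sup>2 / norm (x - x0)" using that(1) by (simp add: pos_less_divide_eq)
    then have "B < norm (inversion x0 R x - x0)" unfolding norm_inversion .
    then show ?thesis using B(2) by force
  qed
  have zero: "U x = 0" "V x = 0" if "x \<in> ball x0 \<delta>" for x
    using that near[of x] zero_outside_support[OF u, of "inversion x0 R x"]
    by (auto simp: U_def V_def dist_norm norm_minus_commute)
  have cJ: "continuous_on (- {x0}) (inversion x0 R)"
    unfolding inversion_def[abs_def] by (intro continuous_intros) auto
  have cg: "continuous_on UNIV g" using u by (simp add: C1_compact_support_in_def)
  have cgJ: "continuous_on (- {x0}) (\<lambda>x. g (inversion x0 R x))"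
    by (rule continuous_on_compose2[OF cg cJ]) simp
  have "continuous_on (- {x0}) V"
  proof (rule continuous_on_eq)
    show "continuous_on (- {x0}) (\<lambda>x. (R\<^sup>2 / (norm (x - x0))\<^sup>2) *\<^sub>R (g (inversion x0 R x) +
           ((x - x0) \<bullet> g (inversion x0 R x)) *\<^sub>R ((-2 / (norm (x - x0))\<^sup>2) *\<^sub>R (x - x0))))"
      by (intro continuous_intros cgJ) auto
  qed (simp add: V_def)
  moreover have "continuous_on (ball x0 \<delta>) V"
    by (rule continuous_on_eq[of _ "\<lambda>_. 0"]) (use zero in auto)
  ultimately have "continuous_on (- {x0} \<union> ball x0 \<delta>) V"
    by (intro continuous_on_open_Un) auto
  moreover have "- {x0} \<union> ball x0 \<delta> = UNIV" using \<delta> by auto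
  ultimately have cV: "continuous_on UNIV V" by simp
  have "GDERIV U x :> V x" for x
  proof (cases "x = x0")
    case True
    have "(U has_derivative (\<lambda>h. 0)) (at x)"
      by (rule has_derivative_transform_within_open[where f="\<lambda>_. 0" and s="ball x0 \<delta>"])
         (use True \<delta> zero in auto)
    then show ?thesis using True by (simp add: gderiv_def V_def)
  next
    case False
    have 1: "(u has_derivative (\<lambda>h. h \<bullet> g (inversion x0 R x))) (at (inversion x0 R x))"
      using u by (simp add: C1_compact_support_in_def gderiv_def)
    have "((\<lambda>x. u (inversion x0 R x)) has_derivative (\<lambda>h. h \<bullet> V x)) (at x)"
      by (rule has_derivative_eq_rhs[OF has_derivative_compose[OF has_derivative_inversion[OF False] 1]])
         (simp add: fun_eq_iff V_def False inner_add_left inner_add_right inner_commute algebra_simps)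
    then have "(U has_derivative (\<lambda>h. h \<bullet> V x)) (at x)"
      by (rule has_derivative_transform_within_open[where s="- {x0}"]) (use False in \<open>auto simp: U_def\<close>)
    then show ?thesis by (simp add: gderiv_def)
  qed
  then show "C1_gradient U V" using cV by (simp add: C1_gradient_def)
  show "norm (V x) = (R / norm (x - x0))\<^sup>2 * norm (g (inversion x0 R x))" if "x \<noteq> x0"
    using that norm_reflect[of "x - x0" "g (inversion x0 R x)"] by (simp add: V_def power_divide)
qed

text \<open>The Jacobian is \<open>(R / norm (x - x0)) ^ (2 * n)\<close>, the \<open>n\<close>-th power of the factor by which the inversion scales
  gradients: the energy is conformally invariant.\<close>

lemma nn_integral_inversion_le:
  fixes F :: "real^'n \<Rightarrow> real"
  assumes R: "0 < R" and F: "integrable lborel F" "\<And>x. 0 \<le> F x"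
  shows "(\<integral>\<^sup>+x\<in>- {x0}. ennreal ((R / norm (x - x0)) ^ (2 * CARD('n)) * F (inversion x0 R x)) \<partial>lborel)
    \<le> ennreal (integral\<^sup>L lborel F)"
proof -
  let ?c = "\<lambda>x. R\<^sup>2 / (norm (x - x0))\<^sup>2" and ?p = "\<lambda>x. (-2 / (norm (x - x0))\<^sup>2) *\<^sub>R (x - x0)" and ?q = "\<lambda>x. x - x0"
  have [measurable]: "F \<in> borel_measurable borel" using F(1) by auto
  have Jm[measurable]: "inversion x0 R \<in> borel_measurable borel"
    unfolding inversion_def[abs_def] by measurable
  have inj: "inj_on (inversion x0 R) (- {x0})"
    using R by (intro inj_onI) (metis inversion_inversion less_irrefl)
  have "(\<integral>\<^sup>+x\<in>- {x0}. ennreal (\<bar>?c x\<bar> ^ CARD('n) * \<bar>1 + ?p x \<bullet> ?q x\<bar> * F (inversion x0 R x)) \<partial>lborel)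
      \<le> ennreal (integral\<^sup>L lborel F)"
  proof (rule change_of_variables_le[OF _ inj _ F])
    show "(inversion x0 R has_derivative (\<lambda>h. ?c x *\<^sub>R (h + (?p x \<bullet> h) *\<^sub>R ?q x))) (at x)" if "x \<in> - {x0}" for x
      by (rule has_derivative_inversion) (use that in simp)
    have [measurable]: "- {x0} \<in> sets borel" by simp
    show "(\<lambda>x. ennreal (\<bar>?c x\<bar> ^ CARD('n) * \<bar>1 + ?p x \<bullet> ?q x\<bar> * F (inversion x0 R x)) * indicator (- {x0}) x) \<in> borel_measurable borel"
      by measurable
  qed (intro open_Compl closed_singleton)
  also have "(\<integral>\<^sup>+x\<in>- {x0}. ennreal (\<bar>?c x\<bar> ^ CARD('n) * \<bar>1 + ?p x \<bullet> ?q x\<bar> * F (inversion x0 R x)) \<partial>lborel) =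
     (\<integral>\<^sup>+x\<in>- {x0}. ennreal ((R / norm (x - x0)) ^ (2 * CARD('n)) * F (inversion x0 R x)) \<partial>lborel)"
  proof (rule nn_integral_cong)
    fix x :: "real^'n"
    show "ennreal (\<bar>?c x\<bar> ^ CARD('n) * \<bar>1 + ?p x \<bullet> ?q x\<bar> * F (inversion x0 R x)) * indicator (- {x0}) x =
       ennreal ((R / norm (x - x0)) ^ (2 * CARD('n)) * F (inversion x0 R x)) * indicator (- {x0}) x"
    proof (cases "x = x0")
      case False
      then have "1 + ?p x \<bullet> ?q x = -1" by (simp add: power2_norm_eq_inner)
      moreover have "\<bar>?c x\<bar> ^ CARD('n) = (R / norm (x - x0)) ^ (2 * CARD('n))"
        by (simp add: power_mult power_divide)
      ultimately show ?thesis by simp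
    qed simp
  qed
  finally show ?thesis .
qed

text \<open>Let \<open>c\<close> be the shell mean and suppose \<open>c > 0\<close>. As \<open>u\<close> vanishes outside \<open>D\<close>, the function \<open>(c - u) / c\<close>
  is \<open>1\<close> there. Transplanted by the inversion about \<open>x0\<close> and multiplied by a cutoff, it is a competitor
  for the inverted frontier, whose capacity \<open>\<kappa>\<close> is positive. Its energy is at most a constant times \<open>E / c ^ n\<close>: the
  gradient of \<open>u\<close> contributes its conformally invariant energy, and the gradient of the cutoff contributes the deviation of \<open>u\<close>
  from its mean, which the Poincare inequality controls. Hence \<open>\<kappa> * c ^ n\<close> is at most a constant times \<open>E\<close>.\<close>

lemma shell_mean_outer_bound:
  fixes D :: "(real^'n) set"
  assumes D: "open D" "x0 \<in> D" and pos: "positive_capacity (extended_space frontier_of (Some ` D))"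
    and R: "0 < R" "cball x0 R \<subseteq> D" and \<rho>: "0 < \<rho>" "2 * \<rho> \<le> R"
  shows "\<exists>C\<ge>0. \<forall>u g E. C1_compact_support_in D u g \<longrightarrow> 0 \<le> E \<longrightarrow> dirichlet g \<le> ennreal E \<longrightarrow>
     shell_mean (\<lambda>x. u (x0 + x)) \<rho> \<le> C * root CARD('n) E"
proof -
  let ?n = "CARD('n)"
  obtain K where K: "K \<subseteq> ball x0 R" "\<And>x. x \<in> K \<Longrightarrow> x = x0 \<or> inversion x0 R x \<notin> D"
    and cap: "\<And>G. open G \<Longrightarrow> connected G \<Longrightarrow> bounded G \<Longrightarrow> K \<subseteq> G \<Longrightarrow> capacity G K \<noteq> 0"
    using positive_capacity_inverted_boundary[OF D pos R] by blast
  \<comment> \<open>This ratio makes the cutoff equal to \<open>ln (b / R) - 1 = 1\<close> on the ball of radius \<open>R\<close>.\<close>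
  define b where "b = exp 2 * R"
  interpret log_cutoff_radii R b using R by unfold_locales (simp_all add: b_def)
  have M1: "ln (b / R) - 1 = 1" using R by (simp add: b_def)
  have bR: "R \<le> b" by (rule a_le_b)
  let ?G = "ball x0 (b + 1)"
  have KG: "K \<subseteq> ?G" using K(1) bR by auto
  have "capacity ?G K \<noteq> 0" using KG by (intro cap) auto
  then obtain \<kappa> where \<kappa>: "0 < \<kappa>" "ennreal \<kappa> \<le> capacity ?G K"
  proof (cases "capacity ?G K")
    case (real r)
    then show thesis using that[of r] \<open>capacity ?G K \<noteq> 0\<close> by (cases "r = 0") auto
  next
    case top
    then show thesis using that[of 1] by simp
  qed
  define H where "H = 1 / (shell_mass TYPE(real^'n) * \<rho> ^ ?n)"
  define C1 where "C1 = H * ((2 * R) ^ ?n * 2 ^ ?n * (unit_ball_vol (real ?n) * R ^ ?n))"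
  \<comment> \<open>In the annulus \<open>R < norm (x - x0) < b\<close>, which carries the gradient of the cutoff, \<open>b / R\<^sup>2\<close> bounds the quotient of this
    gradient by the scaling factor \<open>(R / norm (x - x0))\<^sup>2\<close> of the inversion.\<close>
  define k0 where "k0 = (b / R\<^sup>2) ^ ?n"
  have H0: "0 \<le> H" using shell_mass_pos[where 'a="real^'n"] \<rho> by (simp add: H_def)
  have C10: "0 \<le> C1" using H0 R by (simp add: C1_def)
  have k00: "0 \<le> k0" using R b_pos by (simp add: k0_def)
  let ?B = "2 ^ ?n * (1 + k0 * C1) / \<kappa>"
  have B0: "0 \<le> ?B" using k00 C10 \<kappa> by simp
  have main: "shell_mean (\<lambda>x. u (x0 + x)) \<rho> \<le> root ?n ?B * root ?n E"
    if u: "C1_compact_support_in D u g" and E: "0 \<le> E" "dirichlet g \<le> ennreal E" for u g E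
  proof (cases "shell_mean (\<lambda>x. u (x0 + x)) \<rho> \<le> 0")
    case True
    then show ?thesis using B0 E by (meson mult_nonneg_nonneg order_trans real_root_ge_zero)
  next
    case False
    define c where "c = shell_mean (\<lambda>x. u (x0 + x)) \<rho>"
    have c: "0 < c" using False by (simp add: c_def)
    have u1: "C1_gradient u g" using u by (rule C1_compact_support_in_C1_gradient)
    have cu: "continuous_on UNIV u" using C1_gradient_continuous[OF u1] .
    have cg: "continuous_on UNIV g" using u1 by (simp add: C1_gradient_def)
    have [measurable]: "u \<in> borel_measurable borel" "g \<in> borel_measurable borel"
      using cu cg by (auto intro: borel_measurable_continuous_onI)
    obtain U0 where U0: "\<And>x. \<bar>u x\<bar> \<le> U0" using C1_compact_support_bounded[OF u] by blast
    have dev: "(\<integral>\<^sup>+y\<in>ball x0 R. ennreal (\<bar>c - u y\<bar> ^ ?n) \<partial>lborel) \<le> ennreal (C1 * E)"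
    proof -
      have bm: "ball 0 R \<in> sets borel" by simp
      note [measurable] = bm
      have "(\<integral>\<^sup>+y\<in>ball x0 R. ennreal (\<bar>c - u y\<bar> ^ ?n) \<partial>lborel) = (\<integral>\<^sup>+y. ennreal (\<bar>c - u (x0 + y)\<bar> ^ ?n) * indicator (ball x0 R) (x0 + y) \<partial>lborel)"
        by (rule nn_integral_translate[symmetric]) (intro borel_measurable_times_ennreal borel_measurable_indicator; simp)
      also have "\<dots> = (\<integral>\<^sup>+y\<in>ball 0 R. ennreal (\<bar>c - u (x0 + y)\<bar> ^ ?n) \<partial>lborel)"
        by (intro nn_integral_cong) (simp add: indicator_def dist_norm)
      also have "\<dots> \<le> ennreal C1 * (\<integral>\<^sup>+z\<in>ball 0 R. ennreal (norm (g (x0 + z)) ^ ?n) \<partial>lborel)"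
      proof -
        have "{z::real^'n. \<rho> \<le> norm z \<and> norm z < 2 * \<rho>} \<subseteq> ball 0 R" using \<rho> by (auto simp: dist_norm)
        from dominated_probability_shell[OF \<rho>(1) this]
        have dom: "dominated_probability (shell_measure \<rho> :: (real^'n) measure) H (ball 0 R)"
          by (simp add: H_def)
        show ?thesis
          using deviation_from_mean[OF C1_gradient_translate[OF u1, of x0] U0 dom R(1), of ?n]
          by (simp add: c_def shell_mean_def C1_def)
      qed
      also have "\<dots> \<le> ennreal C1 * (\<integral>\<^sup>+z. ennreal (norm (g (x0 + z)) ^ ?n) \<partial>lborel)"
        by (intro mult_left_mono nn_integral_mono) (auto simp: indicator_def)
      also have "(\<integral>\<^sup>+z. ennreal (norm (g (x0 + z)) ^ ?n) \<partial>lborel) = dirichlet g"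
        by (rule nn_integral_translate[of "\<lambda>z. ennreal (norm (g z) ^ ?n)"]) simp
      also have "ennreal C1 * dirichlet g \<le> ennreal C1 * ennreal E" by (intro mult_left_mono E) simp
      also have "\<dots> = ennreal (C1 * E)" using C10 E by (simp add: ennreal_mult)
      finally show ?thesis .
    qed
    define F1 where "F1 y = indicator (ball x0 R) y * \<bar>c - u y\<bar> ^ ?n" for y
    have F1m[measurable]: "F1 \<in> borel_measurable borel"
      unfolding F1_def[abs_def] by (intro borel_measurable_times borel_measurable_indicator; simp)
    have F10: "0 \<le> F1 y" for y by (simp add: F1_def)
    have nnF1: "(\<integral>\<^sup>+y. ennreal (F1 y) \<partial>lborel) \<le> ennreal (C1 * E)"
    proof -
      have "(\<integral>\<^sup>+y. ennreal (F1 y) \<partial>lborel) = (\<integral>\<^sup>+y\<in>ball x0 R. ennreal (\<bar>c - u y\<bar> ^ ?n) \<partial>lborel)"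
        by (intro nn_integral_cong) (simp add: F1_def indicator_def)
      then show ?thesis using dev by simp
    qed
    have intF1: "integrable lborel F1"
      by (rule integrableI_nonneg) (use F10 nnF1 in \<open>auto intro: le_less_trans\<close>)
    have I1: "integral\<^sup>L lborel F1 \<le> C1 * E"
      using nnF1 nn_integral_eq_integral[OF intF1] F10 C10 E by (simp add: ennreal_le_iff)
    \<comment> \<open>Up to the factor \<open>(2 / c) ^ n\<close>, a bound for the energy density of the competitor \<open>w\<close> below, in the coordinates of \<open>u\<close>.\<close>
    define F where "F y = norm (g y) ^ ?n + k0 * F1 y" for y
    have intF: "integrable lborel F"
      unfolding F_def[abs_def] using integrable_gradient_power[OF u] intF1 by simp
    have F0: "0 \<le> F y" for y using F10 k00 by (simp add: F_def)
    have IF: "integral\<^sup>L lborel F \<le> (1 + k0 * C1) * E"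
    proof -
      have "integral\<^sup>L lborel F = (\<integral>y. norm (g y) ^ ?n \<partial>lborel) + k0 * integral\<^sup>L lborel F1"
        unfolding F_def[abs_def] using integrable_gradient_power[OF u] intF1 by simp
      also have "\<dots> \<le> E + k0 * (C1 * E)"
        using E dirichlet_eq_integral[OF u] I1 k00
        by (intro add_mono mult_left_mono) (simp_all add: ennreal_le_iff)
      finally show ?thesis by (simp add: algebra_simps)
    qed
    define U where "U x = (if x = x0 then 0 else u (inversion x0 R x))" for x
    define V where "V x = (if x = x0 then 0 else (R\<^sup>2 / (norm (x - x0))\<^sup>2) *\<^sub>R (g (inversion x0 R x) +
           ((x - x0) \<bullet> g (inversion x0 R x)) *\<^sub>R ((-2 / (norm (x - x0))\<^sup>2) *\<^sub>R (x - x0))))" for x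
    have UV: "C1_gradient U V"
      unfolding U_def[abs_def] V_def[abs_def] by (rule inverted_competitor(1)[OF u R(1)])
    have nV: "norm (V x) = (R / norm (x - x0))\<^sup>2 * norm (g (inversion x0 R x))" if "x \<noteq> x0" for x
      unfolding V_def by (rule inverted_competitor(2)[OF u R(1) that])
    define Q where "Q x = log_cutoff R b (x - x0)" for x
    define QG where "QG x = log_cutoff_gradient R b (x - x0)" for x
    have QC: "C1_gradient Q QG"
    proof -
      have "C1_gradient (\<lambda>x. log_cutoff R b (- x0 + x)) (\<lambda>x. log_cutoff_gradient R b (- x0 + x))"
        by (rule C1_gradient_translate[OF log_cutoff_C1])
      then show ?thesis unfolding Q_def[abs_def] QG_def[abs_def] by simp
    qed
    define w where "w x = Q x * (c - U x) / c" for x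
    define W where "W x = (1 / c) *\<^sub>R (Q x *\<^sub>R (- V x) + (c - U x) *\<^sub>R QG x)" for x
    have cQ: "continuous_on UNIV Q" "continuous_on UNIV QG" "continuous_on UNIV U" "continuous_on UNIV V"
      using QC UV C1_gradient_continuous[OF QC] C1_gradient_continuous[OF UV] by (auto simp: C1_gradient_def)
    have gw: "GDERIV w x :> W x" for x
    proof -
      have 1: "GDERIV (\<lambda>x. c - U x) x :> 0 - V x"
        using UV by (intro GDERIV_diff GDERIV_const) (simp add: C1_gradient_def)
      have "GDERIV (\<lambda>x. Q x * (c - U x)) x :> Q x *\<^sub>R (0 - V x) + (c - U x) *\<^sub>R QG x"
        using QC by (intro GDERIV_mult 1) (simp add: C1_gradient_def)
      then have "((\<lambda>x. Q x * (c - U x)) has_derivative (\<lambda>h. h \<bullet> (Q x *\<^sub>R (0 - V x) + (c - U x) *\<^sub>R QG x))) (at x)"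
        by (simp only: gderiv_def)
      from has_derivative_mult_right[OF this, of "1 / c"]
      have "((\<lambda>x. 1 / c * (Q x * (c - U x))) has_derivative (\<lambda>h. h \<bullet> W x)) (at x)"
        by (simp add: W_def)
      moreover have "w = (\<lambda>x. 1 / c * (Q x * (c - U x)))" by (simp add: fun_eq_iff w_def)
      ultimately show ?thesis by (simp only: gderiv_def)
    qed
    have cW: "continuous_on UNIV W" unfolding W_def[abs_def] by (intro continuous_intros cQ)
    have "support_on UNIV w \<subseteq> cball x0 b"
    proof
      fix x assume "x \<in> support_on UNIV w"
      then have "log_cutoff R b (x - x0) \<noteq> 0" by (auto simp: support_on_def w_def Q_def)
      then have "norm (x - x0) < b" using log_cutoff_outer[of "x - x0"] by (meson not_le)
      then show "x \<in> cball x0 b" by (simp add: dist_norm norm_minus_commute)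
    qed
    then have sup: "compact (closure (support_on UNIV w)) \<and> closure (support_on UNIV w) \<subseteq> ?G"
      by (rule closure_support_in_compact[OF _ compact_cball]) auto
    have w1: "1 \<le> w x" if "x \<in> K" for x
    proof -
      have "norm (x - x0) \<le> R" using that K(1) by (auto simp: dist_norm norm_minus_commute subset_iff less_imp_le)
      then have Q1: "Q x = 1" using log_cutoff_inner[of "x - x0"] M1 by (simp add: Q_def)
      have "U x = 0" using K(2)[OF that] zero_outside_domain(1)[OF u, of "inversion x0 R x"] by (auto simp: U_def)
      then show ?thesis using Q1 c by (simp add: w_def)
    qed
    have ad: "admissible ?G K w W"
      unfolding admissible_def C1_compact_support_in_def using gw cW sup w1 by blast
    have pt: "norm (W x) ^ ?n \<le> (2 / c) ^ ?n * ((R / norm (x - x0)) ^ (2 * ?n) * F (inversion x0 R x))" if x: "x \<noteq> x0" for x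
    proof -
      let ?J = "inversion x0 R x" and ?r = "norm (x - x0)"
      have r: "0 < ?r" using x by simp
      have Qb: "0 \<le> Q x" "Q x \<le> 1" using log_cutoff_nonneg_le[of "x - x0"] M1 by (simp_all add: Q_def)
      have Ux: "U x = u ?J" using x by (simp add: U_def)
      have "norm (W x) \<le> 1 / c * (norm (Q x *\<^sub>R (- V x)) + norm ((c - U x) *\<^sub>R QG x))"
        unfolding W_def using c norm_triangle_ineq[of "Q x *\<^sub>R (- V x)" "(c - U x) *\<^sub>R QG x"]
        by (simp add: divide_right_mono)
      also have "norm (Q x *\<^sub>R (- V x)) \<le> norm (V x)" using Qb by (simp add: mult_left_le_one_le)
      finally have "norm (W x) \<le> 1 / c * (norm (V x) + \<bar>c - U x\<bar> * norm (QG x))" using c by (simp add: divide_right_mono)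
      then have "norm (W x) ^ ?n \<le> (1 / c * (norm (V x) + \<bar>c - U x\<bar> * norm (QG x))) ^ ?n"
        by (intro power_mono) auto
      also have "\<dots> \<le> (1 / c) ^ ?n * (2 ^ ?n * (norm (V x) ^ ?n + (\<bar>c - U x\<bar> * norm (QG x)) ^ ?n))"
        unfolding power_mult_distrib[of "1 / c"] using c by (intro mult_left_mono sum_power_le) auto
      also have "\<dots> = (2 / c) ^ ?n * (norm (V x) ^ ?n + (\<bar>c - U x\<bar> * norm (QG x)) ^ ?n)"
        by (simp add: power_divide)
      also have "\<dots> \<le> (2 / c) ^ ?n * ((R / ?r) ^ (2 * ?n) * F ?J)"
      proof (rule mult_left_mono)
        have a: "norm (V x) ^ ?n = (R / ?r) ^ (2 * ?n) * norm (g ?J) ^ ?n"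
          unfolding nV[OF x] by (simp add: power_mult_distrib power_mult)
        have "(\<bar>c - U x\<bar> * norm (QG x)) ^ ?n \<le> (R / ?r) ^ (2 * ?n) * (k0 * F1 ?J)"
        proof (cases "?r \<le> R \<or> b \<le> ?r")
          case True
          then have "QG x = 0"
            using log_cutoff_slope_inner[of "x - x0"] log_cutoff_slope_outer[of "x - x0"]
            by (auto simp: QG_def log_cutoff_gradient_def)
          then show ?thesis using k00 F10 R by (simp add: power_0_left)
        next
          case False
          have "norm (?J - x0) < R"
            unfolding norm_inversion using False R r by (simp add: power2_eq_square divide_less_eq)
          then have F1J: "F1 ?J = \<bar>c - u ?J\<bar> ^ ?n" by (simp add: F1_def dist_norm norm_minus_commute)
          have "norm (QG x) \<le> 1 / ?r"
            using norm_log_cutoff_gradient_le(2)[of "x - x0"] x by (simp add: QG_def)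
          also have "\<dots> \<le> (R / ?r)\<^sup>2 * (b / R\<^sup>2)"
            using False r R by (simp add: power2_eq_square field_simps)
          finally have "norm (QG x) ^ ?n \<le> ((R / ?r)\<^sup>2 * (b / R\<^sup>2)) ^ ?n" by (intro power_mono) auto
          then have "\<bar>c - U x\<bar> ^ ?n * norm (QG x) ^ ?n \<le> \<bar>c - U x\<bar> ^ ?n * ((R / ?r) ^ (2 * ?n) * k0)"
            unfolding k0_def power_mult power_mult_distrib[symmetric, of "(R / ?r)\<^sup>2"] by (intro mult_left_mono) auto
          then show ?thesis unfolding F1J Ux by (simp add: power_mult_distrib mult_ac)
        qed
        then show "norm (V x) ^ ?n + (\<bar>c - U x\<bar> * norm (QG x)) ^ ?n \<le> (R / ?r) ^ (2 * ?n) * F ?J"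
          unfolding a F_def by (simp add: distrib_left)
      qed (use c in simp)
      finally show ?thesis .
    qed
    have Wm[measurable]: "W \<in> borel_measurable borel" using cW by (rule borel_measurable_continuous_onI)
    have AE0: "AE x in lborel. x \<noteq> x0" by (rule AE_lborel_singleton)
    have Jm[measurable]: "inversion x0 R \<in> borel_measurable borel"
      unfolding inversion_def[abs_def] by measurable
    have Fm[measurable]: "F \<in> borel_measurable borel" unfolding F_def[abs_def] by measurable
    have "capacity ?G K \<le> dirichlet W" by (rule capacity_le_dirichlet[OF ad])
    also have "\<dots> \<le> (\<integral>\<^sup>+x. ennreal ((2 / c) ^ ?n) * (ennreal ((R / norm (x - x0)) ^ (2 * ?n) * F (inversion x0 R x)) * indicator (- {x0}) x) \<partial>lborel)"
    proof (rule nn_integral_mono_AE)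
      show "AE x in lborel. ennreal (norm (W x) ^ ?n) \<le>
         ennreal ((2 / c) ^ ?n) * (ennreal ((R / norm (x - x0)) ^ (2 * ?n) * F (inversion x0 R x)) * indicator (- {x0}) x)"
        using AE0
      proof eventually_elim
        case (elim x)
        have "ennreal (norm (W x) ^ ?n) \<le> ennreal ((2 / c) ^ ?n * ((R / norm (x - x0)) ^ (2 * ?n) * F (inversion x0 R x)))"
          by (rule ennreal_leI[OF pt[OF elim]])
        also have "\<dots> = ennreal ((2 / c) ^ ?n) * ennreal ((R / norm (x - x0)) ^ (2 * ?n) * F (inversion x0 R x))"
          using c F0 R by (intro ennreal_mult) auto
        finally show ?case using elim by simp
      qed
    qed
    also have "\<dots> = ennreal ((2 / c) ^ ?n) * (\<integral>\<^sup>+x\<in>- {x0}. ennreal ((R / norm (x - x0)) ^ (2 * ?n) * F (inversion x0 R x)) \<partial>lborel)"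
      by (rule nn_integral_cmult) measurable
    also have "\<dots> \<le> ennreal ((2 / c) ^ ?n) * ennreal (integral\<^sup>L lborel F)"
      by (intro mult_left_mono nn_integral_inversion_le R intF F0) simp
    also have "\<dots> \<le> ennreal ((2 / c) ^ ?n) * ennreal ((1 + k0 * C1) * E)"
      by (intro mult_left_mono ennreal_leI IF) simp
    also have "\<dots> = ennreal ((2 / c) ^ ?n * ((1 + k0 * C1) * E))"
      using c k00 C10 E by (intro ennreal_mult[symmetric]) auto
    finally have "ennreal \<kappa> \<le> ennreal ((2 / c) ^ ?n * ((1 + k0 * C1) * E))" using \<kappa>(2) by (rule order_trans[rotated])
    then have "\<kappa> \<le> (2 / c) ^ ?n * ((1 + k0 * C1) * E)"
      using c k00 C10 E by (subst (asm) ennreal_le_iff) auto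
    then have "\<kappa> * c ^ ?n \<le> 2 ^ ?n * ((1 + k0 * C1) * E)"
      using c by (simp add: power_divide pos_le_divide_eq)
    then have "c ^ ?n \<le> ?B * E" using \<kappa>(1) by (simp add: field_simps)
    then have "root ?n (c ^ ?n) \<le> root ?n (?B * E)" by simp
    moreover have "root ?n (c ^ ?n) = c" using c by (simp add: real_root_power_cancel)
    ultimately show ?thesis unfolding c_def[symmetric] by (simp only: real_root_mult)
  qed
  then show ?thesis using B0 by (intro exI[of _ "root ?n ?B"]) auto
qed

section \<open>Lower bounds for the energy\<close>

text \<open>The mean of \<open>u\<close> over the shell of radius \<open>exp 2 * s\<close> is almost at least \<open>1\<close>, the mean over the shell of
  radius \<open>R / (2 * exp 1)\<close> is almost at most \<open>0\<close>, and the sharp radial estimate bounds the difference. The two radii are those for which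
  the annulus in between is the one where the radial compression with \<open>a = s\<close> and \<open>b = R\<close> gains
  energy.\<close>

lemma radial_energy_lower_bound:
  fixes D :: "(real^'n) set"
  assumes D: "open D" "x0 \<in> D" and pos: "positive_capacity (extended_space frontier_of (Some ` D))"
    and R: "0 < R" "cball x0 R \<subseteq> D"
  shows "\<exists>C\<ge>0. \<forall>s K y u g E. 0 < s \<longrightarrow> 2 * exp 3 * s \<le> R \<longrightarrow> connected K \<longrightarrow> x0 \<in> K \<longrightarrow> y \<in> K \<longrightarrow> s \<le> norm (y - x0) \<longrightarrow>
    admissible D K u g \<longrightarrow> 0 < E \<longrightarrow> dirichlet g \<le> ennreal E \<longrightarrow> C * root CARD('n) E \<le> 1 \<longrightarrow>
    (1 - C * root CARD('n) E) ^ CARD('n) \<le> ln (R / s) ^ (CARD('n) - 1) * (ln 2 / shell_mass TYPE(real^'n)) *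
      (\<integral>z. radial_density x0 (exp 2 * s) (R / exp 1) g z \<partial>lborel)"
proof -
  let ?n = "CARD('n)" and ?w = "shell_mass TYPE(real^'n)"
  let ?b = "R / (2 * exp 1)"
  have b: "0 < ?b" using R by simp
  have e1: "(1::real) \<le> exp 1" by simp
  have b2: "2 * ?b \<le> R" using R e1 by (simp add: pos_divide_le_eq)
  have dim: "DIM(real^'n) = CARD('n)" by simp
  have "(1::real) \<le> exp 2" by simp
  from shell_mean_near_continuum[OF this, where 'a="real^'n", unfolded dim]
  obtain C1 where C1: "C1 \<ge> 0" and inner0:
    "\<forall>(u :: real^'n \<Rightarrow> real) g U K y s E. C1_gradient u g \<longrightarrow> (\<forall>x. \<bar>u x\<bar> \<le> U) \<longrightarrow> connected K \<longrightarrow> 0 \<in> K \<longrightarrow> y \<in> K \<longrightarrow> 0 < s \<longrightarrow> s \<le> norm y \<longrightarrow>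
     (\<forall>x\<in>K. 1 \<le> u x) \<longrightarrow> 0 < E \<longrightarrow> dirichlet g \<le> ennreal E \<longrightarrow> 1 - C1 * root ?n E \<le> shell_mean u (exp 2 * s)"
    by blast
  note inner = inner0[rule_format]
  obtain C2 where C2: "C2 \<ge> 0" and outer:
    "\<And>u g E. C1_compact_support_in D u g \<Longrightarrow> 0 \<le> E \<Longrightarrow> dirichlet g \<le> ennreal E \<Longrightarrow>
     shell_mean (\<lambda>x. u (x0 + x)) ?b \<le> C2 * root ?n E"
    using shell_mean_outer_bound[OF D pos R b b2] by blast
  have main: "(1 - (C1 + C2) * root ?n E) ^ ?n \<le> ln (R / s) ^ (?n - 1) * (ln 2 / ?w) *
      (\<integral>z. radial_density x0 (exp 2 * s) (R / exp 1) g z \<partial>lborel)"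
    if s: "0 < s" "2 * exp 3 * s \<le> R" and K: "connected K" "x0 \<in> K" "y \<in> K" "s \<le> norm (y - x0)"
      and ad: "admissible D K u g" and E: "0 < E" "dirichlet g \<le> ennreal E" "(C1 + C2) * root ?n E \<le> 1"
    for s K y u g E
  proof -
    have u: "C1_compact_support_in D u g" and u1: "\<And>x. x \<in> K \<Longrightarrow> 1 \<le> u x" using ad by (auto simp: admissible_def)
    have cg: "continuous_on UNIV g" using u by (simp add: C1_compact_support_in_def)
    have [measurable]: "g \<in> borel_measurable borel" using cg by (rule borel_measurable_continuous_onI)
    obtain U where U: "\<And>x. \<bar>u x\<bar> \<le> U" using C1_compact_support_bounded[OF u] by blast
    let ?v = "\<lambda>x. u (x0 + x)" and ?h = "\<lambda>x. g (x0 + x)"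
    have v: "C1_gradient ?v ?h" by (rule C1_gradient_translate[OF C1_compact_support_in_C1_gradient[OF u]])
    let ?a = "exp 2 * s"
    let ?I = "\<integral>z. radial_density x0 (?a) (R / exp 1) g z \<partial>lborel"
    have "exp 3 = exp 2 * exp (1::real)" by (simp add: exp_add[symmetric])
    then have ab: "?a \<le> ?b" using s R by (simp add: pos_le_divide_eq mult_ac)
    have a: "0 < ?a" using s by simp
    have ln0: "0 \<le> ln (?b / ?a)" using ab a by (intro ln_ge_zero) (simp only: pos_le_divide_eq mult_1_left)
    have w0: "0 \<le> ln 2 / ?w" using shell_mass_pos[where 'a="real^'n"] by simp
    have c0: "0 \<le> ln (?b / ?a) ^ (?n - 1) * (ln 2 / ?w)"
      by (intro mult_nonneg_nonneg zero_le_power ln0 w0)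
    have I0: "0 \<le> ?I" by (rule Bochner_Integration.integral_nonneg) simp
    have "1 - C1 * root ?n E \<le> shell_mean ?v ?a"
    proof (rule inner[OF v, of U "(\<lambda>x. x - x0) ` K" "y - x0" s E])
      show "connected ((\<lambda>x. x - x0) ` K)" by (intro connected_continuous_image K continuous_intros)
      show "0 \<in> (\<lambda>x. x - x0) ` K" using K(2) by (auto intro: rev_image_eqI)
      show "dirichlet ?h \<le> ennreal E"
        using E(2) nn_integral_translate[of "\<lambda>x. ennreal (norm (g x) ^ ?n)" x0] by simp
    qed (use U K s u1 E in auto)
    moreover have "shell_mean ?v ?b \<le> C2 * root ?n E" using E by (intro outer[OF u]) auto
    ultimately have "1 - (C1 + C2) * root ?n E \<le> shell_mean ?v ?a - shell_mean ?v ?b" by (simp add: algebra_simps)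
    then have "(1 - (C1 + C2) * root ?n E) ^ ?n \<le> \<bar>shell_mean ?v ?a - shell_mean ?v ?b\<bar> ^ ?n"
      using E(3) by (intro power_mono) auto
    then have "ennreal ((1 - (C1 + C2) * root ?n E) ^ ?n) \<le> ennreal (\<bar>shell_mean ?v ?a - shell_mean ?v ?b\<bar> ^ ?n)"
      by (rule ennreal_leI)
    also have "\<dots> \<le> ennreal (ln (?b / ?a) ^ (?n - 1) * (ln 2 / ?w)) *
       (\<integral>\<^sup>+z\<in>{z. ?a \<le> norm z \<and> norm z < 2 * ?b}. ennreal (\<bar>sgn z \<bullet> ?h z\<bar> ^ ?n) \<partial>lborel)"
      using shell_mean_radial_increment[OF v U a ab] by simp
    also have "(\<integral>\<^sup>+z\<in>{z. ?a \<le> norm z \<and> norm z < 2 * ?b}. ennreal (\<bar>sgn z \<bullet> ?h z\<bar> ^ ?n) \<partial>lborel) =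
       (\<integral>\<^sup>+z. ennreal (\<bar>sgn ((x0 + z) - x0) \<bullet> g (x0 + z)\<bar> ^ ?n) *
          indicator {z. ?a \<le> norm (z - x0) \<and> norm (z - x0) < R / exp 1} (x0 + z) \<partial>lborel)"
      by (intro nn_integral_cong) (simp add: indicator_def)
    also have "\<dots> = (\<integral>\<^sup>+z. ennreal (\<bar>sgn (z - x0) \<bullet> g z\<bar> ^ ?n) *
          indicator {z. ?a \<le> norm (z - x0) \<and> norm (z - x0) < R / exp 1} z \<partial>lborel)"
      by (rule nn_integral_translate) measurable
    also have "\<dots> = (\<integral>\<^sup>+z. ennreal (radial_density x0 (?a) (R / exp 1) g z) \<partial>lborel)"
      by (intro nn_integral_cong) (simp add: indicator_def)
    also have "\<dots> = ennreal ?I"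
      by (rule nn_integral_eq_integral[OF integrable_radial_density[OF u]]) (rule AE_I2, simp)
    also have "ennreal (ln (?b / ?a) ^ (?n - 1) * (ln 2 / ?w)) * ennreal ?I = ennreal (ln (?b / ?a) ^ (?n - 1) * (ln 2 / ?w) * ?I)"
      by (rule ennreal_mult[OF c0 I0, symmetric])
    finally have "(1 - (C1 + C2) * root ?n E) ^ ?n \<le> ln (?b / ?a) ^ (?n - 1) * (ln 2 / ?w) * ?I"
      unfolding ennreal_le_iff[OF mult_nonneg_nonneg[OF c0 I0]] .
    also have "\<dots> \<le> ln (R / s) ^ (?n - 1) * (ln 2 / ?w) * ?I"
    proof (intro mult_right_mono power_mono)
      have "?b / ?a \<le> R / s"
      proof (rule frac_le)
        show "?b \<le> R" using b2 b by linarith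
        show "s \<le> ?a" using mult_right_mono[of 1 "exp 2" s] s by simp
      qed (use R s in auto)
      then show "ln (?b / ?a) \<le> ln (R / s)" using R s a b by (subst ln_le_cancel_iff) auto
    qed (rule ln0 w0 I0)+
    finally show ?thesis .
  qed
  show ?thesis
    using C1 C2 main by (intro exI[of _ "C1 + C2"]) auto
qed

text \<open>By the preceding lemma, the energy of a competitor cannot be arbitrarily small.\<close>

lemma modulus_metric_far_lower_bound:
  fixes D :: "(real^'n) set"
  assumes D: "open D" "x0 \<in> D" and pos: "positive_capacity (extended_space frontier_of (Some ` D))"
    and R: "0 < R" "cball x0 R \<subseteq> D" and s: "0 < s" "2 * exp 3 * s \<le> R"
  shows "\<exists>m0>0. \<forall>y. s \<le> norm (y - x0) \<longrightarrow> ennreal m0 \<le> modulus_metric D x0 y"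
proof -
  let ?n = "CARD('n)" and ?w = "shell_mass TYPE(real^'n)"
  obtain C where C: "C \<ge> 0" and low: "\<And>K y u g E. connected K \<Longrightarrow> x0 \<in> K \<Longrightarrow> y \<in> K \<Longrightarrow> s \<le> norm (y - x0) \<Longrightarrow>
    admissible D K u g \<Longrightarrow> 0 < E \<Longrightarrow> dirichlet g \<le> ennreal E \<Longrightarrow> C * root ?n E \<le> 1 \<Longrightarrow>
    (1 - C * root ?n E) ^ ?n \<le> ln (R / s) ^ (?n - 1) * (ln 2 / ?w) *
      (\<integral>z. radial_density x0 (exp 2 * s) (R / exp 1) g z \<partial>lborel)"
    using radial_energy_lower_bound[OF D pos R] s by blast
  define L where "L = ln (R / s) ^ (?n - 1) * (ln 2 / ?w)"
  have "(1::real) \<le> exp 3" by simp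
  then have "(1::real) \<le> 2 * exp 3" by linarith
  then have "1 * s \<le> 2 * exp 3 * s" using s by (intro mult_right_mono) auto
  then have "s \<le> R" using s by linarith
  then have L0: "0 \<le> L" using s R shell_mass_pos[where 'a="real^'n"] by (auto simp: L_def intro!: mult_nonneg_nonneg)
  \<comment> \<open>For \<open>E = m0\<close> the first term makes the left-hand side of \<open>low\<close> at least \<open>(1/2) ^ n\<close>, and the second makes the right-hand
    side smaller than that.\<close>
  define m0 where "m0 = min ((1 / (2 * (C + 1))) ^ ?n) ((1/2) ^ ?n / (2 * (L + 1)))"
  have m0: "0 < m0" using C L0 by (simp add: m0_def)
  have "root ?n m0 \<le> root ?n ((1 / (2 * (C + 1))) ^ ?n)" by (simp add: m0_def)
  also have "\<dots> = 1 / (2 * (C + 1))" using C by (simp add: real_root_power_cancel)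
  finally have "C * root ?n m0 \<le> C * (1 / (2 * (C + 1)))" using C by (intro mult_left_mono) auto
  also have "\<dots> \<le> 1 / 2" using C by (simp add: field_simps)
  finally have Cm: "C * root ?n m0 \<le> 1/2" .
  have "ennreal m0 \<le> modulus_metric D x0 y" if y: "s \<le> norm (y - x0)" for y
  proof (rule ccontr)
    assume "\<not> ?thesis"
    then have "modulus_metric D x0 y < ennreal m0" by simp
    moreover have "x0 \<noteq> y" using y s by auto
    ultimately obtain \<gamma> u g where \<gamma>: "arc \<gamma>" "pathstart \<gamma> = x0" "pathfinish \<gamma> = y"
      and ad: "admissible D (path_image \<gamma>) u g" and lt: "dirichlet g < ennreal m0"
      using modulus_metric_less_competitor[OF D(1)] by metis
    have u: "C1_compact_support_in D u g" using ad by (simp add: admissible_def)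
    let ?I = "\<integral>z. radial_density x0 (exp 2 * s) (R / exp 1) g z \<partial>lborel"
    have "(1 - C * root ?n m0) ^ ?n \<le> L * ?I"
      unfolding L_def
      by (rule low[OF _ _ _ y ad m0])
         (use \<gamma> lt Cm in \<open>auto simp: connected_arc_image intro: less_imp_le\<close>)
    also have "\<dots> \<le> L * m0"
    proof (rule mult_left_mono[OF _ L0])
      have "?I \<le> (\<integral>z. norm (g z) ^ ?n \<partial>lborel)"
        by (intro integral_mono integrable_radial_density[OF u] radial_density_le integrable_gradient_power[OF u])
      also have "\<dots> \<le> m0" using lt m0 dirichlet_eq_integral[OF u] by (simp add: ennreal_less_iff)
      finally show "?I \<le> m0" .
    qed
    also have "\<dots> \<le> L * ((1/2) ^ ?n / (2 * (L + 1)))" using L0 by (intro mult_left_mono) (auto simp: m0_def)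
    also have "\<dots> = (1/2) ^ ?n * (L / (2 * (L + 1)))" by simp
    also have "\<dots> < (1/2) ^ ?n * 1" using L0 by (intro mult_strict_left_mono) (auto simp: divide_less_eq)
    also have "\<dots> \<le> (1 - C * root ?n m0) ^ ?n" using Cm by (simp only: mult_1_right) (intro power_mono; simp)
    finally show False by simp
  qed
  then show ?thesis using m0 by blast
qed

section \<open>Contraction along rays\<close>

text \<open>The bound of \<open>modulus_metric_le_log\<close> in terms of \<open>L = ln (b / a)\<close>.\<close>

definition log_upper :: "'n::finite itself \<Rightarrow> real \<Rightarrow> real" where
  "log_upper _ L = shell_mass TYPE(real^'n) * (L / ln 2 + 1) / (L - 1) ^ CARD('n)"

text \<open>In the variable \<open>h = 1 / (L - 1)\<close> the bound is continuous at \<open>h = 0\<close>, which reduces limits for \<open>L\<close> tending to infinity to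
  continuity.\<close>

lemma log_upper_reciprocal:
  assumes "1 < L" "2 \<le> CARD('n)"
  defines "h \<equiv> 1 / (L - 1)"
  shows "log_upper TYPE('n::finite) L = shell_mass TYPE(real^'n) * h ^ (CARD('n) - 1) * ((1 + h) / ln 2 + h)"
proof -
  obtain k where k: "CARD('n) = Suc k" using assms(2) by (cases "CARD('n)") auto
  have L: "L - 1 = 1 / h" "L = 1 / h + 1" "h \<noteq> 0" using assms(1) by (auto simp: h_def)
  have eq: "(L / ln 2 + 1) / (L - 1) ^ Suc k = h ^ k * ((1 + h) / ln 2 + h)"
    unfolding L(1) unfolding L(2) using L(3) by (simp add: power_divide field_simps)
  have "log_upper TYPE('n) L = shell_mass TYPE(real^'n) * ((L / ln 2 + 1) / (L - 1) ^ Suc k)"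
    unfolding log_upper_def k by (simp only: times_divide_eq_right)
  then show ?thesis unfolding eq by (simp only: k diff_Suc_1 mult.assoc)
qed

text \<open>The upper bound for the energy and the lower bound for the radial energy are both asymptotic to
  \<open>shell_mass / (ln 2 * L ^ (n - 1))\<close>. The factor \<open>33/32\<close> leaves room for competitors that are not quite minimal,
  and \<open>99/128 = 3/4 * 33/32\<close>: such competitors have at least three quarters of their energy in the radial direction.\<close>

lemma eventually_energy_ratio:
  fixes C :: real
  assumes n: "2 \<le> CARD('n::finite)"
  shows "\<exists>L0>1. \<forall>L\<ge>L0. C * root CARD('n) (33/32 * log_upper TYPE('n) L) \<le> 1 \<and>
    99/128 * log_upper TYPE('n) L \<le>
      (1 - C * root CARD('n) (33/32 * log_upper TYPE('n) L)) ^ CARD('n) * (shell_mass TYPE(real^'n) / (ln 2 * L ^ (CARD('n) - 1)))"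
proof -
  let ?n = "CARD('n)" and ?w = "shell_mass TYPE(real^'n)"
  have w: "?w > 0" by (rule shell_mass_pos)
  define up where "up h = ?w * h ^ (?n - 1) * ((1 + h) / ln 2 + h)" for h :: real
  define A where "A h = 1 - C * root ?n (33/32 * up h)" for h
  define B where "B h = A h ^ ?n / ln 2 - 99/128 * ((1 + h) / ln 2 + h) * (1 + h) ^ (?n - 1)" for h :: real
  have up0: "up 0 = 0" using n by (simp add: up_def)
  have cA: "isCont A 0" unfolding A_def[abs_def] up_def[abs_def] by (intro continuous_intros) auto
  have cB: "isCont B 0" unfolding B_def[abs_def] by (intro continuous_intros cA) auto
  have A0: "A 0 = 1" by (simp add: A_def up0)
  have B0: "B 0 = 29/128 / ln 2" by (simp add: B_def A0 field_simps)
  have "eventually (\<lambda>h. A h > 0) (nhds 0)"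
  proof -
    have "(A \<longlongrightarrow> A 0) (nhds 0)" using cA by (simp add: isCont_def tendsto_at_iff_tendsto_nhds)
    then show ?thesis by (rule order_tendstoD(1)) (simp add: A0)
  qed
  moreover have "eventually (\<lambda>h. B h > 0) (nhds 0)"
  proof -
    have "(B \<longlongrightarrow> B 0) (nhds 0)" using cB by (simp add: isCont_def tendsto_at_iff_tendsto_nhds)
    then show ?thesis by (rule order_tendstoD(1)) (simp add: B0)
  qed
  ultimately have "eventually (\<lambda>h. A h > 0 \<and> B h > 0) (nhds 0)" by (rule eventually_conj)
  then obtain d where d: "d > 0" "\<And>h. dist h 0 < d \<Longrightarrow> A h > 0 \<and> B h > 0"
    by (auto simp: eventually_nhds_metric)
  define L0 where "L0 = 2 + 1 / d"
  have L0: "L0 > 1" using d(1) by (simp add: L0_def add_pos_pos)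
  have "C * root ?n (33/32 * log_upper TYPE('n) L) \<le> 1 \<and>
    99/128 * log_upper TYPE('n) L \<le>
      (1 - C * root ?n (33/32 * log_upper TYPE('n) L)) ^ ?n * (?w / (ln 2 * L ^ (?n - 1)))" if L: "L0 \<le> L" for L
  proof -
    define h where "h = 1 / (L - 1)"
    have L1: "1 < L" using L L0 by simp
    have h: "0 < h" using L1 by (simp add: h_def)
    have "1 / d < L - 1" using L by (simp add: L0_def)
    then have "h < d" using d(1) L1 by (simp add: h_def field_simps)
    then have AB: "A h > 0" "B h > 0" using d(2)[of h] h by auto
    have up: "log_upper TYPE('n) L = up h"
      unfolding up_def h_def by (rule log_upper_reciprocal[OF L1 n])
    have Lh: "L = (1 + h) / h" using L1 by (simp add: h_def field_simps)
    have c1: "C * root ?n (33/32 * up h) \<le> 1" using AB(1) by (simp add: A_def)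
    have hp: "0 < (1 + h) ^ (?n - 1)" using h by simp
    have "99/128 * ((1 + h) / ln 2 + h) * (1 + h) ^ (?n - 1) \<le> A h ^ ?n / ln 2" using AB(2) by (simp add: B_def)
    then have "99/128 * ((1 + h) / ln 2 + h) \<le> A h ^ ?n / ln 2 / (1 + h) ^ (?n - 1)"
      unfolding pos_le_divide_eq[OF hp] .
    then have "99/128 * ((1 + h) / ln 2 + h) * (?w * h ^ (?n - 1)) \<le> A h ^ ?n / ln 2 / (1 + h) ^ (?n - 1) * (?w * h ^ (?n - 1))"
      using w h by (intro mult_right_mono) auto
    moreover have "A h ^ ?n / ln 2 / (1 + h) ^ (?n - 1) * (?w * h ^ (?n - 1)) = A h ^ ?n * (?w / (ln 2 * L ^ (?n - 1)))"
      unfolding Lh power_divide by simp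
    moreover have "99/128 * ((1 + h) / ln 2 + h) * (?w * h ^ (?n - 1)) = 99/128 * up h"
      by (simp add: up_def)
    ultimately have "99/128 * up h \<le> A h ^ ?n * (?w / (ln 2 * L ^ (?n - 1)))" by (simp only:)
    then show ?thesis using c1 unfolding up A_def by blast
  qed
  then show ?thesis using L0 by blast
qed

text \<open>For a near-minimal competitor of energy \<open>E\<close> the radial energy is at least \<open>3/4 * E\<close>. The radial compression then
  yields a competitor of energy at most \<open>E / (1 - \<epsilon>) - 3/2 * \<epsilon> * E \<le> (1 - \<epsilon> / 4) * E\<close>.\<close>

lemma modulus_metric_radial_contraction:
  fixes D :: "(real^'n) set"
  assumes n: "2 \<le> CARD('n)"
    and D: "open D" "x0 \<in> D" and pos: "positive_capacity (extended_space frontier_of (Some ` D))"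
    and R: "0 < R" "cball x0 R \<subseteq> D"
  shows "\<exists>s0>0. 2 * exp 3 * s0 \<le> R \<and> (\<forall>y \<delta>. 0 < norm (y - x0) \<longrightarrow> norm (y - x0) < s0 \<longrightarrow> 0 < \<delta> \<longrightarrow> \<delta> \<le> 1/10 \<longrightarrow>
    modulus_metric D x0 (x0 + exp (- \<delta>) *\<^sub>R (y - x0)) \<le>
      ennreal (1 - \<delta> / (4 * (ln (R / norm (y - x0)) - 1))) * modulus_metric D x0 y)"
proof -
  let ?n = "CARD('n)" and ?w = "shell_mass TYPE(real^'n)"
  let ?up = "log_upper TYPE('n)"
  have w: "?w > 0" by (rule shell_mass_pos)
  obtain C where C: "C \<ge> 0" and low: "\<And>s K y u g E. 0 < s \<Longrightarrow> 2 * exp 3 * s \<le> R \<Longrightarrow> connected K \<Longrightarrow> x0 \<in> K \<Longrightarrow> y \<in> K \<Longrightarrow> s \<le> norm (y - x0) \<Longrightarrow>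
    admissible D K u g \<Longrightarrow> 0 < E \<Longrightarrow> dirichlet g \<le> ennreal E \<Longrightarrow> C * root ?n E \<le> 1 \<Longrightarrow>
    (1 - C * root ?n E) ^ ?n \<le> ln (R / s) ^ (?n - 1) * (ln 2 / ?w) *
      (\<integral>z. radial_density x0 (exp 2 * s) (R / exp 1) g z \<partial>lborel)"
    using radial_energy_lower_bound[OF D pos R] by blast
  obtain L0 where L0: "L0 > 1" and ratio: "\<And>L. L \<ge> L0 \<Longrightarrow> C * root ?n (33/32 * ?up L) \<le> 1 \<and>
    99/128 * ?up L \<le> (1 - C * root ?n (33/32 * ?up L)) ^ ?n * (?w / (ln 2 * L ^ (?n - 1)))"
    using eventually_energy_ratio[OF n, of C] by blast
  define s0 where "s0 = min (R / (2 * exp 3)) (R / exp L0)"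
  have s0: "0 < s0" "2 * exp 3 * s0 \<le> R"
    using R by (auto simp: s0_def min_def field_simps)
  have main: "modulus_metric D x0 (x0 + exp (- \<delta>) *\<^sub>R (y - x0)) \<le>
      ennreal (1 - \<delta> / (4 * (ln (R / norm (y - x0)) - 1))) * modulus_metric D x0 y"
    if y: "0 < norm (y - x0)" "norm (y - x0) < s0" and \<delta>: "0 < \<delta>" "\<delta> \<le> 1/10" for y \<delta>
  proof -
    define s where "s = norm (y - x0)"
    have s: "0 < s" "s < s0" using y by (auto simp: s_def)
    have sR: "2 * exp 3 * s \<le> R" using s s0 by (smt (verit) exp_gt_zero mult_strict_left_mono)
    define L where "L = ln (R / s)"
    have "exp L0 \<le> R / s" using s R by (auto simp: s0_def field_simps)
    then have LL0: "L0 \<le> L" using s R by (simp add: L_def ln_ge_iff)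
    have "exp 2 \<le> exp (3::real)" by simp
    then have "exp 2 * s \<le> exp 3 * s" using s by (intro mult_right_mono) auto
    also have "\<dots> \<le> 2 * exp 3 * s" using s by simp
    finally have e2: "exp 2 * s \<le> R" using sR by linarith
    interpret log_cutoff_radii s R using s e2 by unfold_locales auto
    have L2: "2 \<le> L" unfolding L_def by (rule ln_ratio_ge)
    \<comment> \<open>The compression then scales the ball of radius \<open>s\<close> by exactly \<open>exp \<delta>\<close>.\<close>
    define \<epsilon> where "\<epsilon> = \<delta> / (L - 1)"
    have \<epsilon>: "0 < \<epsilon>" "\<epsilon> \<le> 1/10" "\<epsilon> * (L - 1) = \<delta>"
    proof -
      show "0 < \<epsilon>" "\<epsilon> * (L - 1) = \<delta>" using \<delta> L2 by (auto simp: \<epsilon>_def)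
      have "\<epsilon> \<le> \<delta> / 1" unfolding \<epsilon>_def using \<delta> L2 by (intro divide_left_mono) auto
      then show "\<epsilon> \<le> 1/10" using \<delta> by simp
    qed
    have up0: "0 < ?up L" using w L2 by (auto simp: log_upper_def intro!: divide_pos_pos mult_pos_pos add_pos_pos)
    have yx: "y \<noteq> x0" using y by auto
    have "modulus_metric D x0 y \<le> ennreal (?up L)"
      using modulus_metric_le_log[OF R(2) yx] by (simp add: s_def log_upper_def L_def)
    also have "\<dots> < ennreal (33/32 * ?up L)" using up0 by (subst ennreal_less_iff) auto
    finally have small: "modulus_metric D x0 y < ennreal (33/32 * ?up L)" .
    have k: "0 < 1 - \<epsilon> / 4" using \<epsilon> by simp
    have "modulus_metric D x0 (x0 + exp (- \<delta>) *\<^sub>R (y - x0)) \<le> ennreal (1 - \<epsilon> / 4) * modulus_metric D x0 y"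
    proof (rule le_mult_of_le_mult_greater[OF k _ small])
      fix \<theta> assume \<theta>: "modulus_metric D x0 y < \<theta>" "\<theta> < ennreal (33/32 * ?up L)"
      obtain E where E: "\<theta> = ennreal E" "0 \<le> E" using \<theta>(2) by (cases \<theta>) auto
      have E1: "0 < E" using \<theta>(1) E by (metis ennreal_0 not_less_zero order_le_less)
      have E2: "E < 33/32 * ?up L" using \<theta>(2) E by (simp add: ennreal_less_iff)
      obtain \<gamma> u g where \<gamma>: "arc \<gamma>" "path_image \<gamma> \<subseteq> D" "pathstart \<gamma> = x0" "pathfinish \<gamma> = y"
        and ad: "admissible D (path_image \<gamma>) u g" and lt: "dirichlet g < \<theta>"
        using modulus_metric_less_competitor[OF D(1) _ \<theta>(1)] yx by metis
      have u: "C1_compact_support_in D u g" using ad by (simp add: admissible_def)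
      let ?I = "\<integral>z. radial_density x0 (exp 2 * s) (R / exp 1) g z \<partial>lborel"
      let ?G = "\<integral>z. norm (g z) ^ ?n \<partial>lborel"
      have GE: "?G \<le> E" using lt E E1 dirichlet_eq_integral[OF u] by (simp add: ennreal_less_iff)
      have CE: "C * root ?n E \<le> C * root ?n (33/32 * ?up L)" using E2 C by (intro mult_left_mono) auto
      have C1: "C * root ?n (33/32 * ?up L) \<le> 1" using ratio[OF LL0] by blast
      have "(1 - C * root ?n E) ^ ?n \<le> L ^ (?n - 1) * (ln 2 / ?w) * ?I"
        unfolding L_def
        by (rule low[OF s(1) sR _ _ _ _ ad E1]) (use \<gamma> lt E CE C1 in \<open>auto simp: connected_arc_image s_def intro: less_imp_le\<close>)
      moreover have "(1 - C * root ?n (33/32 * ?up L)) ^ ?n \<le> (1 - C * root ?n E) ^ ?n"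
        using CE C1 by (intro power_mono) auto
      ultimately have "(1 - C * root ?n (33/32 * ?up L)) ^ ?n \<le> L ^ (?n - 1) * (ln 2 / ?w) * ?I" by linarith
      then have "(1 - C * root ?n (33/32 * ?up L)) ^ ?n * (?w / (ln 2 * L ^ (?n - 1))) \<le>
          L ^ (?n - 1) * (ln 2 / ?w) * ?I * (?w / (ln 2 * L ^ (?n - 1)))"
        using w L2 by (intro mult_right_mono) auto
      also have "\<dots> = ?I" using w L2 by simp
      finally have "99/128 * ?up L \<le> ?I" using ratio[OF LL0] by linarith
      then have I: "3/4 * E \<le> ?I" using E2 by linarith
      have "modulus_metric D x0 (x0 + exp (- \<epsilon> * (ln (R / s) - 1)) *\<^sub>R (y - x0)) \<le>
         ennreal (\<integral>z. norm (g z) ^ ?n / (1 - \<epsilon>) -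
        2 * \<epsilon> * (radial_density x0 (exp 2 * s) (R / exp 1) g z) \<partial>lborel)"
        by (rule modulus_metric_radial_stretch[OF n R(2) \<epsilon>(1) _ _ \<gamma> yx _ ad])
           (use \<epsilon> \<delta> in \<open>auto simp: s_def L_def\<close>)
      also have "(\<integral>z. norm (g z) ^ ?n / (1 - \<epsilon>) -
        2 * \<epsilon> * (radial_density x0 (exp 2 * s) (R / exp 1) g z) \<partial>lborel)
        = ?G / (1 - \<epsilon>) - 2 * \<epsilon> * ?I"
        using integrable_gradient_power[OF u] integrable_radial_density[OF u, where p=x0]
        by (subst Bochner_Integration.integral_diff) auto
      also have "ennreal (?G / (1 - \<epsilon>) - 2 * \<epsilon> * ?I) \<le> ennreal ((1 - \<epsilon> / 4) * E)"
      proof (rule ennreal_leI)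
        have "?G / (1 - \<epsilon>) \<le> E / (1 - \<epsilon>)" using GE \<epsilon> by (intro divide_right_mono) auto
        also have "\<dots> \<le> E * (1 + 5/4 * \<epsilon>)"
        proof -
          have "0 \<le> \<epsilon> * (1/4 - 5/4 * \<epsilon>)" using \<epsilon> by simp
          then have "1 \<le> (1 + 5/4 * \<epsilon>) * (1 - \<epsilon>)" by (simp add: algebra_simps)
          then have "E * 1 \<le> E * ((1 + 5/4 * \<epsilon>) * (1 - \<epsilon>))" using E1 by (intro mult_left_mono) auto
          then show ?thesis using \<epsilon> by (simp add: pos_divide_le_eq mult.assoc)
        qed
        finally have 1: "?G / (1 - \<epsilon>) \<le> E + 5/4 * (\<epsilon> * E)" by (simp add: algebra_simps)
        have 2: "2 * \<epsilon> * (3/4 * E) \<le> 2 * \<epsilon> * ?I" using I \<epsilon> by (intro mult_left_mono) auto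
        show "?G / (1 - \<epsilon>) - 2 * \<epsilon> * ?I \<le> (1 - \<epsilon> / 4) * E"
          using 1 2 by (simp add: algebra_simps)
      qed
      also have "\<dots> = ennreal (1 - \<epsilon> / 4) * \<theta>" unfolding E(1) using k E1 by (intro ennreal_mult) auto
      finally show "modulus_metric D x0 (x0 + exp (- \<delta>) *\<^sub>R (y - x0)) \<le> ennreal (1 - \<epsilon> / 4) * \<theta>"
        using \<epsilon>(3) by (simp add: L_def)
    qed
    moreover have "1 - \<epsilon> / 4 = 1 - \<delta> / (4 * (ln (R / norm (y - x0)) - 1))"
      by (simp add: \<epsilon>_def L_def s_def)
    ultimately show ?thesis by simp
  qed
  then show ?thesis using s0 by blast
qed

lemma log_upper_small:
  assumes n: "2 \<le> CARD('n::finite)" and e: "0 < e"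
  shows "\<exists>L0>1. \<forall>L\<ge>L0. log_upper TYPE('n) L < e"
proof -
  let ?n = "CARD('n)" and ?w = "shell_mass TYPE(real^'n)"
  define up where "up h = ?w * h ^ (?n - 1) * ((1 + h) / ln 2 + h)" for h :: real
  have up0: "up 0 = 0" using n by (simp add: up_def)
  have "isCont up 0" unfolding up_def[abs_def] by (intro continuous_intros) auto
  then have "(up \<longlongrightarrow> up 0) (nhds 0)" by (simp add: isCont_def tendsto_at_iff_tendsto_nhds)
  then have "eventually (\<lambda>h. up h < e) (nhds 0)" by (rule order_tendstoD(2)) (simp add: up0 e)
  then obtain d where d: "d > 0" "\<And>h. dist h 0 < d \<Longrightarrow> up h < e" by (auto simp: eventually_nhds_metric)
  have "log_upper TYPE('n) L < e" if L: "2 + 1 / d \<le> L" for L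
  proof -
    have "0 < 1 / d" using d(1) by simp
    then have L1: "1 < L" using L by linarith
    have "1 / d < L - 1" using L by simp
    then have "1 / (L - 1) < d" using d(1) L1 by (simp add: field_simps)
    then show ?thesis
      unfolding log_upper_reciprocal[OF L1 n] using d(2)[of "1 / (L - 1)"] L1 by (simp add: up_def)
  qed
  moreover have "1 < 2 + 1 / d" using d(1) by (simp add: add_pos_pos)
  ultimately show ?thesis by blast
qed

lemma modulus_metric_small_near_center:
  fixes D :: "(real^'n) set"
  assumes n: "2 \<le> CARD('n)" and R: "0 < R" "cball x0 R \<subseteq> D" and r: "0 < r"
  shows "\<exists>t>0. \<forall>y. 0 < norm (y - x0) \<longrightarrow> norm (y - x0) < t \<longrightarrow> modulus_metric D x0 y < ennreal r"
proof -
  obtain L0 where L0: "L0 > 1" "\<And>L. L \<ge> L0 \<Longrightarrow> log_upper TYPE('n) L < r"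
    using log_upper_small[OF n r] by blast
  define t where "t = min (R / exp 2) (R / exp L0)"
  have t: "0 < t" using R by (simp add: t_def)
  have "modulus_metric D x0 y < ennreal r" if y: "0 < norm (y - x0)" "norm (y - x0) < t" for y
  proof -
    let ?s = "norm (y - x0)"
    have "exp 2 * ?s \<le> R" "exp L0 \<le> R / ?s" using y R by (auto simp: t_def field_simps)
    then have L: "L0 \<le> ln (R / ?s)" using y R by (subst ln_ge_iff) auto
    interpret log_cutoff_radii ?s R using y \<open>exp 2 * ?s \<le> R\<close> by unfold_locales auto
    have "modulus_metric D x0 y \<le> ennreal (log_upper TYPE('n) (ln (R / ?s)))"
      using modulus_metric_le_log[OF R(2), of y] y by (simp add: log_upper_def)
    also have "\<dots> < ennreal r" by (rule ennreal_lessI[OF r L0(2)[OF L]])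
    finally show ?thesis .
  qed
  then show ?thesis using t by blast
qed

section \<open>Cones and level sets of radial gauges\<close>

text \<open>Decomposes the points of a cone into a component \<open>\<tau> *\<^sub>R v\<close> along the axis and an orthogonal remainder \<open>t\<close>. The
  angle of the cone is the one with tangent \<open>\<kappa> / norm v\<close>.\<close>

lemma vertex_of_cone_inI:
  fixes x v :: "real^'n"
  assumes v: "v \<noteq> 0" and \<kappa>: "0 < \<kappa>" and \<eta>: "0 < \<eta>"
    and A: "\<And>\<tau> t. 0 < \<tau> \<Longrightarrow> \<tau> < \<eta> \<Longrightarrow> norm t \<le> \<kappa> * \<tau> \<Longrightarrow> x + \<tau> *\<^sub>R v + t \<in> A"
  shows "vertex_of_cone_in x A"
proof -
  define k where "k = \<kappa> / norm v"
  have k: "0 < k" using v \<kappa> by (simp add: k_def)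
  define m where "m = sqrt (1 + k\<^sup>2)"
  \<comment> \<open>The cosine of the angle whose tangent is \<open>k\<close>.\<close>
  define c0 where "c0 = 1 / m"
  have sk: "1 < 1 + k\<^sup>2" using k by simp
  have sq: "1 < m" using sk by (simp add: m_def)
  have msq: "m\<^sup>2 = 1 + k\<^sup>2" by (simp add: m_def)
  have c0: "0 < c0" "c0 < 1" using sq by (auto simp: c0_def)
  have c0sq: "c0\<^sup>2 * (1 + k\<^sup>2) = 1" using sq by (simp add: c0_def power_divide msq[symmetric])
  define \<alpha> where "\<alpha> = arccos c0"
  have "arccos c0 < arccos 0" using c0 by (intro arccos_less_arccos) auto
  then have \<alpha>: "0 < \<alpha>" "\<alpha> < pi / 2" using c0 arccos_lt_bounded[of c0] by (auto simp: \<alpha>_def)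
  define \<rho> where "\<rho> = \<eta> * norm v"
  have \<rho>: "0 < \<rho>" using v \<eta> by (simp add: \<rho>_def)
  have "spherical_cone x \<rho> v \<alpha> \<subseteq> A"
  proof
    fix z assume "z \<in> spherical_cone x \<rho> v \<alpha>"
    then obtain w where w: "z = x + w" "0 < norm w" "norm w < \<rho>"
      and ang: "arccos ((w \<bullet> v) / (norm w * norm v)) < \<alpha>" by (auto simp: spherical_cone_def)
    define c where "c = (w \<bullet> v) / (norm w * norm v)"
    have nv: "0 < norm v" using v by simp
    have wv: "w \<bullet> v = c * (norm w * norm v)" using w nv by (simp add: c_def)
    have cb: "\<bar>c\<bar> \<le> 1"
      using Cauchy_Schwarz_ineq2[of w v] w nv by (simp add: c_def abs_divide divide_le_eq_1)
    have cc0: "c0 < c"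
    proof (rule ccontr)
      assume "\<not> c0 < c"
      then have "arccos c0 \<le> arccos c" using cb c0 by (intro arccos_le_arccos) auto
      then show False using ang by (simp add: \<alpha>_def c_def)
    qed
    define \<tau> where "\<tau> = norm w * c / norm v"
    define t where "t = w - \<tau> *\<^sub>R v"
    have \<tau>: "0 < \<tau>" using w nv cc0 c0 by (simp add: \<tau>_def)
    have "norm w * c \<le> norm w * 1" using cb w by (intro mult_left_mono) auto
    also have "\<dots> < \<eta> * norm v" using w by (simp add: \<rho>_def)
    finally have \<tau>1: "\<tau> < \<eta>" using nv by (simp add: \<tau>_def pos_divide_less_eq)
    have "(norm t)\<^sup>2 = (norm w)\<^sup>2 - 2 * \<tau> * (w \<bullet> v) + \<tau>\<^sup>2 * (norm v)\<^sup>2"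
      unfolding power2_norm_eq_inner
      by (simp add: t_def inner_diff_left inner_diff_right inner_commute[of v w] power2_eq_square algebra_simps)
    also have "\<dots> = (norm w)\<^sup>2 * (1 - c\<^sup>2)"
      unfolding wv \<tau>_def using nv by (simp add: power2_eq_square field_simps)
    also have "\<dots> \<le> (norm w)\<^sup>2 * (k\<^sup>2 * c\<^sup>2)"
    proof (rule mult_left_mono)
      have "c0\<^sup>2 \<le> c\<^sup>2" using cc0 c0 by (intro power_mono) auto
      then have "c0\<^sup>2 * (1 + k\<^sup>2) \<le> c\<^sup>2 * (1 + k\<^sup>2)" by (intro mult_right_mono) auto
      then show "1 - c\<^sup>2 \<le> k\<^sup>2 * c\<^sup>2" unfolding c0sq by (simp add: algebra_simps)
    qed simp
    also have "\<dots> = (\<kappa> * \<tau>)\<^sup>2" using nv by (simp add: k_def \<tau>_def power2_eq_square)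
    finally have "norm t \<le> \<kappa> * \<tau>" by (rule power2_le_imp_le) (use \<kappa> \<tau> in simp)
    then have "x + \<tau> *\<^sub>R v + t \<in> A" using A \<tau> \<tau>1 by blast
    then show "z \<in> A" by (simp add: w(1) t_def)
  qed
  then show ?thesis unfolding vertex_of_cone_in_def using \<rho> v \<alpha> by blast
qed

text \<open>The properties of the modulus metric near its centre that determine the shape of small balls and spheres. The
  Lipschitz and contraction estimates are multiplicative, in the form in which substitutions provide them, and the rate of
  contraction may degenerate at \<open>x0\<close>.\<close>

locale radial_gauge =
  fixes f :: "real^'n \<Rightarrow> real" and x0 :: "real^'n" and s0 :: real
  assumes s0: "0 < s0"
    and pos: "\<And>y. 0 < norm (y - x0) \<Longrightarrow> norm (y - x0) < s0 \<Longrightarrow> 0 < f y"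
    and small: "\<And>r. 0 < r \<Longrightarrow> \<exists>t>0. \<forall>y. 0 < norm (y - x0) \<longrightarrow> norm (y - x0) < t \<longrightarrow> f y < r"
    and lip: "\<And>y. 0 < norm (y - x0) \<Longrightarrow> norm (y - x0) < s0 \<Longrightarrow>
       \<exists>C\<ge>0. \<exists>\<rho>>0. ball y \<rho> \<subseteq> ball x0 s0 - {x0} \<and> (\<forall>z\<in>ball y \<rho>. \<forall>z'\<in>ball y \<rho>. f z' \<le> (1 + C * dist z z') * f z)"
    and contr: "\<And>t. 0 < t \<Longrightarrow> \<exists>c>0. \<forall>y \<delta>. t \<le> norm (y - x0) \<longrightarrow> norm (y - x0) < s0 \<longrightarrow> 0 < \<delta> \<longrightarrow> \<delta> \<le> 1/10 \<longrightarrow>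
       f (x0 + exp (- \<delta>) *\<^sub>R (y - x0)) \<le> (1 - c * \<delta>) * f y"
begin

definition punctured :: "(real^'n) set" where
  "punctured = ball x0 s0 - {x0}"

lemma punctured_iff: "y \<in> punctured \<longleftrightarrow> 0 < norm (y - x0) \<and> norm (y - x0) < s0"
  by (auto simp: punctured_def dist_norm norm_minus_commute)

lemma open_punctured: "open punctured" by (auto simp: punctured_def)

lemma local_lipschitz:
  assumes y: "y \<in> punctured"
  obtains C \<rho> where "0 \<le> C" "0 < \<rho>" "ball y \<rho> \<subseteq> punctured"
    "\<forall>z\<in>ball y \<rho>. \<forall>z'\<in>ball y \<rho>. f z' \<le> (1 + C * dist z z') * f z"
proof -
  have yy: "0 < norm (y - x0)" "norm (y - x0) < s0" using y by (simp_all only: punctured_iff)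
  obtain C \<rho> where *: "0 \<le> C" "0 < \<rho>" "ball y \<rho> \<subseteq> punctured"
    "\<forall>z\<in>ball y \<rho>. \<forall>z'\<in>ball y \<rho>. f z' \<le> (1 + C * dist z z') * f z"
    using lip[OF yy] unfolding punctured_def by (elim exE conjE)
  show thesis
    by (rule that[OF *])
qed

lemma uniform_contraction:
  assumes "0 < t"
  obtains c where "0 < c" "\<forall>y \<delta>. t \<le> norm (y - x0) \<longrightarrow> norm (y - x0) < s0 \<longrightarrow> 0 < \<delta> \<longrightarrow> \<delta> \<le> 1/10 \<longrightarrow>
       f (x0 + exp (- \<delta>) *\<^sub>R (y - x0)) \<le> (1 - c * \<delta>) * f y"
proof -
  obtain c where *: "0 < c" "\<forall>y \<delta>. t \<le> norm (y - x0) \<longrightarrow> norm (y - x0) < s0 \<longrightarrow> 0 < \<delta> \<longrightarrow> \<delta> \<le> 1/10 \<longrightarrow>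
       f (x0 + exp (- \<delta>) *\<^sub>R (y - x0)) \<le> (1 - c * \<delta>) * f y"
    using contr[OF assms] by (elim exE conjE)
  show thesis by (rule that[OF *])
qed

lemma continuous: "continuous_on punctured f"
proof -
  have "isCont f y" if "y \<in> punctured" for y
  proof -
    obtain C \<rho> where C: "0 \<le> C" "0 < \<rho>" and "ball y \<rho> \<subseteq> punctured"
      and L0: "\<forall>z\<in>ball y \<rho>. \<forall>z'\<in>ball y \<rho>. f z' \<le> (1 + C * dist z z') * f z"
      by (rule local_lipschitz[OF \<open>y \<in> punctured\<close>]) (rule that)
    note L = L0[rule_format]
    have "(f \<longlongrightarrow> f y) (nhds y)"
    proof (rule tendsto_sandwich)
      have ev: "eventually (\<lambda>z. z \<in> ball y \<rho>) (nhds y)"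
        using C(2) by (intro eventually_nhds_in_open) auto
      show "eventually (\<lambda>z. f y / (1 + C * dist z y) \<le> f z) (nhds y)"
        using ev
      proof eventually_elim
        case (elim z)
        have "0 < 1 + C * dist z y" using C(1) by (simp add: add_pos_nonneg)
        then show ?case using L[OF elim, of y] C(2) by (simp add: pos_divide_le_eq mult.commute)
      qed
      show "eventually (\<lambda>z. f z \<le> (1 + C * dist y z) * f y) (nhds y)"
        using ev by eventually_elim (use L[of y] C(2) in auto)
      have "((\<lambda>z. f y / (1 + C * dist z y)) \<longlongrightarrow> f y / (1 + C * dist y y)) (nhds y)"
        by (intro tendsto_intros filterlim_ident) auto
      then show "((\<lambda>z. f y / (1 + C * dist z y)) \<longlongrightarrow> f y) (nhds y)" by simp
      have "((\<lambda>z. (1 + C * dist y z) * f y) \<longlongrightarrow> (1 + C * dist y y) * f y) (nhds y)"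
        by (intro tendsto_intros filterlim_ident)
      then show "((\<lambda>z. (1 + C * dist y z) * f y) \<longlongrightarrow> f y) (nhds y)" by simp
    qed
    then show ?thesis by (simp add: isCont_def tendsto_at_iff_tendsto_nhds)
  qed
  then show ?thesis by (intro continuous_at_imp_continuous_on) auto
qed

lemma small_step_decreases:
  assumes y: "y \<in> punctured" and \<delta>: "0 < \<delta>" "\<delta> \<le> 1/10"
  shows "f (x0 + exp (- \<delta>) *\<^sub>R (y - x0)) < f y"
proof -
  have yy: "0 < norm (y - x0)" "norm (y - x0) < s0" using y by (simp_all only: punctured_iff)
  obtain c where c0: "0 < c" "\<forall>z \<delta>. norm (y - x0) \<le> norm (z - x0) \<longrightarrow> norm (z - x0) < s0 \<longrightarrow> 0 < \<delta> \<longrightarrow> \<delta> \<le> 1/10 \<longrightarrow>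
       f (x0 + exp (- \<delta>) *\<^sub>R (z - x0)) \<le> (1 - c * \<delta>) * f z"
    by (rule uniform_contraction[OF yy(1)]) (rule that)
  note c = c0(1) c0(2)[rule_format, OF order_refl yy(2) \<delta>]
  have "(1 - c * \<delta>) * f y < 1 * f y"
    using c(1) \<delta>(1) pos[of y] y unfolding punctured_iff by (intro mult_strict_right_mono) auto
  then show ?thesis using c(2) by simp
qed

lemma scaled_in_punctured:
  assumes "y \<in> punctured" "0 < \<mu>" "\<mu> \<le> 1"
  shows "x0 + \<mu> *\<^sub>R (y - x0) \<in> punctured"
proof -
  have "\<mu> * norm (y - x0) \<le> 1 * norm (y - x0)" using assms by (intro mult_right_mono) auto
  then have "\<mu> * norm (y - x0) < s0" using assms(1) unfolding punctured_iff by linarith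
  then show ?thesis using assms by (simp add: punctured_iff)
qed

text \<open>An arbitrary ratio \<open>\<mu>\<close> is reached by finitely many steps of ratio at least \<open>exp (- 1/10)\<close>.\<close>

lemma strictly_increasing_on_rays:
  assumes "y \<in> punctured" "0 < \<mu>" "\<mu> < 1"
  shows "f (x0 + \<mu> *\<^sub>R (y - x0)) < f y"
proof -
  have "f (x0 + \<mu> *\<^sub>R (y - x0)) < f y"
    if "exp (- real k / 10) \<le> \<mu>" "0 < \<mu>" "\<mu> < 1" "y \<in> punctured" for k y \<mu>
    using that
  proof (induction k arbitrary: y \<mu>)
    case (Suc k)
    show ?case
    proof (cases "exp (- (1/10)) \<le> \<mu>")
      case True
      then have "ln (exp (- (1/10))) \<le> ln \<mu>" using Suc.prems by (subst ln_le_cancel_iff) auto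
      then have "- ln \<mu> \<le> 1/10" by simp
      moreover have "0 < - ln \<mu>" using Suc.prems by simp
      ultimately show ?thesis
        using small_step_decreases[OF Suc.prems(4), of "- ln \<mu>"] Suc.prems by simp
    next
      case False
      define y' where "y' = x0 + exp (- (1/10)) *\<^sub>R (y - x0)"
      define \<mu>' where "\<mu>' = \<mu> * exp (1/10)"
      have eq: "x0 + \<mu>' *\<^sub>R (y' - x0) = x0 + \<mu> *\<^sub>R (y - x0)"
        by (simp add: y'_def \<mu>'_def exp_minus)
      have y': "y' \<in> punctured" unfolding y'_def by (rule scaled_in_punctured[OF Suc.prems(4)]) auto
      have "\<mu>' < exp (- (1/10)) * exp (1/10)" unfolding \<mu>'_def using False by (intro mult_strict_right_mono) auto
      then have m1: "\<mu>' < 1" by (simp add: exp_minus)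
      have "exp (- real k / 10) = exp (- real (Suc k) / 10) * exp (1/10)"
        by (simp add: exp_add[symmetric] diff_divide_distrib)
      also have "\<dots> \<le> \<mu>'" unfolding \<mu>'_def using Suc.prems(1) by (intro mult_right_mono) auto
      finally have "f (x0 + \<mu>' *\<^sub>R (y' - x0)) < f y'"
        using Suc.prems m1 y' by (intro Suc.IH) (auto simp: \<mu>'_def)
      also have "f y' < f y" unfolding y'_def by (rule small_step_decreases[OF Suc.prems(4)]) auto
      finally show ?thesis unfolding eq .
    qed
  qed simp
  note main = this
  obtain k :: nat where "- ln \<mu> * 10 \<le> real k" using real_arch_simple by blast
  then have "- real k / 10 \<le> ln \<mu>" by simp
  then have "exp (- real k / 10) \<le> \<mu>" using assms(2) by (simp add: ln_ge_iff)
  then show ?thesis using main assms by blast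
qed

text \<open>The axis points to \<open>x0\<close>. A step of parameter \<open>\<tau>\<close> along it decreases \<open>f\<close> by a factor of at most \<open>1 - c * \<tau>\<close>, while the error \<open>t\<close>
  increases it by a factor of at most \<open>1 + c / 2 * \<tau>\<close> if \<open>\<kappa>\<close> is chosen small compared with \<open>c / C\<close>.\<close>

lemma interior_cone:
  assumes y: "y \<in> punctured"
  shows "vertex_of_cone_in y {z \<in> punctured. f z < f y}"
proof -
  let ?q = "y - x0"
  have q: "0 < norm ?q" "norm ?q < s0" using y by (auto simp: punctured_iff)
  obtain C \<rho> where C: "0 \<le> C" "0 < \<rho>" "ball y \<rho> \<subseteq> punctured"
    and L0: "\<forall>z\<in>ball y \<rho>. \<forall>z'\<in>ball y \<rho>. f z' \<le> (1 + C * dist z z') * f z"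
    by (rule local_lipschitz[OF y]) (rule that)
  note L = L0[rule_format]
  obtain c where c0: "0 < c" "\<forall>z \<delta>. norm ?q \<le> norm (z - x0) \<longrightarrow> norm (z - x0) < s0 \<longrightarrow> 0 < \<delta> \<longrightarrow> \<delta> \<le> 1/10 \<longrightarrow>
       f (x0 + exp (- \<delta>) *\<^sub>R (z - x0)) \<le> (1 - c * \<delta>) * f z"
    by (rule uniform_contraction[OF q(1)]) (rule that)
  note c = c0(1) c0(2)[rule_format, OF order_refl q(2)]
  define \<kappa> where "\<kappa> = c / (2 * (C + 1))"
  have \<kappa>: "0 < \<kappa>" using c C by (simp add: \<kappa>_def)
  have C\<kappa>: "C * \<kappa> \<le> c / 2" using c C by (simp add: \<kappa>_def field_simps)
  \<comment> \<open>The bound \<open>1/20\<close> ensures \<open>- ln (1 - \<tau>) \<le> 1/10\<close>, the range of the contraction estimate.\<close>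
  define \<tau>0 where "\<tau>0 = min (1/20) (min (1 / (2 * c)) (\<rho> / (2 * (norm ?q + \<kappa>))))"
  have nqk: "0 < norm ?q + \<kappa>" by (rule add_pos_pos[OF q(1) \<kappa>])
  have \<tau>0: "0 < \<tau>0" using c C nqk by (simp add: \<tau>0_def)
  show ?thesis
  proof (rule vertex_of_cone_inI[where v="- ?q" and \<kappa>=\<kappa> and \<eta>=\<tau>0])
    fix \<tau> :: real and t :: "real^'n" assume \<tau>: "0 < \<tau>" "\<tau> < \<tau>0" and t: "norm t \<le> \<kappa> * \<tau>"
    define p where "p = x0 + (1 - \<tau>) *\<^sub>R ?q"
    have b: "\<tau> < 1/20" "\<tau> < 1 / (2 * c)" "\<tau> < \<rho> / (2 * (norm ?q + \<kappa>))" using \<tau> by (auto simp: \<tau>0_def)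
    have c\<tau>: "c * \<tau> < 1/2" using b(2) c by (simp add: field_simps)
    have "\<tau> * (norm ?q + \<kappa>) < \<rho> / 2" using b(3) nqk by (simp add: field_simps)
    then have r1: "\<tau> * norm ?q + \<kappa> * \<tau> < \<rho>" using C(2) by (simp add: algebra_simps)
    have yp: "y - p = \<tau> *\<^sub>R ?q" by (simp add: p_def algebra_simps)
    have pin: "p \<in> ball y \<rho>" using r1 \<kappa> \<tau> by (simp add: dist_norm yp) (smt (verit) mult_nonneg_nonneg)
    have z: "y + \<tau> *\<^sub>R (- ?q) + t = p + t" by (simp add: p_def algebra_simps)
    have "norm (y - (p + t)) \<le> norm (y - p) + norm t" using norm_triangle_ineq4[of "y - p" t] by (simp add: algebra_simps)
    then have zin: "p + t \<in> ball y \<rho>" using r1 t \<tau> by (simp add: dist_norm yp)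
    define \<delta> where "\<delta> = - ln (1 - \<tau>)"
    have \<delta>1: "\<tau> \<le> \<delta>" using ln_le_minus_one[of "1 - \<tau>"] b(1) by (simp add: \<delta>_def)
    have \<delta>2: "\<delta> \<le> 1/10"
    proof -
      have "exp (- (1/10)) \<le> (19/20 :: real)"
      proof -
        have "1 + 1/10 \<le> exp (1/10 :: real)" by (rule exp_ge_add_one_self)
        then have "20/19 \<le> exp (1/10 :: real)" by linarith
        then have "1 / exp (1/10) \<le> 1 / (20/19 :: real)" by (intro divide_left_mono) auto
        then show ?thesis by (simp add: exp_minus inverse_eq_divide)
      qed
      then have "exp (- (1/10)) \<le> 1 - \<tau>" using b(1) by simp
      then have "- (1/10) \<le> ln (1 - \<tau>)" using b(1) by (subst ln_ge_iff) auto
      then show ?thesis by (simp add: \<delta>_def)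
    qed
    have "p = x0 + exp (- \<delta>) *\<^sub>R ?q" using b(1) by (simp add: p_def \<delta>_def)
    then have "f p \<le> (1 - c * \<delta>) * f y" using c(2)[of \<delta>] \<delta>1 \<delta>2 \<tau> by simp
    also have "\<dots> \<le> (1 - c * \<tau>) * f y"
      using \<delta>1 c(1) pos[OF q] by (intro mult_right_mono) auto
    finally have fp: "f p \<le> (1 - c * \<tau>) * f y" .
    have "C * norm t \<le> C * (\<kappa> * \<tau>)" using t C by (intro mult_left_mono) auto
    also have "\<dots> \<le> c / 2 * \<tau>" using mult_right_mono[OF C\<kappa>, of \<tau>] \<tau> by simp
    finally have Ct: "C * norm t \<le> c / 2 * \<tau>" .
    have fp0: "0 < f p" using pin C(3) pos[of p] by (auto simp: punctured_iff)
    have "f (p + t) \<le> (1 + C * norm t) * f p" using L[OF pin zin] by (simp add: dist_norm)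
    also have "\<dots> \<le> (1 + c / 2 * \<tau>) * f p" using Ct fp0 by (intro mult_right_mono) auto
    also have "\<dots> \<le> (1 + c / 2 * \<tau>) * ((1 - c * \<tau>) * f y)"
      using fp c \<tau> by (intro mult_left_mono) auto
    also have "\<dots> = ((1 + c / 2 * \<tau>) * (1 - c * \<tau>)) * f y" by simp
    also have "\<dots> < 1 * f y"
    proof (rule mult_strict_right_mono[OF _ pos[OF q]])
      have "0 < c * \<tau>" using c \<tau> by simp
      moreover have "(1 + c / 2 * \<tau>) * (1 - c * \<tau>) = 1 - c * \<tau> / 2 - (c * \<tau>) * (c * \<tau>) / 2"
        by (simp add: field_simps)
      ultimately show "(1 + c / 2 * \<tau>) * (1 - c * \<tau>) < 1" using mult_pos_pos[of "c * \<tau>" "c * \<tau>"] by linarith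
    qed
    finally show "y + \<tau> *\<^sub>R (- ?q) + t \<in> {z \<in> punctured. f z < f y}"
      unfolding z using zin C(3) by auto
  qed (use q \<kappa> \<tau>0 in auto)
qed

text \<open>The same comparison with \<open>y\<close> as the contracted point: the contraction from \<open>x0 + (1 + \<tau>) *\<^sub>R (y - x0)\<close>
  to \<open>y\<close> only has \<open>\<delta> = ln (1 + \<tau>) \<ge> \<tau> / 2\<close>, whence the smaller \<open>\<kappa>\<close>.\<close>

lemma exterior_cone:
  assumes y: "y \<in> punctured"
  shows "vertex_of_cone_in y {z \<in> punctured. f y < f z}"
proof -
  let ?q = "y - x0"
  have q: "0 < norm ?q" "norm ?q < s0" using y by (auto simp: punctured_iff)
  obtain C \<rho> where C: "0 \<le> C" "0 < \<rho>" "ball y \<rho> \<subseteq> punctured"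
    and L0: "\<forall>z\<in>ball y \<rho>. \<forall>z'\<in>ball y \<rho>. f z' \<le> (1 + C * dist z z') * f z"
    by (rule local_lipschitz[OF y]) (rule that)
  note L = L0[rule_format]
  obtain c where c0: "0 < c" "\<forall>p \<delta>. norm ?q \<le> norm (p - x0) \<longrightarrow> norm (p - x0) < s0 \<longrightarrow> 0 < \<delta> \<longrightarrow> \<delta> \<le> 1/10 \<longrightarrow>
      f (x0 + exp (- \<delta>) *\<^sub>R (p - x0)) \<le> (1 - c * \<delta>) * f p"
    by (rule uniform_contraction[OF q(1)]) (rule that)
  note c = c0[rule_format]
  define \<kappa> where "\<kappa> = c / (4 * (C + 1))"
  have \<kappa>: "0 < \<kappa>" using c C by (simp add: \<kappa>_def)
  have C\<kappa>: "C * \<kappa> \<le> c / 4" using c C by (simp add: \<kappa>_def field_simps)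
  define \<tau>0 where "\<tau>0 = min (1/20) (min (1 / (2 * c)) (\<rho> / (2 * (norm ?q + \<kappa>))))"
  have nqk: "0 < norm ?q + \<kappa>" by (rule add_pos_pos[OF q(1) \<kappa>])
  have \<tau>0: "0 < \<tau>0" using c C nqk by (simp add: \<tau>0_def)
  show ?thesis
  proof (rule vertex_of_cone_inI[where v="?q" and \<kappa>=\<kappa> and \<eta>=\<tau>0])
    fix \<tau> :: real and t :: "real^'n" assume \<tau>: "0 < \<tau>" "\<tau> < \<tau>0" and t: "norm t \<le> \<kappa> * \<tau>"
    define p where "p = x0 + (1 + \<tau>) *\<^sub>R ?q"
    have b: "\<tau> < 1/20" "\<tau> < 1 / (2 * c)" "\<tau> < \<rho> / (2 * (norm ?q + \<kappa>))" using \<tau> by (auto simp: \<tau>0_def)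
    have c\<tau>: "c * \<tau> < 1/2" using b(2) c by (simp add: field_simps)
    have "\<tau> * (norm ?q + \<kappa>) < \<rho> / 2" using b(3) nqk by (simp add: field_simps)
    then have r1: "\<tau> * norm ?q + \<kappa> * \<tau> < \<rho>" using C(2) by (simp add: algebra_simps)
    have yp: "y - p = - (\<tau> *\<^sub>R ?q)" by (simp add: p_def algebra_simps)
    have pin: "p \<in> ball y \<rho>" using r1 \<kappa> \<tau> by (simp add: dist_norm yp) (smt (verit) mult_nonneg_nonneg)
    have z: "y + \<tau> *\<^sub>R ?q + t = p + t" by (simp add: p_def algebra_simps)
    have "norm (y - (p + t)) \<le> norm (y - p) + norm t" using norm_triangle_ineq4[of "y - p" t] by (simp add: algebra_simps)
    then have zin: "p + t \<in> ball y \<rho>" using r1 t \<tau> by (simp add: dist_norm yp)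
    have pP: "p \<in> punctured" and zP: "p + t \<in> punctured" using pin zin C(3) by auto
    define \<delta> where "\<delta> = ln (1 + \<tau>)"
    have \<delta>1: "\<tau> / 2 \<le> \<delta>"
    proof -
      have "exp (\<tau> / 2) \<le> 1 + \<tau> / 2 + (\<tau> / 2)\<^sup>2" using \<tau> b(1) by (intro exp_bound) auto
      also have "\<dots> \<le> 1 + \<tau>"
      proof -
        have "\<tau> * \<tau> \<le> \<tau> * 1" using \<tau> b(1) by (intro mult_left_mono) auto
        then show ?thesis using \<tau> by (simp add: power2_eq_square field_simps)
      qed
      finally show ?thesis unfolding \<delta>_def using \<tau> by (subst ln_ge_iff) auto
    qed
    have \<delta>2: "\<delta> \<le> 1/10" using ln_add_one_self_le_self[of \<tau>] \<tau> b(1) by (simp add: \<delta>_def)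
    have np: "norm ?q \<le> norm (p - x0)"
    proof -
      have "p - x0 = (1 + \<tau>) *\<^sub>R ?q" by (simp add: p_def)
      then have "norm (p - x0) = (1 + \<tau>) * norm ?q" using \<tau> by simp
      also have "\<dots> \<ge> 1 * norm ?q" using \<tau> by (intro mult_right_mono) auto
      finally show ?thesis by simp
    qed
    have "x0 + exp (- \<delta>) *\<^sub>R (p - x0) = y" using \<tau> by (simp add: p_def \<delta>_def exp_minus)
    then have "f y \<le> (1 - c * \<delta>) * f p" using c(2)[of p \<delta>] np pP \<delta>1 \<delta>2 \<tau> by (simp add: punctured_iff)
    also have "\<dots> \<le> (1 - c * (\<tau> / 2)) * f p"
      using \<delta>1 c(1) pos[of p] pP by (intro mult_right_mono) (auto simp: punctured_iff intro: mult_left_mono)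
    finally have fy: "f y \<le> (1 - c * \<tau> / 2) * f p" by simp
    have "C * norm t \<le> C * (\<kappa> * \<tau>)" using t C by (intro mult_left_mono) auto
    also have "\<dots> \<le> c / 4 * \<tau>" using mult_right_mono[OF C\<kappa>, of \<tau>] \<tau> by simp
    finally have Ct: "C * norm t \<le> c / 4 * \<tau>" .
    have fz0: "0 < f (p + t)" using zP pos[of "p + t"] by (auto simp: punctured_iff)
    have "f p \<le> (1 + C * norm t) * f (p + t)" using L[OF zin pin] by (simp add: dist_norm)
    also have "\<dots> \<le> (1 + c / 4 * \<tau>) * f (p + t)" using Ct fz0 by (intro mult_right_mono) auto
    finally have "(1 - c * \<tau> / 2) * f p \<le> (1 - c * \<tau> / 2) * ((1 + c / 4 * \<tau>) * f (p + t))"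
      using c\<tau> by (intro mult_left_mono) auto
    from order_trans[OF fy this] have "f y \<le> ((1 - c * \<tau> / 2) * (1 + c / 4 * \<tau>)) * f (p + t)"
      by (simp only: mult.assoc)
    also have "\<dots> < 1 * f (p + t)"
    proof (rule mult_strict_right_mono[OF _ fz0])
      have "0 < c * \<tau>" using c \<tau> by simp
      moreover have "(1 - c * \<tau> / 2) * (1 + c / 4 * \<tau>) = 1 - c * \<tau> / 4 - (c * \<tau>) * (c * \<tau>) / 8"
        by (simp add: field_simps)
      ultimately show "(1 - c * \<tau> / 2) * (1 + c / 4 * \<tau>) < 1" using mult_pos_pos[of "c * \<tau>" "c * \<tau>"] by linarith
    qed
    finally show "y + \<tau> *\<^sub>R ?q + t \<in> {z \<in> punctured. f y < f z}"
      unfolding z using zP by simp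
  qed (use q \<kappa> \<tau>0 in auto)
qed

text \<open>The level set is compact, since \<open>f\<close> is smaller than \<open>r\<close> near \<open>x0\<close> and larger than \<open>r\<close> on the outer part of the
  neighbourhood. Its radial projection to the unit sphere is injective by monotonicity on rays and surjective by the
  intermediate value theorem, hence a homeomorphism.\<close>

lemma level_set_homeomorphic_sphere:
  assumes s1: "0 < s1" "s1 < s0" and r: "0 < r"
    and far: "\<And>y. s1 \<le> norm (y - x0) \<Longrightarrow> norm (y - x0) < s0 \<Longrightarrow> r < f y"
  shows "{y \<in> punctured. f y = r} homeomorphic sphere (0::real^'n) 1"
proof -
  let ?S = "{y \<in> punctured. f y = r}"
  obtain t where t: "0 < t" and near: "\<And>y. 0 < norm (y - x0) \<Longrightarrow> norm (y - x0) < t \<Longrightarrow> f y < r"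
    using small[OF r] by blast
  define A where "A = {y. min t s1 \<le> norm (y - x0) \<and> norm (y - x0) \<le> s1}"
  have AP: "A \<subseteq> punctured" using t s1 by (auto simp: A_def punctured_iff)
  have "compact A"
  proof -
    have "A = cball x0 s1 - ball x0 (min t s1)" by (auto simp: A_def dist_norm norm_minus_commute)
    then show ?thesis by (simp add: compact_diff)
  qed
  have cf: "continuous_on A f" using continuous AP by (rule continuous_on_subset)
  have SA: "?S = A \<inter> f -` {r}"
  proof
    show "?S \<subseteq> A \<inter> f -` {r}"
    proof
      fix y assume y: "y \<in> ?S"
      then have "norm (y - x0) < s1" "t \<le> norm (y - x0)"
        using far[of y] near[of y] by (auto simp: punctured_iff not_less[symmetric])
      then show "y \<in> A \<inter> f -` {r}" using y by (auto simp: A_def)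
    qed
  qed (use AP in auto)
  have "closed (A \<inter> f -` {r})"
    by (rule continuous_closed_preimage[OF cf]) (use \<open>compact A\<close> in \<open>auto simp: compact_imp_closed\<close>)
  then have cS: "compact ?S"
    unfolding SA using compact_Int_closed[OF \<open>compact A\<close>, of "A \<inter> f -` {r}"] by (simp add: Int_assoc[symmetric])
  let ?N = "\<lambda>y. sgn (y - x0)"
  have cN: "continuous_on ?S ?N"
    unfolding sgn_div_norm by (intro continuous_intros) (auto simp: punctured_iff)
  have inj: "inj_on ?N ?S"
  proof (rule inj_onI)
    fix y y' assume y: "y \<in> ?S" "y' \<in> ?S" and eq: "?N y = ?N y'"
    have no: "\<not> norm (a - x0) < norm (b - x0)" if "a \<in> ?S" "b \<in> ?S" "?N a = ?N b" for a b
    proof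
      assume lt: "norm (a - x0) < norm (b - x0)"
      have na: "0 < norm (a - x0)" "0 < norm (b - x0)" using that by (auto simp: punctured_iff)
      let ?\<mu> = "norm (a - x0) / norm (b - x0)"
      have "a - x0 = norm (a - x0) *\<^sub>R ?N a" using na by (simp add: sgn_div_norm)
      also have "\<dots> = ?\<mu> *\<^sub>R (b - x0)" unfolding that(3) by (simp add: sgn_div_norm divide_inverse)
      finally have "a = x0 + ?\<mu> *\<^sub>R (b - x0)" by (simp add: algebra_simps)
      moreover have "f (x0 + ?\<mu> *\<^sub>R (b - x0)) < f b"
        using that(2) na lt by (intro strictly_increasing_on_rays) auto
      ultimately show False using that(1,2) by simp
    qed
    have "norm (y - x0) = norm (y' - x0)" using no[OF y eq] no[OF y(2,1) eq[symmetric]] by linarith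
    moreover have "y - x0 = norm (y - x0) *\<^sub>R ?N y" "y' - x0 = norm (y' - x0) *\<^sub>R ?N y'"
      using y by (auto simp: punctured_iff sgn_div_norm)
    ultimately have "y - x0 = y' - x0" using eq by simp
    then show "y = y'" by simp
  qed
  have im: "?N ` ?S = sphere 0 1"
  proof
    show "?N ` ?S \<subseteq> sphere 0 1" by (auto simp: norm_sgn punctured_iff)
    show "sphere 0 1 \<subseteq> ?N ` ?S"
    proof
      fix \<theta> :: "real^'n" assume "\<theta> \<in> sphere 0 1"
      then have \<theta>: "norm \<theta> = 1" by simp
      define a where "a = min t s1 / 2"
      have a: "0 < a" "a < t" "a < s1" using t s1 by (auto simp: a_def)
      have P: "x0 + \<tau> *\<^sub>R \<theta> \<in> punctured" if "\<tau> \<in> {a..s1}" for \<tau>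
        using that a s1 \<theta> by (auto simp: punctured_iff)
      have "continuous_on {a..s1} (\<lambda>\<tau>. f (x0 + \<tau> *\<^sub>R \<theta>))"
        by (rule continuous_on_compose2[OF continuous]) (use P in \<open>auto intro!: continuous_intros\<close>)
      moreover have "f (x0 + a *\<^sub>R \<theta>) \<le> r" using near[of "x0 + a *\<^sub>R \<theta>"] a \<theta> by auto
      moreover have "r \<le> f (x0 + s1 *\<^sub>R \<theta>)" using far[of "x0 + s1 *\<^sub>R \<theta>"] s1 \<theta> by auto
      ultimately obtain \<tau> where \<tau>: "a \<le> \<tau>" "\<tau> \<le> s1" "f (x0 + \<tau> *\<^sub>R \<theta>) = r"
        using IVT'[of "\<lambda>\<tau>. f (x0 + \<tau> *\<^sub>R \<theta>)" a r s1] a by auto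
      then have mem: "x0 + \<tau> *\<^sub>R \<theta> \<in> ?S" using P by auto
      have "\<theta> = ?N (x0 + \<tau> *\<^sub>R \<theta>)" using \<tau> a \<theta> by (simp add: sgn_div_norm)
      then show "\<theta> \<in> ?N ` ?S" using mem by (rule image_eqI)
    qed
  qed
  show ?thesis by (rule homeomorphic_compact[OF cS cN im inj])
qed

end

section \<open>The modulus metric as a radial gauge\<close>

lemma vertex_of_cone_in_mono: "vertex_of_cone_in x A \<Longrightarrow> A \<subseteq> B \<Longrightarrow> vertex_of_cone_in x B"
  unfolding vertex_of_cone_in_def by (meson order_trans)

text \<open>The last conjunct concerns all points of the space and will exclude points outside the gauge
  neighbourhood from small spheres and balls.\<close>

lemma radial_gauge_modulus_metric:
  fixes D :: "(real^'n) set"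
  assumes n: "2 \<le> CARD('n)"
    and D: "open D" "x0 \<in> D" and pos: "positive_capacity (extended_space frontier_of (Some ` D))"
  shows "\<exists>s0 f. radial_gauge f x0 s0 \<and> ball x0 s0 \<subseteq> D \<and>
    (\<forall>y. 0 < norm (y - x0) \<longrightarrow> norm (y - x0) < s0 \<longrightarrow> modulus_metric D x0 y = ennreal (f y)) \<and>
    (\<forall>s>0. s < s0 \<longrightarrow> (\<exists>m0>0. \<forall>y. s \<le> norm (y - x0) \<longrightarrow> ennreal m0 \<le> modulus_metric D x0 y))"
proof -
  obtain R where R: "0 < R" "cball x0 R \<subseteq> D" using D open_contains_cball by blast
  obtain s0 where s0: "0 < s0" "2 * exp 3 * s0 \<le> R" and contr: "\<And>y \<delta>. 0 < norm (y - x0) \<Longrightarrow> norm (y - x0) < s0 \<Longrightarrow> 0 < \<delta> \<Longrightarrow> \<delta> \<le> 1/10 \<Longrightarrow>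
    modulus_metric D x0 (x0 + exp (- \<delta>) *\<^sub>R (y - x0)) \<le>
      ennreal (1 - \<delta> / (4 * (ln (R / norm (y - x0)) - 1))) * modulus_metric D x0 y"
    using modulus_metric_radial_contraction[OF n D pos R] by blast
  have below: "2 * exp 3 * s \<le> R" if "s \<le> s0" for s
  proof -
    have "2 * exp 3 * s \<le> 2 * exp 3 * s0" using that by (intro mult_left_mono) auto
    then show ?thesis using s0(2) by linarith
  qed
  have e2: "exp 2 * s \<le> R" if "0 < s" "s \<le> s0" for s
  proof -
    have "exp 2 \<le> exp (3::real)" by simp
    then have "exp 2 * s \<le> exp 3 * s" using that by (intro mult_right_mono) auto
    also have "\<dots> \<le> 2 * exp 3 * s" using that by simp
    finally show ?thesis using below[OF that(2)] by linarith
  qed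
  have far: "\<exists>m0>0. \<forall>y. s \<le> norm (y - x0) \<longrightarrow> ennreal m0 \<le> modulus_metric D x0 y" if "0 < s" "s \<le> s0" for s
    by (rule modulus_metric_far_lower_bound[OF D pos R that(1) below[OF that(2)]])
  define f where "f y = enn2real (modulus_metric D x0 y)" for y
  have fin: "modulus_metric D x0 y < \<infinity>" if y: "0 < norm (y - x0)" "norm (y - x0) < s0" for y
  proof -
    interpret log_cutoff_radii "norm (y - x0)" R using y e2[of "norm (y - x0)"] by unfold_locales auto
    have "y \<noteq> x0" using y by auto
    from modulus_metric_le_log[OF R(2) this order_refl] show ?thesis
      by (rule le_less_trans) simp
  qed
  have mf: "modulus_metric D x0 y = ennreal (f y)" if "0 < norm (y - x0)" "norm (y - x0) < s0" for y
    using fin[OF that] by (simp add: f_def)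
  have fpos: "0 < f y" if y: "0 < norm (y - x0)" "norm (y - x0) < s0" for y
  proof -
    obtain m0 where m0: "m0 > 0" "ennreal m0 \<le> modulus_metric D x0 y"
      using far[of "norm (y - x0)"] y by auto
    then show ?thesis unfolding mf[OF y] using ennreal_le_iff2 by force
  qed
  have sR: "s0 \<le> R"
  proof -
    have "1 * s0 \<le> exp 2 * s0" using s0 by (intro mult_right_mono) auto
    then show ?thesis using e2[of s0] s0 by linarith
  qed
  have bD: "ball x0 s0 \<subseteq> D" using sR R(2) by (meson ball_subset_cball order_trans subset_ball)
  have "radial_gauge f x0 s0"
  proof
    show "0 < s0" by (rule s0)
    show "0 < f y" if "0 < norm (y - x0)" "norm (y - x0) < s0" for y by (rule fpos[OF that])
    show "\<exists>t>0. \<forall>y. 0 < norm (y - x0) \<longrightarrow> norm (y - x0) < t \<longrightarrow> f y < r" if r: "0 < r" for r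
    proof -
      obtain t where t: "0 < t" "\<And>y. 0 < norm (y - x0) \<Longrightarrow> norm (y - x0) < t \<Longrightarrow> modulus_metric D x0 y < ennreal r"
        using modulus_metric_small_near_center[OF n R r] by blast
      have "f y < r" if "0 < norm (y - x0)" "norm (y - x0) < min t s0" for y
        using t(2)[of y] that fpos[of y] by (simp add: mf ennreal_less_iff less_imp_le)
      then show ?thesis using t(1) s0(1) by (intro exI[of _ "min t s0"]) auto
    qed
    show "\<exists>C\<ge>0. \<exists>\<rho>>0. ball y \<rho> \<subseteq> ball x0 s0 - {x0} \<and> (\<forall>z\<in>ball y \<rho>. \<forall>z'\<in>ball y \<rho>. f z' \<le> (1 + C * dist z z') * f z)"
      if y: "0 < norm (y - x0)" "norm (y - x0) < s0" for y
    proof -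
      have yP: "y \<in> ball x0 s0 - {x0}" using y by (auto simp: dist_norm norm_minus_commute)
      have "open (ball x0 s0 - {x0})" by auto
      then obtain \<rho>1 where \<rho>1: "0 < \<rho>1" "ball y \<rho>1 \<subseteq> ball x0 s0 - {x0}" using yP open_contains_ball by blast
      have yD: "y \<in> D" "y \<noteq> x0" using yP bD by auto
      obtain C \<rho>2 where C: "0 \<le> C" "0 < \<rho>2" and L: "\<forall>z\<in>ball y \<rho>2. \<forall>z'\<in>ball y \<rho>2.
          modulus_metric D x0 z' \<le> ennreal (1 + C * dist z z') * modulus_metric D x0 z"
        using modulus_metric_locally_lipschitz[OF D(1) yD] by (elim exE conjE) (rule that)
      let ?\<rho> = "min \<rho>1 \<rho>2"
      have "f z' \<le> (1 + C * dist z z') * f z" if z: "z \<in> ball y ?\<rho>" "z' \<in> ball y ?\<rho>" for z z'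
      proof -
        have "z \<in> ball x0 s0 - {x0}" "z' \<in> ball x0 s0 - {x0}" using z \<rho>1(2) by auto
        then have P: "0 < norm (z - x0)" "norm (z - x0) < s0" "0 < norm (z' - x0)" "norm (z' - x0) < s0"
          by (auto simp: dist_norm norm_minus_commute)
        have "modulus_metric D x0 z' \<le> ennreal (1 + C * dist z z') * modulus_metric D x0 z"
          using L z by auto
        also have "\<dots> = ennreal ((1 + C * dist z z') * f z)"
          unfolding mf[OF P(1,2)] using C fpos[OF P(1,2)] by (intro ennreal_mult[symmetric]) auto
        finally have "ennreal (f z') \<le> ennreal ((1 + C * dist z z') * f z)" unfolding mf[OF P(3,4)] .
        then show ?thesis using C fpos[OF P(1,2)] by (subst (asm) ennreal_le_iff) auto
      qed
      moreover have "ball y ?\<rho> \<subseteq> ball x0 s0 - {x0}" using \<rho>1(2) by auto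
      ultimately show ?thesis using C \<rho>1(1) by (intro exI[of _ C] conjI exI[of _ ?\<rho>]) auto
    qed
    show "\<exists>c>0. \<forall>y \<delta>. t \<le> norm (y - x0) \<longrightarrow> norm (y - x0) < s0 \<longrightarrow> 0 < \<delta> \<longrightarrow> \<delta> \<le> 1/10 \<longrightarrow>
       f (x0 + exp (- \<delta>) *\<^sub>R (y - x0)) \<le> (1 - c * \<delta>) * f y" if t: "0 < t" for t
    proof -
      define M where "M = max 1 (ln (R / t) - 1)"
      have M: "1 \<le> M" by (simp add: M_def)
      have "f (x0 + exp (- \<delta>) *\<^sub>R (y - x0)) \<le> (1 - 1 / (4 * M) * \<delta>) * f y"
        if y: "t \<le> norm (y - x0)" "norm (y - x0) < s0" and \<delta>: "0 < \<delta>" "\<delta> \<le> 1/10" for y \<delta>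
      proof -
        have y0: "0 < norm (y - x0)" using y t by linarith
        interpret log_cutoff_radii "norm (y - x0)" R using y0 y e2[of "norm (y - x0)"] by unfold_locales auto
        let ?M = "ln (R / norm (y - x0)) - 1"
        let ?z = "x0 + exp (- \<delta>) *\<^sub>R (y - x0)"
        have M1: "1 \<le> ?M" using ln_ratio_ge by simp
        have "R / norm (y - x0) \<le> R / t" using y(1) R(1) mult_pos_pos[OF y0 t] by (intro divide_left_mono) auto
        then have "ln (R / norm (y - x0)) \<le> ln (R / t)" using R y0 t by (subst ln_le_cancel_iff) auto
        then have M2: "?M \<le> M" by (simp add: M_def)
        have "\<delta> / (4 * M) \<le> \<delta> / (4 * ?M)" using M1 M2 \<delta> by (intro divide_left_mono) auto
        then have le: "1 - \<delta> / (4 * ?M) \<le> 1 - 1 / (4 * M) * \<delta>" by simp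
        have "1 / (4 * M) * \<delta> \<le> 1 * (1/10)" using M \<delta> by (intro mult_mono) auto
        then have k0: "0 \<le> 1 - 1 / (4 * M) * \<delta>" by simp
        have "exp (- \<delta>) * norm (y - x0) \<le> 1 * norm (y - x0)" using \<delta> by (intro mult_right_mono) auto
        moreover have "norm (?z - x0) = exp (- \<delta>) * norm (y - x0)" by simp
        ultimately have z: "0 < norm (?z - x0)" "norm (?z - x0) < s0"
          using y(2) mult_pos_pos[OF exp_gt_zero[of "- \<delta>"] y0] by linarith+
        have "ennreal (f ?z) \<le> ennreal (1 - \<delta> / (4 * ?M)) * ennreal (f y)"
          using contr[OF y0 y(2) \<delta>] unfolding mf[OF z] mf[OF y0 y(2)] .
        also have "\<dots> \<le> ennreal (1 - 1 / (4 * M) * \<delta>) * ennreal (f y)"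
          by (intro mult_right_mono ennreal_leI le) simp
        also have "\<dots> = ennreal ((1 - 1 / (4 * M) * \<delta>) * f y)"
          using k0 fpos[OF y0 y(2)] by (intro ennreal_mult[symmetric]) auto
        finally show ?thesis
          using mult_nonneg_nonneg[OF k0 less_imp_le[OF fpos[OF y0 y(2)]]] by (simp only: ennreal_le_iff)
      qed
      then show ?thesis using M by (intro exI[of _ "1 / (4 * M)"]) auto
    qed
  qed
  then show ?thesis using bD mf far by (intro exI[of _ s0] exI[of _ f]) (auto intro: less_imp_le)
qed

theorem theorem2:
  fixes D :: "(real^'n) set" and x0 :: "real^'n"
  assumes "CARD('n) \<ge> 2"
    and "open D" and "connected D" and "x0 \<in> D"
    and "positive_capacity (extended_space frontier_of (Some ` D))"
  shows "\<exists>r0>0. \<forall>r::real. 0 < r \<and> r < r0 \<longrightarrow>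
           modulus_sphere D x0 r homeomorphic sphere (0::real^'n) 1 \<and>
           interior_cone_condition D x0 r \<and>
           exterior_cone_condition D x0 r \<and>
           starlike_wrt x0 (modulus_ball D x0 r)"
proof -
  obtain s0 f where gauge: "radial_gauge f x0 s0" and bD: "ball x0 s0 \<subseteq> D"
    and mf: "\<And>y. 0 < norm (y - x0) \<Longrightarrow> norm (y - x0) < s0 \<Longrightarrow> modulus_metric D x0 y = ennreal (f y)"
    and far: "\<And>s. 0 < s \<Longrightarrow> s < s0 \<Longrightarrow> \<exists>m0>0. \<forall>y. s \<le> norm (y - x0) \<longrightarrow> ennreal m0 \<le> modulus_metric D x0 y"
    using radial_gauge_modulus_metric[OF assms(1,2,4,5)] by blast
  interpret radial_gauge f x0 s0 by (rule gauge)
  \<comment> \<open>Any \<open>s1\<close> below \<open>s0\<close> would do: the radius \<open>r0\<close> must keep the balls in a compact part of the neighbourhood.\<close>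
  define s1 where "s1 = s0 / 2"
  have s1: "0 < s1" "s1 < s0" using s0 by (auto simp: s1_def)
  obtain r0 where r0: "0 < r0" "\<And>y. s1 \<le> norm (y - x0) \<Longrightarrow> ennreal r0 \<le> modulus_metric D x0 y"
    using far[OF s1] by blast
  have PD: "punctured \<subseteq> D" using bD by (auto simp: punctured_def)
  have mP: "modulus_metric D x0 y = ennreal (f y)" "0 < f y" if "y \<in> punctured" for y
    using that mf[of y] pos[of y] by (auto simp: punctured_iff)
  have mx0: "modulus_metric D x0 x0 = 0" by (simp add: modulus_metric_def)
  have "modulus_sphere D x0 r homeomorphic sphere (0::real^'n) 1 \<and> interior_cone_condition D x0 r \<and>
        exterior_cone_condition D x0 r \<and> starlike_wrt x0 (modulus_ball D x0 r)" if r: "0 < r" "r < r0" for r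
  proof -
    have inP: "y \<in> punctured" if "modulus_metric D x0 y \<le> ennreal r" "y \<noteq> x0" for y
    proof -
      have "ennreal r < ennreal r0" using r by (simp add: ennreal_less_iff)
      then have "\<not> s1 \<le> norm (y - x0)" using r0(2)[of y] that(1) by (meson leD le_less_trans order_trans)
      then show ?thesis using that(2) s1 by (auto simp: punctured_iff)
    qed
    have sph: "modulus_sphere D x0 r = {y \<in> punctured. f y = r}"
    proof (intro equalityI subsetI)
      fix y assume y: "y \<in> modulus_sphere D x0 r"
      then have "y \<noteq> x0" using r mx0 by (auto simp: modulus_sphere_def)
      then have P: "y \<in> punctured" using y by (intro inP) (auto simp: modulus_sphere_def)
      then show "y \<in> {y \<in> punctured. f y = r}" using y r mP[OF P] by (auto simp: modulus_sphere_def)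
    next
      fix y assume "y \<in> {y \<in> punctured. f y = r}"
      then show "y \<in> modulus_sphere D x0 r" using PD mP[of y] by (auto simp: modulus_sphere_def)
    qed
    have bal: "modulus_ball D x0 r = insert x0 {y \<in> punctured. f y < r}"
    proof (intro equalityI subsetI)
      fix y assume y: "y \<in> modulus_ball D x0 r"
      show "y \<in> insert x0 {y \<in> punctured. f y < r}"
      proof (cases "y = x0")
        case False
        then have P: "y \<in> punctured" using y by (intro inP) (auto simp: modulus_ball_def)
        then show ?thesis using y r mP[OF P] by (auto simp: modulus_ball_def ennreal_less_iff)
      qed simp
    next
      fix y assume "y \<in> insert x0 {y \<in> punctured. f y < r}"
      then show "y \<in> modulus_ball D x0 r"
        using PD mP[of y] assms(4) mx0 r by (auto simp: modulus_ball_def ennreal_less_iff)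
    qed
    have "r < f y" if "s1 \<le> norm (y - x0)" "norm (y - x0) < s0" for y
    proof -
      have y: "y \<in> punctured" using that s1 by (auto simp: punctured_iff)
      then have "ennreal r0 \<le> ennreal (f y)" using r0(2)[OF that(1)] mP[OF y] by simp
      then have "r0 \<le> f y" using mP(2)[OF y] by (simp add: ennreal_le_iff)
      then show ?thesis using r by simp
    qed
    then have 1: "modulus_sphere D x0 r homeomorphic sphere (0::real^'n) 1"
      unfolding sph by (rule level_set_homeomorphic_sphere[OF s1 r(1)])
    have 2: "interior_cone_condition D x0 r"
      unfolding interior_cone_condition_def sph bal
      by (auto intro!: vertex_of_cone_in_mono[OF interior_cone])
    have 3: "exterior_cone_condition D x0 r"
      unfolding exterior_cone_condition_def
    proof
      fix y assume "y \<in> modulus_sphere D x0 r"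
      then have y: "y \<in> punctured" "f y = r" by (auto simp: sph)
      let ?U = "{z \<in> punctured. f y < f z}"
      have "open (punctured \<inter> f -` {r<..})"
        by (rule continuous_open_preimage[OF continuous open_punctured]) simp
      moreover have "?U = punctured \<inter> f -` {r<..}" using y by auto
      ultimately have "open ?U" by simp
      moreover have "?U \<inter> modulus_ball D x0 r = {}" using y by (auto simp: bal punctured_def)
      ultimately have "?U \<inter> closure (modulus_ball D x0 r) = {}" using open_Int_closure_eq_empty by blast
      then have "?U \<subseteq> D - closure (modulus_ball D x0 r)" using PD by auto
      then show "vertex_of_cone_in y (D - closure (modulus_ball D x0 r))"
        by (rule vertex_of_cone_in_mono[OF exterior_cone[OF y(1)]])
    qed
    have 4: "starlike_wrt x0 (modulus_ball D x0 r)"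
      unfolding starlike_wrt_def
    proof (intro ballI subsetI)
      fix y w assume y: "y \<in> modulus_ball D x0 r" and w: "w \<in> closed_segment x0 y"
      then obtain \<mu> where \<mu>: "0 \<le> \<mu>" "\<mu> \<le> 1" "w = x0 + \<mu> *\<^sub>R (y - x0)"
        by (auto simp: in_segment algebra_simps)
      show "w \<in> modulus_ball D x0 r"
      proof (cases "y = x0 \<or> \<mu> = 0 \<or> \<mu> = 1")
        case True
        then show ?thesis using y \<mu>(3) bal by auto
      next
        case False
        then have yP: "y \<in> punctured" "f y < r" using y by (auto simp: bal)
        have "f w < f y" unfolding \<mu>(3) using False \<mu> by (intro strictly_increasing_on_rays yP) auto
        moreover have "w \<in> punctured" unfolding \<mu>(3) using False \<mu> by (intro scaled_in_punctured yP) auto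
        ultimately show ?thesis using yP by (auto simp: bal)
      qed
    qed
    show ?thesis using 1 2 3 4 by blast
  qed
  then show ?thesis using r0(1) by blast
qed

end
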